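(* Let $\mu_0=N(m_0,C_0)$ be a Gaussian measure on $\mathcal H$ with mean $m_0\in\mathcal H$ and (strictly positive, trace-class) covariance operator $C_0$, and let $\mu$ be given by $\frac{d\mu}{d\mu_0}(x)=\frac1{Z_\mu}\exp(-\Phi(x))$. Let $\mathcal A$ be any of the following sets: (1) all Gaussian measures on $\mathcal H$; (2) all Gaussian measures on $\mathcal H$ equivalent to $\mu_0$; (3) all Gaussian measures on $\mathcal H$ with a fixed trace-class covariance operator $\hat C$; (4) all Gaussian measures on $\mathcal H$ with a fixed mean $\hat m\in\mathcal H$. For any fixed $N\in\mathbb N$, $N\ge1$, let $$\mathcal C=\Big\{\sum_{i=1}^N p^i\nu^i:\ 0\le p^i\le1,\ \sum_{i=1}^Np^i=1,\ \nu^i\in\mathcal A\Big\}.$$ Then, as soon as there exists a single $\nu\in\mathcal A$ with $D_{\rm KL}(\nu\|\mu)<\infty$, there exists a minimiser of $\nu\mapsto D_{\rm KL}(\nu\|\mu)$ in $\mathcal C$. This minimiser is necessarily equivalent to $\mu_0$ in the sense of measures.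
   Context: $\mathcal H$ is a separable Hilbert space with its Borel $\sigma$-algebra; $N(m,C)$ denotes the Gaussian measure with mean $m$ and covariance operator $C$ (Dirac measures count as Gaussian). $X\subseteq\mathcal H$ is a separable Banach space continuously embedded in $\mathcal H$, Borel measurable as a subset of $\mathcal H$, with $\mu_0(X)=1$; $\Phi:X\to\mathbb R$ is continuous in the topology of $X$, $\exp(-\Phi)$ is $\mu_0$-integrable, $Z_\mu=\int\exp(-\Phi)\,d\mu_0$. $D_{\rm KL}(\nu\|\mu)=\int \log\big(\frac{d\nu}{d\mu}\big)\,d\nu$ if $\nu\ll\mu$ and $+\infty$ otherwise. Measures are equivalent if mutually absolutely continuous. *)

theory Defs
  imports "HOL-Probability.Probability"
begin

text \<open>
  A separable real Hilbert space is a type of sort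
  \<open>{banach, real_inner, second_countable_topology}\<close>.
\<close>

definition orthonormal_basis :: "'h::real_inner set \<Rightarrow> bool" where
  "orthonormal_basis B \<longleftrightarrow>
     pairwise orthogonal B \<and> (\<forall>e\<in>B. norm e = 1) \<and> closure (span B) = UNIV"

text \<open>
  For a positive operator the absolute value is the operator itself, so being of trace class
  means that the (unconditionally summed) diagonal series converges.
\<close>

definition covariance_operator :: "('h::real_inner \<Rightarrow>\<^sub>L 'h) \<Rightarrow> bool" where
  "covariance_operator C \<longleftrightarrow>
     (\<forall>h k. C h \<bullet> k = h \<bullet> C k) \<and>
     (\<forall>h. 0 \<le> C h \<bullet> h) \<and>
     (\<forall>B. orthonormal_basis B \<longrightarrow> (\<lambda>e. C e \<bullet> e) summable_on B)"

definition strictly_positive :: "('h::real_inner \<Rightarrow>\<^sub>L 'h) \<Rightarrow> bool" where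
  "strictly_positive C \<longleftrightarrow> (\<forall>h. h \<noteq> 0 \<longrightarrow> 0 < C h \<bullet> h)"

definition gaussian_on_reals :: "real measure \<Rightarrow> bool" where
  "gaussian_on_reals M \<longleftrightarrow>
     (\<exists>a. M = return borel a) \<or>
     (\<exists>a s. 0 < s \<and> M = density lborel (\<lambda>x. ennreal (normal_density a s x)))"

definition gaussian_measure :: "'h::real_normed_vector measure \<Rightarrow> bool" where
  "gaussian_measure M \<longleftrightarrow>
     prob_space M \<and> sets M = sets borel \<and>
     (\<forall>f. bounded_linear f \<longrightarrow> gaussian_on_reals (distr M borel f))"

text \<open>
  Mean and covariance are taken in the weak sense: \<open>\<langle>m, h\<rangle> = \<integral> \<langle>x, h\<rangle> dM\<close> and
  \<open>\<langle>C h, k\<rangle> = \<integral> \<langle>x - m, h\<rangle> \<langle>x - m, k\<rangle> dM\<close>.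
\<close>

definition has_mean :: "'h::real_inner measure \<Rightarrow> 'h \<Rightarrow> bool" where
  "has_mean M m \<longleftrightarrow> (\<forall>h. has_bochner_integral M (\<lambda>x. x \<bullet> h) (m \<bullet> h))"

definition has_covariance :: "'h::real_inner measure \<Rightarrow> ('h \<Rightarrow>\<^sub>L 'h) \<Rightarrow> bool" where
  "has_covariance M C \<longleftrightarrow>
     (\<exists>m. has_mean M m \<and>
       (\<forall>h k. has_bochner_integral M (\<lambda>x. ((x - m) \<bullet> h) * ((x - m) \<bullet> k)) (C h \<bullet> k)))"

definition equivalent_measures :: "'a measure \<Rightarrow> 'a measure \<Rightarrow> bool" where
  "equivalent_measures M N \<longleftrightarrow> absolutely_continuous M N \<and> absolutely_continuous N M"

text \<open>
  \<open>KL \<nu> \<mu>\<close> is the divergence of \<open>\<nu>\<close> from \<open>\<mu>\<close>; note the reversed argument order of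
  \<^const>\<open>KL_divergence\<close>, which moreover is real-valued and \<open>0\<close> when the log-density is not integrable.
  For probability measures the negative part of the log-density is always \<open>\<nu>\<close>-integrable,
  so the integral is \<open>\<infinity>\<close> whenever the log-density is not integrable.
\<close>

definition KL :: "'a measure \<Rightarrow> 'a measure \<Rightarrow> ereal" where
  "KL \<nu> \<mu> =
     (if absolutely_continuous \<mu> \<nu> \<and> integrable \<nu> (entropy_density (exp 1) \<mu> \<nu>)
      then ereal (KL_divergence (exp 1) \<mu> \<nu>) else \<infinity>)"

text \<open>
  The space \<open>X\<close> is a type of its own, and \<open>\<iota>\<close> is its embedding into the Hilbert space.
  The density is zero outside \<open>X\<close>, which is a null set of the reference measure.
\<close>

definition normalising_constant :: "'h measure \<Rightarrow> ('x \<Rightarrow> 'h) \<Rightarrow> ('x \<Rightarrow> real) \<Rightarrow> real" where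
  "normalising_constant \<mu>0 \<iota> \<Phi> = (LINT x:range \<iota>|\<mu>0. exp (- \<Phi> (inv \<iota> x)))"

definition target_measure :: "'h measure \<Rightarrow> ('x \<Rightarrow> 'h) \<Rightarrow> ('x \<Rightarrow> real) \<Rightarrow> 'h measure" where
  "target_measure \<mu>0 \<iota> \<Phi> =
     density \<mu>0 (\<lambda>x. ennreal
       (indicator (range \<iota>) x * (exp (- \<Phi> (inv \<iota> x)) / normalising_constant \<mu>0 \<iota> \<Phi>)))"

definition mixtures :: "nat \<Rightarrow> 'h::topological_space measure set \<Rightarrow> 'h measure set" where
  "mixtures N A =
     {\<nu>. sets \<nu> = sets borel \<and>
         (\<exists>(p :: nat \<Rightarrow> real) \<nu>s.
            (\<forall>i\<in>{1..N}. 0 \<le> p i \<and> p i \<le> 1 \<and> \<nu>s i \<in> A) \<and>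
            (\<Sum>i=1..N. p i) = 1 \<and>
            (\<forall>B\<in>sets borel. emeasure \<nu> B = (\<Sum>i=1..N. ennreal (p i) * emeasure (\<nu>s i) B)))}"

end

theory Submission
  imports Defs
begin

text \<open>
  Sublevel sets of the divergence are compact for setwise convergence: a bound on the divergence
  makes a sequence of measures uniformly absolutely continuous with respect to the target, so that
  a diagonal subsequence converges on every Borel set, and the divergence is lower semicontinuous
  because it is the supremum of \<open>\<integral>h d\<nu> + 1 - \<integral>exp h d\<mu>\<close> over bounded \<open>h\<close>. In a minimising sequence
  of mixtures each component whose weight stays away from \<open>0\<close> inherits the uniform absolute
  continuity and hence converges along a subsequence; the other components disappear in the limit
  and may be replaced by any member of the class. Each of the four classes contains the setwise
  limits of its sequences that are absolutely continuous with respect to \<open>\<mu>0\<close>, because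
  one-dimensional normal laws converge only together with their parameters.

  For the second class, and for the equivalence of a minimiser with \<open>\<mu>0\<close>, one needs half of the
  Feldman--Hajek dichotomy: a Gaussian measure \<open>\<nu> \<lless> \<mu>0\<close> also satisfies \<open>\<mu>0 \<lless> \<nu>\<close>. On finitely many
  functionals both measures become products of normal laws after a simultaneous diagonalisation.
  Absolute continuity bounds the Hellinger affinity of the products from below, independently of
  the number of functionals; this bounds the sum of the reverse divergences from above, and the
  Gibbs inequality turns that into \<open>K \<mu>0(U) \<le> M + exp(K) \<nu>(U)\<close>, first for cylinder sets and then
  for all open sets.
\<close>

section \<open>Setwise compactness\<close>

text \<open>Setwise convergence is chosen because it passes to images under linear functionals, so
  that Gaussianity, mean and covariance can all be examined on one functional at a time. It controls
  bounded integrands only, whereas means and variances are integrals of unbounded ones; hence the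
  detour through parameters of one-dimensional laws, with medians and characteristic functions
  supplying the a priori bounds.

  In the dichotomy the obstacle is uniformity in the number of functionals. Minus the logarithm of
  the affinity and the divergence are both additive over independent coordinates, and for a pair
  \<open>N(a, 1)\<close>, \<open>N(b, s\<^sup>2)\<close> the second is at most a constant times the
  first as long as the affinity stays away from \<open>0\<close>. A lower bound on the total
  affinity provides one such constant for all coordinates, so the sum of the divergences is bounded
  whatever the dimension. All of this happens in finite-dimensional spans of functionals; no square
  roots of covariance operators and no Hilbert-Schmidt condition appear.\<close>

definition setwise_limit :: "(nat \<Rightarrow> 'a measure) \<Rightarrow> 'a measure \<Rightarrow> bool" where
  "setwise_limit V M \<longleftrightarrow> (\<forall>B\<in>sets M. (\<lambda>n. measure (V n) B) \<longlonglongrightarrow> measure M B)"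

definition uniformly_ac :: "(nat \<Rightarrow> 'a measure) \<Rightarrow> 'a measure \<Rightarrow> bool" where
  "uniformly_ac V M \<longleftrightarrow>
     (\<forall>\<epsilon>>0. \<exists>\<delta>>0. \<forall>n. \<forall>B\<in>sets M. measure M B < \<delta> \<longrightarrow> measure (V n) B < \<epsilon>)"

lemma uniformly_acD:
  "uniformly_ac V M \<Longrightarrow> 0 < \<epsilon> \<Longrightarrow>
    \<exists>\<delta>>0. \<forall>n. \<forall>B\<in>sets M. measure M B < \<delta> \<longrightarrow> measure (V n) B < \<epsilon>"
  unfolding uniformly_ac_def by simp

lemma setwise_limit_subseq:
  "setwise_limit V M \<Longrightarrow> strict_mono r \<Longrightarrow> setwise_limit (V \<circ> r) M"
  unfolding setwise_limit_def using LIMSEQ_subseq_LIMSEQ by (fastforce simp: comp_def)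

lemma diagonal_convergent:
  fixes f :: "nat \<Rightarrow> nat \<Rightarrow> real"
  assumes bdd: "\<And>n k. \<bar>f n k\<bar> \<le> C k"
  shows "\<exists>r :: nat \<Rightarrow> nat. strict_mono r \<and> (\<forall>k. convergent (\<lambda>n. f (r n) k))"
proof -
  let ?P = "\<lambda>k s. convergent (\<lambda>n. f (s n) k)"
  interpret nat: subseqs ?P
  proof
    fix k :: nat and s :: "nat \<Rightarrow> nat"
    have "bounded (range (\<lambda>n. f (s n) k))"
      using bdd by (auto intro!: boundedI)
    then obtain l r where "strict_mono r" "((\<lambda>n. f (s n) k) \<circ> r) \<longlonglongrightarrow> l"
      using bounded_imp_convergent_subsequence by blast
    then show "\<exists>r. strict_mono r \<and> convergent (\<lambda>n. f ((s \<circ> r) n) k)"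
      by (auto simp: comp_def convergent_def)
  qed
  have "?P k nat.diagseq" for k
  proof -
    \<comment> \<open>The diagonal sequence refines the \<open>k\<close>-th stage only from index
      \<open>Suc k\<close> on; dropping an initial segment does not affect convergence.\<close>
    have "?P k (nat.diagseq \<circ> (+) (Suc k))"
    proof (rule nat.diagseq_holds)
      fix r s :: "nat \<Rightarrow> nat" and n
      assume "strict_mono r" "convergent (\<lambda>m. f (s m) n)"
      then show "convergent (\<lambda>m. f ((s \<circ> r) m) n)"
        using convergent_subseq_convergent[of "\<lambda>m. f (s m) n" r] by (simp add: comp_def)
    qed
    then have "convergent (\<lambda>m. f (nat.diagseq (m + Suc k)) k)"
      by (simp add: comp_def add.commute)
    then show ?thesis
      using convergent_ignore_initial_segment[of "\<lambda>m. f (nat.diagseq m) k" "Suc k"] by simp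
  qed
  then show ?thesis using nat.subseq_diagseq by blast
qed

lemma measure_diff_le_sym_diff:
  assumes "finite_measure M" "A \<in> sets M" "B \<in> sets M"
  shows "\<bar>measure M A - measure M B\<bar> \<le> measure M ((A - B) \<union> (B - A))"
proof -
  interpret finite_measure M by fact
  have "measure M A \<le> measure M (B \<union> ((A - B) \<union> (B - A)))"
    using assms by (intro finite_measure_mono) auto
  also have "\<dots> \<le> measure M B + measure M ((A - B) \<union> (B - A))"
    using assms by (intro measure_Un_le) auto
  finally have 1: "measure M A \<le> \<dots>" .
  have "measure M B \<le> measure M (A \<union> ((A - B) \<union> (B - A)))"
    using assms by (intro finite_measure_mono) auto
  also have "\<dots> \<le> measure M A + measure M ((A - B) \<union> (B - A))"
    using assms by (intro measure_Un_le) auto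
  finally show ?thesis using 1 by linarith
qed

text \<open>Separability of the measure algebra: outer regularity replaces a Borel set by an open
  one, and continuity from below replaces the open set by a finite union of members of a countable
  basis.\<close>

lemma countable_dense_family:
  fixes M :: "'a::{second_countable_topology, complete_space} measure"
  assumes fin: "finite_measure M" and sb: "sets M = sets borel"
  shows "\<exists>D :: nat \<Rightarrow> 'a set. (\<forall>k. D k \<in> sets borel) \<and>
    (\<forall>B\<in>sets borel. \<forall>\<delta>>0. \<exists>k. measure M ((B - D k) \<union> (D k - B)) < \<delta>)"
proof -
  interpret finite_measure M by fact
  obtain \<B> :: "'a set set" where cb: "countable \<B>" and tb: "topological_basis \<B>"
    using ex_countable_basis by blast
  define \<D> where "\<D> = Union ` {F. finite F \<and> F \<subseteq> \<B>}"
  have cD: "countable \<D>" unfolding \<D>_def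
    using cb by (intro countable_image countable_Collect_finite_subset)
  have "{} \<in> \<D>" unfolding \<D>_def by (auto intro!: image_eqI[of _ _ "{}"])
  then have rng: "range (from_nat_into \<D>) = \<D>"
    using cD by (intro range_from_nat_into) auto
  have oD: "open X" if "X \<in> \<D>" for X
    using that topological_basis_open[OF tb] unfolding \<D>_def by (auto intro!: open_Union)
  have appr: "\<exists>X\<in>\<D>. measure M ((B - X) \<union> (X - B)) < \<delta>"
    if B: "B \<in> sets borel" and \<delta>: "\<delta> > 0" for B and \<delta> :: real
  proof -
    have "emeasure M B = (INF U\<in>{U. B \<subseteq> U \<and> open U}. emeasure M U)"
      using outer_regular[OF sb _ B] by (simp add: emeasure_eq_measure)
    moreover have "emeasure M B < emeasure M B + ennreal (\<delta>/2)"
      using \<delta> by (simp add: emeasure_eq_measure ennreal_less_iff flip: ennreal_plus)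
    ultimately obtain U where U: "B \<subseteq> U" "open U" "emeasure M U < emeasure M B + ennreal (\<delta>/2)"
      by (auto simp: INF_less_iff)
    then have mU: "measure M U < measure M B + \<delta>/2"
      using \<delta> by (simp add: emeasure_eq_measure ennreal_less_iff flip: ennreal_plus)
    obtain F where F: "F \<subseteq> \<B>" "U = \<Union>F" using tb U(2) by (metis topological_basis_def)
    show ?thesis
    proof (cases "F = {}")
      case True
      then have "B = {}" using F U by auto
      then show ?thesis using \<open>{} \<in> \<D>\<close> \<delta> by (auto intro!: bexI[of _ "{}"])
    next
      case False
      have cF: "countable F" using F cb countable_subset by blast
      let ?W = "\<lambda>n::nat. \<Union>i<n. from_nat_into F i"
      have WF: "from_nat_into F i \<in> F" for i using False by (rule from_nat_into)
      have W: "?W n \<in> \<D>" for n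
        unfolding \<D>_def using WF F(1) by (intro image_eqI[of _ _ "from_nat_into F ` {..<n}"]) auto
      have Us: "(\<Union>n. ?W n) = U"
        using range_from_nat_into[OF False cF] F(2) by (auto; metis UN_I lessI lessThan_iff rangeE)
      have "(\<lambda>n. measure M (?W n)) \<longlonglongrightarrow> measure M (\<Union>n. ?W n)"
        using oD[OF W] sb by (intro finite_Lim_measure_incseq) (auto simp: incseq_def intro: less_le_trans)
      then have "eventually (\<lambda>n. measure M (?W n) > measure M U - \<delta>/2) sequentially"
        using \<delta> Us by (intro order_tendstoD(1)) auto
      then obtain n where n: "measure M (?W n) > measure M U - \<delta>/2"
        using eventually_sequentially by auto
      have ms: "?W n \<in> sets M" "U \<in> sets M" "B \<in> sets M" using oD[OF W] sb U B by auto
      have WU: "?W n \<subseteq> U" using Us by blast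
      have "measure M ((B - ?W n) \<union> (?W n - B)) \<le> measure M ((U - ?W n) \<union> (U - B))"
        using ms WU U(1) by (intro finite_measure_mono) auto
      also have "\<dots> \<le> measure M (U - ?W n) + measure M (U - B)"
        using ms by (intro measure_Un_le) auto
      also have "\<dots> = (measure M U - measure M (?W n)) + (measure M U - measure M B)"
        using ms WU U(1) by (simp add: finite_measure_Diff)
      also have "\<dots> < \<delta>" using n mU by simp
      finally show ?thesis using W by blast
    qed
  qed
  show ?thesis
  proof (intro exI[of _ "from_nat_into \<D>"] conjI allI ballI impI)
    show "from_nat_into \<D> k \<in> sets borel" for k
      using oD rng by (metis borel_open rangeI)
    show "\<exists>k. measure M ((B - from_nat_into \<D> k) \<union> (from_nat_into \<D> k - B)) < \<delta>"
      if "B \<in> sets borel" "0 < \<delta>" for B \<delta>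
      using appr[OF that] rng by (metis imageE)
  qed
qed

text \<open>The diagonal argument yields convergence only on a countable family that is dense in the
  measure algebra of \<open>M\<close>. Uniform absolute continuity then does two things: it carries
  convergence over to every Borel set, and it makes the limiting set function continuous at the
  empty set, hence countably additive.\<close>

lemma setwise_compactness:
  fixes M :: "'a::{second_countable_topology, complete_space} measure"
  assumes fin: "finite_measure M" and sb: "sets M = sets borel"
    and V: "\<And>n. prob_space (V n)" "\<And>n. sets (V n) = sets borel"
    and ac: "uniformly_ac V M"
  obtains r :: "nat \<Rightarrow> nat" and L where "strict_mono r" "prob_space L" "sets L = sets borel"
    "setwise_limit (V \<circ> r) L" "absolutely_continuous M L"
proof -
  interpret finite_measure M by fact
  interpret V: prob_space "V n" for n by (rule V)
  note [simp] = sb V(2)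
  define Q where "Q D \<longleftrightarrow> (\<forall>k. D k \<in> sets (borel :: 'a measure)) \<and>
    (\<forall>B\<in>sets borel. \<forall>\<delta>>0. \<exists>k. measure M ((B - D k) \<union> (D k - B)) < \<delta>)"
    for D :: "nat \<Rightarrow> 'a set"
  have "\<exists>D. Q D" unfolding Q_def by (rule countable_dense_family[OF fin sb])
  then obtain D where "Q D" ..
  then have D0: "\<forall>k. D k \<in> sets (borel :: 'a measure)"
    and dense0: "\<forall>B\<in>sets borel. \<forall>\<delta>>0. \<exists>k. measure M ((B - D k) \<union> (D k - B)) < \<delta>"
    unfolding Q_def by (rule conjunct1, rule conjunct2)
  have D: "D k \<in> sets borel" for k using D0 by (rule spec)
  have dense: "\<exists>k. measure M ((B - D k) \<union> (D k - B)) < \<delta>" if "B \<in> sets borel" "\<delta> > 0" for B \<delta>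
    using dense0 that by (meson bspec)
  have "\<bar>measure (V n) (D k)\<bar> \<le> 1" for n k by simp
  then have "\<exists>r :: nat \<Rightarrow> nat. strict_mono r \<and> (\<forall>k. convergent (\<lambda>n. measure (V (r n)) (D k)))"
    by (rule diagonal_convergent)
  then obtain r :: "nat \<Rightarrow> nat"
    where "strict_mono r \<and> (\<forall>k. convergent (\<lambda>n. measure (V (r n)) (D k)))" ..
  then have r: "strict_mono r" and cD: "convergent (\<lambda>n. measure (V (r n)) (D k))" for k
    by simp_all
  have conv: "convergent (\<lambda>n. measure (V (r n)) B)" if B: "B \<in> sets borel" for B
  proof -
    have "Cauchy (\<lambda>n. measure (V (r n)) B)"
    proof (rule CauchyI')
      fix e :: real assume "e > 0"
      then have "e/3 > 0" by simp
      from uniformly_acD[OF ac this] obtain \<delta> where \<delta>: "\<delta> > 0"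
        and "\<forall>n. \<forall>B\<in>sets M. measure M B < \<delta> \<longrightarrow> measure (V n) B < e/3" by blast
      then have \<delta>2: "measure (V n) B < e/3" if "B \<in> sets M" "measure M B < \<delta>" for n B
        using that by blast
      \<comment> \<open>A set that is \<open>\<delta>\<close>-close to \<open>B\<close> for
        \<open>M\<close> is \<open>e/3\<close>-close for all \<open>V n\<close> at once, so only the
        convergent sequence on \<open>D k\<close> remains to be estimated.\<close>
      obtain k where k: "measure M ((B - D k) \<union> (D k - B)) < \<delta>" using dense[OF B \<delta>] by blast
      have close: "\<bar>measure (V n) B - measure (V n) (D k)\<bar> < e/3" for n
        using measure_diff_le_sym_diff[OF V.finite_measure_axioms, of B n "D k"] B D[of k]
          \<delta>2[OF _ k, of n] by auto
      obtain N where N: "\<And>m n. m \<ge> N \<Longrightarrow> n \<ge> N \<Longrightarrow>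
          norm (measure (V (r m)) (D k) - measure (V (r n)) (D k)) < e/3"
        using CauchyD[OF convergent_Cauchy[OF cD[of k]], of "e/3"] \<open>e > 0\<close> by auto
      show "\<exists>N. \<forall>m\<ge>N. \<forall>n>m. dist (measure (V (r m)) B) (measure (V (r n)) B) < e"
      proof (intro exI allI impI)
        fix m n assume "N \<le> m" "m < n"
        then have "\<bar>measure (V (r m)) (D k) - measure (V (r n)) (D k)\<bar> < e/3"
          using N[of m n] by simp
        then show "dist (measure (V (r m)) B) (measure (V (r n)) B) < e"
          using close[of "r m"] close[of "r n"] unfolding dist_real_def by linarith
      qed
    qed
    then show ?thesis by (simp add: Cauchy_convergent_iff)
  qed
  define l where "l B = lim (\<lambda>n. measure (V (r n)) B)" for B
  have l: "(\<lambda>n. measure (V (r n)) B) \<longlonglongrightarrow> l B" if "B \<in> sets borel" for B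
    using conv[OF that] unfolding l_def by (simp add: convergent_LIMSEQ_iff)
  have l0: "0 \<le> l B" if "B \<in> sets borel" for B
    by (rule LIMSEQ_le_const[OF l[OF that]]) auto
  have lsmall: "\<exists>\<delta>>0. \<forall>B\<in>sets borel. measure M B < \<delta> \<longrightarrow> l B \<le> e" if "e > 0" for e
  proof -
    from uniformly_acD[OF ac \<open>e > 0\<close>] obtain \<delta> where "\<delta> > 0"
      "\<forall>n. \<forall>B\<in>sets M. measure M B < \<delta> \<longrightarrow> measure (V n) B < e" by blast
    then have "l B \<le> e" if "B \<in> sets borel" "measure M B < \<delta>" for B
      using that by (intro LIMSEQ_le_const2[OF l]) (auto intro!: exI[of _ 0] less_imp_le)
    then show ?thesis using \<open>\<delta> > 0\<close> by blast
  qed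
  have ladd: "l (A \<union> B) = l A + l B" if "A \<in> sets borel" "B \<in> sets borel" "A \<inter> B = {}" for A B
  proof -
    have "(\<lambda>n. measure (V (r n)) (A \<union> B)) = (\<lambda>n. measure (V (r n)) A + measure (V (r n)) B)"
      using that by (intro ext V.finite_measure_Union) auto
    then show ?thesis
      using LIMSEQ_unique[OF l[of "A \<union> B"]] tendsto_add[OF l[OF that(1)] l[OF that(2)]] that by auto
  qed
  have l00: "l {} = 0" using LIMSEQ_unique[OF l[of "{}"]] by simp
  have l1: "l UNIV = 1"
    using LIMSEQ_unique[OF l[of UNIV]] V.prob_space sets_eq_imp_space_eq[OF V(2)] by simp
  define L where "L = measure_of UNIV (sets (borel::'a measure)) (\<lambda>B. ennreal (l B))"
  have sL [simp]: "sets L = sets borel"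
    unfolding L_def using sets.sigma_sets_eq[of "borel::'a measure"] by (simp add: sets_measure_of)
  have pos: "positive (sets borel) (\<lambda>B. ennreal (l B))"
    by (simp add: positive_def l00)
  have "countably_additive (sets borel) (\<lambda>B. ennreal (l B))"
  proof (rule sets.empty_continuous_imp_countably_additive[OF pos])
    show "additive (sets borel) (\<lambda>B. ennreal (l B))"
      by (auto simp: additive_def ladd l0 ennreal_plus[symmetric] simp del: ennreal_plus)
    fix A :: "nat \<Rightarrow> 'a set"
    assume A: "range A \<subseteq> sets borel" "decseq A" "(\<Inter>i. A i) = {}"
    \<comment> \<open>\<open>M\<close> is already a measure, so these masses tend to
      \<open>0\<close>, and \<open>lsmall\<close> hands this over to \<open>l\<close>.\<close>
    have mA: "(\<lambda>i. measure M (A i)) \<longlonglongrightarrow> 0"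
      using finite_Lim_measure_decseq[of A] A by simp
    have "(\<lambda>i. l (A i)) \<longlonglongrightarrow> 0"
    proof (rule LIMSEQ_I)
      fix e :: real assume "e > 0"
      then obtain \<delta> where \<delta>: "\<delta> > 0" "\<And>B. B \<in> sets borel \<Longrightarrow> measure M B < \<delta> \<Longrightarrow> l B \<le> e/2"
        using lsmall[of "e/2"] by auto
      obtain N where "\<And>i. i \<ge> N \<Longrightarrow> measure M (A i) < \<delta>"
        using order_tendstoD(2)[OF mA \<delta>(1)] unfolding eventually_sequentially by blast
      then have "norm (l (A i) - 0) < e" if "i \<ge> N" for i
        using \<delta>(2)[of "A i"] l0[of "A i"] A(1) that \<open>e > 0\<close> by force
      then show "\<exists>N. \<forall>i\<ge>N. norm (l (A i) - 0) < e" by blast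
    qed
    then show "(\<lambda>i. ennreal (l (A i))) \<longlonglongrightarrow> 0"
      using tendsto_ennrealI by fastforce
  qed simp
  then have eL: "emeasure L B = ennreal (l B)" if "B \<in> sets borel" for B
    using emeasure_measure_of[OF L_def, of B] that pos by auto
  have mL: "measure L B = l B" if "B \<in> sets borel" for B
    using eL[OF that] l0[OF that] by (simp add: measure_def)
  show thesis
  proof (rule that[OF r _ sL])
    have "space L = UNIV" using sets_eq_imp_space_eq[OF sL] by simp
    then show "prob_space L" using eL[of UNIV] l1 by (intro prob_spaceI) simp
    show "setwise_limit (V \<circ> r) L" unfolding setwise_limit_def by (simp add: mL l)
    show "absolutely_continuous M L" unfolding absolutely_continuous_def
    proof
      fix B assume B: "B \<in> null_sets M"
      then have Bs: "B \<in> sets borel" and B0: "measure M B = 0"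
        by (auto simp: null_sets_def measure_def)
      have "l B \<le> 0"
      proof (rule field_le_epsilon)
        fix e :: real assume "e > 0"
        from lsmall[OF this] obtain \<delta> where "\<delta> > 0" "\<forall>B\<in>sets borel. measure M B < \<delta> \<longrightarrow> l B \<le> e" by blast
        then show "l B \<le> 0 + e" using Bs B0 by auto
      qed
      then show "B \<in> null_sets L" using eL[OF Bs] Bs by (simp add: null_sets_def ennreal_neg)
    qed
  qed
qed

text \<open>Setwise convergence is convergence of the integrals of indicators, hence of step
  functions. A bounded function is uniformly close to one step function, with the same error for
  every probability measure.\<close>

lemma setwise_limit_integral:
  fixes g :: "'a \<Rightarrow> real"
  assumes V: "\<And>n. prob_space (V n)" "\<And>n. sets (V n) = sets L" and L: "prob_space L"
    and lim: "setwise_limit V L"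
    and g: "g \<in> borel_measurable L" and bdd: "\<And>x. x \<in> space L \<Longrightarrow> \<bar>g x\<bar> \<le> C"
  shows "(\<lambda>n. \<integral>x. g x \<partial>V n) \<longlonglongrightarrow> (\<integral>x. g x \<partial>L)"
proof (rule LIMSEQ_I)
  fix e :: real assume e: "e > 0"
  \<comment> \<open>Room for three errors of size \<open>d\<close>: one for each of the two
    integrals and one for the step function.\<close>
  define d where "d = e/4"
  have d: "d > 0" using e by (simp add: d_def)
  \<comment> \<open>\<open>g\<close> rounded down to a multiple of \<open>d\<close>; boundedness of
    \<open>g\<close> leaves only the finitely many multipliers in \<open>J\<close>.\<close>
  define s where "s x = d * real_of_int \<lfloor>g x / d\<rfloor>" for x
  have sp: "space (V n) = space L" for n using V(2) by (rule sets_eq_imp_space_eq)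
  have close: "\<bar>g x - s x\<bar> \<le> d" for x
  proof -
    have "s x \<le> d * (g x / d)" unfolding s_def using d by (intro mult_left_mono) auto
    moreover have "d * (g x / d) \<le> d * (real_of_int \<lfloor>g x / d\<rfloor> + 1)"
      using d by (intro mult_left_mono) linarith+
    ultimately show ?thesis using d by (simp add: s_def algebra_simps)
  qed
  define J where "J = {\<lfloor>- C / d\<rfloor>..\<lfloor>C / d\<rfloor>}"
  define E where "E j = {x \<in> space L. \<lfloor>g x / d\<rfloor> = j}" for j
  have E: "E j \<in> sets L" for j unfolding E_def using g by measurable
  have s_sum: "s x = (\<Sum>j\<in>J. d * real_of_int j * indicator (E j) x)" if x: "x \<in> space L" for x
  proof -
    have "- C / d \<le> g x / d" "g x / d \<le> C / d"
      using bdd[OF x] d divide_right_mono[of "-C" "g x" d] divide_right_mono[of "g x" C d] by linarith+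
    then have "\<lfloor>g x / d\<rfloor> \<in> J" unfolding J_def by (auto intro: floor_mono)
    then have "s x = (\<Sum>j\<in>J. if j = \<lfloor>g x / d\<rfloor> then d * real_of_int j else 0)"
      by (simp add: s_def J_def)
    also have "\<dots> = (\<Sum>j\<in>J. d * real_of_int j * indicator (E j) x)"
      using x by (intro sum.cong) (auto simp: E_def)
    finally show ?thesis .
  qed
  have main: "\<bar>(\<integral>x. g x \<partial>W) - (\<Sum>j\<in>J. d * real_of_int j * measure W (E j))\<bar> \<le> d"
    if W: "prob_space W" "sets W = sets L" for W
  proof -
    interpret W: prob_space W by fact
    note [measurable_cong] = W(2)
    have spW: "space W = space L" using W(2) by (rule sets_eq_imp_space_eq)
    have gi: "integrable W g"
      using g bdd spW W(2) by (intro W.integrable_const_bound[where B=C]) (auto simp: measurable_cong_sets[OF W(2) refl])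
    have si: "integrable W (\<lambda>x. \<Sum>j\<in>J. d * real_of_int j * indicator (E j) x)"
      using E W(2) by (intro Bochner_Integration.integrable_sum integrable_mult_right integrable_real_indicator)
        (auto simp: W.emeasure_eq_measure)
    have "(\<integral>x. (\<Sum>j\<in>J. d * real_of_int j * indicator (E j) x) \<partial>W)
        = (\<Sum>j\<in>J. d * real_of_int j * measure W (E j))"
      using E W(2) by (subst Bochner_Integration.integral_sum)
        (auto simp: W.emeasure_eq_measure intro!: integrable_mult_right integrable_real_indicator)
    then have "\<bar>(\<integral>x. g x \<partial>W) - (\<Sum>j\<in>J. d * real_of_int j * measure W (E j))\<bar>
        = \<bar>\<integral>x. g x - (\<Sum>j\<in>J. d * real_of_int j * indicator (E j) x) \<partial>W\<bar>"
      using gi si by simp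
    also have "\<dots> \<le> (\<integral>x. \<bar>g x - (\<Sum>j\<in>J. d * real_of_int j * indicator (E j) x)\<bar> \<partial>W)"
      by (rule integral_abs_bound)
    also have "\<dots> \<le> (\<integral>x. d \<partial>W)"
      using gi si close by (intro integral_mono) (auto simp: spW simp flip: s_sum)
    also have "\<dots> = d" by (simp add: W.prob_space)
    finally show ?thesis .
  qed
  have "(\<lambda>n. \<Sum>j\<in>J. d * real_of_int j * measure (V n) (E j))
      \<longlonglongrightarrow> (\<Sum>j\<in>J. d * real_of_int j * measure L (E j))"
    using lim E unfolding setwise_limit_def by (intro tendsto_intros) auto
  then obtain N where N: "\<And>n. n \<ge> N \<Longrightarrow>
    norm ((\<Sum>j\<in>J. d * real_of_int j * measure (V n) (E j)) - (\<Sum>j\<in>J. d * real_of_int j * measure L (E j))) < d"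
    using LIMSEQ_D[OF _ d] by meson
  have "norm ((\<integral>x. g x \<partial>V n) - (\<integral>x. g x \<partial>L)) < e" if "n \<ge> N" for n
    using N[OF that] main[OF V(1) V(2), of n] main[OF L refl] e unfolding d_def real_norm_def
    by argo
  then show "\<exists>N. \<forall>n\<ge>N. norm ((\<integral>x. g x \<partial>V n) - (\<integral>x. g x \<partial>L)) < e" by blast
qed

section \<open>The variational formula for the divergence\<close>

lemma real_density:
  assumes "prob_space \<mu>" "prob_space \<nu>" "sets \<nu> = sets \<mu>" "absolutely_continuous \<mu> \<nu>"
  shows "\<exists>D. D \<in> borel_measurable \<mu> \<and> (\<forall>x. 0 \<le> D x) \<and> \<nu> = density \<mu> (\<lambda>x. ennreal (D x)) \<and>
    (AE x in \<nu>. 0 < D x) \<and> (AE x in \<nu>. entropy_density (exp 1) \<mu> \<nu> x = ln (D x)) \<and>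
    integrable \<mu> D \<and> (\<integral>x. D x \<partial>\<mu>) = 1"
proof -
  interpret \<mu>: prob_space \<mu> by fact
  interpret \<nu>: prob_space \<nu> by fact
  obtain D where D: "D \<in> borel_measurable \<mu>" "AE x in \<mu>. RN_deriv \<mu> \<nu> x = ennreal (D x)"
    "AE x in \<nu>. 0 < D x" "\<And>x. 0 \<le> D x"
    using \<mu>.real_RN_deriv[OF \<nu>.finite_measure_axioms assms(4,3)] by blast
  note [measurable] = D(1)
  have dens: "\<nu> = density \<mu> (\<lambda>x. ennreal (D x))"
    using \<mu>.density_RN_deriv[OF assms(4,3)] density_cong[OF _ _ D(2)] by simp
  have "AE x in \<nu>. RN_deriv \<mu> \<nu> x = ennreal (D x)"
    using assms(3,4) D(2) by (rule absolutely_continuous_AE)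
  then have ent: "AE x in \<nu>. entropy_density (exp 1) \<mu> \<nu> x = ln (D x)"
    by eventually_elim (simp add: entropy_density_def D(4) log_def)
  have "(\<integral>\<^sup>+x. ennreal (D x) \<partial>\<mu>) = emeasure (density \<mu> (\<lambda>x. ennreal (D x))) (space \<mu>)"
    by (subst emeasure_density) (auto intro!: nn_integral_cong)
  also have "\<dots> = 1"
    using \<nu>.emeasure_space_1 sets_eq_imp_space_eq[OF assms(3)] by (simp flip: dens)
  finally have nn: "(\<integral>\<^sup>+x. ennreal (D x) \<partial>\<mu>) = 1" .
  have "integrable \<mu> D" "(\<integral>x. D x \<partial>\<mu>) = 1"
    using nn D(4) by (auto simp: integral_eq_nn_integral intro!: integrableI_nonneg)
  then show ?thesis using D(1,3,4) dens ent by blast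
qed

text \<open>Pointwise \<open>h - ln D \<le> exp h / D - 1\<close>, which is
  \<open>ln t \<le> t - 1\<close> at \<open>t = exp h / D\<close>. Integration against
  \<open>\<nu>\<close> turns \<open>exp h / D\<close> into the integral of \<open>exp h\<close>
  against \<open>\<mu>\<close> over the set where \<open>D\<close> is positive.\<close>

lemma KL_ge:
  fixes h :: "'a \<Rightarrow> real"
  assumes \<mu>: "prob_space \<mu>" and \<nu>: "prob_space \<nu>" "sets \<nu> = sets \<mu>"
    and h: "h \<in> borel_measurable \<mu>" "\<And>x. \<bar>h x\<bar> \<le> C"
  shows "ereal ((\<integral>x. h x \<partial>\<nu>) + 1 - (\<integral>x. exp (h x) \<partial>\<mu>)) \<le> KL \<nu> \<mu>"
proof (cases "absolutely_continuous \<mu> \<nu> \<and> integrable \<nu> (entropy_density (exp 1) \<mu> \<nu>)")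
  case True
  interpret \<mu>: prob_space \<mu> by fact
  interpret \<nu>: prob_space \<nu> by fact
  note [measurable] = h(1)
  from real_density[OF \<mu> \<nu> conjunct1[OF True]]
  obtain D where D [measurable]: "D \<in> borel_measurable \<mu>" and D0: "\<forall>x. 0 \<le> D x"
    and dens: "\<nu> = density \<mu> (\<lambda>x. ennreal (D x))" and Dpos: "AE x in \<nu>. 0 < D x"
    and ent: "AE x in \<nu>. entropy_density (exp 1) \<mu> \<nu> x = ln (D x)"
    by (elim exE conjE) blast
  have [measurable]: "f \<in> borel_measurable \<nu>" if "f \<in> borel_measurable \<mu>" for f :: "'a \<Rightarrow> real"
    using that \<nu>(2) by (simp cong: measurable_cong_sets)
  have [measurable]: "entropy_density (exp 1) \<mu> \<nu> \<in> borel_measurable \<nu>"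
    using True by auto
  have li: "integrable \<nu> (\<lambda>x. ln (D x))"
    using True by (subst integrable_cong_AE[where g="entropy_density (exp 1) \<mu> \<nu>"])
      (use ent in \<open>auto elim: eventually_mono\<close>)
  have KLeq: "KL \<nu> \<mu> = ereal (\<integral>x. ln (D x) \<partial>\<nu>)"
    unfolding KL_def KL_divergence_def using True
    by (auto intro!: integral_cong_AE ent)
  have ehC: "exp (h x) \<le> exp C" for x using h(2)[of x] by simp
  have hi: "integrable \<nu> h"
    using h by (intro \<nu>.integrable_const_bound[where B=C]) auto
  have ei: "integrable \<mu> (\<lambda>x. exp (h x))"
    by (intro \<mu>.integrable_const_bound[where B="exp C"]) (auto simp: ehC simp del: exp_le_cancel_iff)
  \<comment> \<open>Division by zero yields \<open>0\<close>, so the quotient contributes nothing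
    where \<open>D\<close> vanishes.\<close>
  have eq: "D x *\<^sub>R (exp (h x) / D x) = indicator {x. 0 < D x} x * exp (h x)" for x
    using D0[rule_format, of x] by (auto simp: indicator_def)
  have int1: "integrable \<mu> (\<lambda>x. indicator {x. 0 < D x} x * exp (h x))"
    by (intro \<mu>.integrable_const_bound[where B="exp C"]) (auto simp: ehC indicator_def simp del: exp_le_cancel_iff)
  have "integrable \<mu> (\<lambda>x. D x *\<^sub>R (exp (h x) / D x))" unfolding eq by (rule int1)
  then have int2: "integrable \<nu> (\<lambda>x. exp (h x) / D x)"
    unfolding dens using D0 by (subst integrable_density) auto
  have "(\<integral>x. exp (h x) / D x \<partial>\<nu>) = (\<integral>x. D x *\<^sub>R (exp (h x) / D x) \<partial>\<mu>)"
    unfolding dens using D0 by (intro integral_density) auto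
  also have "\<dots> = (\<integral>x. indicator {x. 0 < D x} x * exp (h x) \<partial>\<mu>)"
    unfolding eq by (rule refl)
  also have "\<dots> \<le> (\<integral>x. exp (h x) \<partial>\<mu>)"
    by (intro integral_mono int1 ei) (auto simp: indicator_def)
  finally have le: "(\<integral>x. exp (h x) / D x \<partial>\<nu>) \<le> (\<integral>x. exp (h x) \<partial>\<mu>)" .
  have "(\<integral>x. h x - ln (D x) \<partial>\<nu>) \<le> (\<integral>x. exp (h x) / D x - 1 \<partial>\<nu>)"
  proof (rule integral_mono_AE)
    show "AE x in \<nu>. h x - ln (D x) \<le> exp (h x) / D x - 1"
      using Dpos
    proof eventually_elim
      case (elim x)
      have "h x - ln (D x) = ln (exp (h x) / D x)" using elim by (simp add: ln_div)
      also have "\<dots> \<le> exp (h x) / D x - 1" using elim by (intro ln_le_minus_one) auto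
      finally show ?case .
    qed
  qed (use hi li int2 in auto)
  then have "(\<integral>x. h x \<partial>\<nu>) - (\<integral>x. ln (D x) \<partial>\<nu>) \<le> (\<integral>x. exp (h x) / D x \<partial>\<nu>) - 1"
    using hi li int2 by (simp add: \<nu>.prob_space)
  then show ?thesis unfolding KLeq using le by simp
next
  case False
  then show ?thesis unfolding KL_def by (simp only: if_False) simp
qed

text \<open>The optimal test function \<open>ln D\<close> need not be bounded, so \<open>var\<close>
  is applied to logarithms of truncations \<open>g k\<close> of \<open>D\<close>. The integrals of
  \<open>g k\<close> against \<open>\<mu>\<close> tend to \<open>1\<close>, so the correction terms
  cancel in the limit. Integrability of \<open>ln D\<close> is part of the claim and has to be
  extracted from the bound before dominated convergence applies.\<close>

lemma KL_le:
  assumes \<mu>: "prob_space \<mu>" and \<nu>: "prob_space \<nu>" "sets \<nu> = sets \<mu>"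
    and ac: "absolutely_continuous \<mu> \<nu>"
    and var: "\<And>h C. h \<in> borel_measurable \<mu> \<Longrightarrow> (\<And>x. \<bar>h x\<bar> \<le> C) \<Longrightarrow>
      (\<integral>x. h x \<partial>\<nu>) + 1 - (\<integral>x. exp (h x) \<partial>\<mu>) \<le> c"
  shows "KL \<nu> \<mu> \<le> ereal c"
proof -
  interpret \<mu>: prob_space \<mu> by fact
  interpret \<nu>: prob_space \<nu> by fact
  from real_density[OF \<mu> \<nu> ac]
  obtain D where D [measurable]: "D \<in> borel_measurable \<mu>" and D0: "\<forall>x. 0 \<le> D x"
    and dens: "\<nu> = density \<mu> (\<lambda>x. ennreal (D x))" and Dpos: "AE x in \<nu>. 0 < D x"
    and ent: "AE x in \<nu>. entropy_density (exp 1) \<mu> \<nu> x = ln (D x)"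
    and Di: "integrable \<mu> D" and D1: "(\<integral>x. D x \<partial>\<mu>) = 1"
    by (elim exE conjE) blast
  have mv: "f \<in> borel_measurable \<nu>" if "f \<in> borel_measurable \<mu>" for f :: "'a \<Rightarrow> real"
    using that \<nu>(2) by (simp cong: measurable_cong_sets)
  \<comment> \<open>Truncation at \<open>1 / (k + 1)\<close> and \<open>k + 1\<close>: the logarithm
    becomes bounded, and since the interval contains \<open>1\<close>, truncation never increases
    its absolute value.\<close>
  define g where "g k x = max (1 / real (Suc k)) (min (real (Suc k)) (D x))" for k x
  have g [measurable]: "g k \<in> borel_measurable \<mu>" for k unfolding g_def by measurable
  have g0: "g k x \<ge> 1 / real (Suc k)" "g k x \<le> real (Suc k)" for k x
    by (auto simp: g_def field_simps)
  have gpos: "g k x > 0" for k x using g0(1)[of k x] by (smt (verit) divide_pos_pos of_nat_0_less_iff zero_less_Suc)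
  have glim: "(\<lambda>k. g k x) \<longlonglongrightarrow> D x" for x
  proof -
    obtain N where N: "D x \<le> real N" using real_arch_simple by blast
    have "(\<lambda>k. max (1 / real (Suc k)) (D x)) \<longlonglongrightarrow> max 0 (D x)"
      by (intro tendsto_intros LIMSEQ_Suc[OF lim_1_over_n])
    then have "(\<lambda>k. max (1 / real (Suc k)) (D x)) \<longlonglongrightarrow> D x" using D0 by (simp add: max_def)
    moreover have "eventually (\<lambda>k. max (1 / real (Suc k)) (D x) = g k x) sequentially"
      using eventually_ge_at_top[of N]
    proof eventually_elim
      case (elim k)
      then have "D x \<le> real (Suc k)" using N by simp
      then show ?case by (simp add: g_def min_absorb2)
    qed
    ultimately show ?thesis by (rule Lim_transform_eventually)
  qed
  have gD: "g k x \<le> 1 + D x" for k x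
  proof -
    have "1 / real (Suc k) \<le> 1" by simp
    then show ?thesis using D0[rule_format, of x] unfolding g_def by linarith
  qed
  have gabs: "norm (g k x) \<le> 1 + D x" "norm (g k x) \<le> real (Suc k)" for k x
    using gD[of k x] g0(2)[of k x] gpos[of k x] unfolding real_norm_def by linarith+
  have "(\<lambda>k. \<integral>x. g k x \<partial>\<mu>) \<longlonglongrightarrow> (\<integral>x. D x \<partial>\<mu>)"
  proof (rule integral_dominated_convergence[where w="\<lambda>x. 1 + D x"])
    show "integrable \<mu> (\<lambda>x. 1 + D x)" using Di by simp
    show "AE x in \<mu>. (\<lambda>k. g k x) \<longlonglongrightarrow> D x" by (intro AE_I2 glim)
    show "AE x in \<mu>. norm (g k x) \<le> 1 + D x" for k by (intro AE_I2 gabs(1))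
  qed (rule D g)+
  then have intg: "(\<lambda>k. \<integral>x. g k x \<partial>\<mu>) \<longlonglongrightarrow> 1"
    by (simp only: D1)
  have gi: "integrable \<mu> (g k)" for k
    by (rule \<mu>.integrable_const_bound[where B="real (Suc k)"]) (rule AE_I2 gabs(2) g)+
  define h where "h k x = ln (g k x)" for k x
  have h [measurable]: "h k \<in> borel_measurable \<mu>" for k
    unfolding h_def[abs_def] by (rule borel_measurable_ln[OF g])
  have hb: "\<bar>h k x\<bar> \<le> ln (real (Suc k))" for k x
  proof -
    have "ln (g k x) \<le> ln (real (Suc k))" by (rule iffD2[OF ln_le_cancel_iff]) (rule gpos g0 | simp)+
    moreover have "ln (1 / real (Suc k)) \<le> ln (g k x)" by (rule iffD2[OF ln_le_cancel_iff]) (rule gpos g0 | simp)+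
    ultimately show ?thesis unfolding h_def abs_le_iff by (simp add: ln_div)
  qed
  have hv: "(\<integral>x. h k x \<partial>\<nu>) \<le> c - 1 + (\<integral>x. g k x \<partial>\<mu>)" for k
    using var[OF h hb, of k] by (simp add: h_def gpos)
  have hi: "integrable \<nu> (h k)" for k
    by (rule \<nu>.integrable_const_bound[where B="ln (real (Suc k))"])
      (simp_all only: real_norm_def hb mv[OF h] AE_I2)
  have hD: "\<bar>h k x\<bar> \<le> \<bar>ln (D x)\<bar>" if "D x > 0" for k x
  proof -
    consider "D x \<le> 1 / real (Suc k)" | "D x \<ge> real (Suc k)"
      | "1 / real (Suc k) \<le> D x" "D x \<le> real (Suc k)" by linarith
    then show ?thesis
    proof cases
      case 1
      have "1 / real (Suc k) \<le> real (Suc k)" by (simp add: field_simps)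
      then have e: "g k x = 1 / real (Suc k)" using 1 by (auto simp: g_def)
      have "ln (D x) \<le> ln (1 / real (Suc k))" using 1 that by (subst ln_le_cancel_iff) auto
      moreover have "ln (1 / real (Suc k)) \<le> 0" by simp
      ultimately show ?thesis unfolding h_def e by linarith
    next
      case 2
      have "1 / real (Suc k) \<le> real (Suc k)" by (simp add: field_simps)
      then have e: "g k x = real (Suc k)" using 2 by (auto simp: g_def)
      have "ln (real (Suc k)) \<le> ln (D x)" using 2 that by (subst ln_le_cancel_iff) auto
      moreover have "0 \<le> ln (real (Suc k))" by simp
      ultimately show ?thesis unfolding h_def e by linarith
    next
      case 3
      then have "g k x = D x" by (auto simp: g_def)
      then show ?thesis by (simp add: h_def)
    qed
  qed
  have hlim: "(\<lambda>k. h k x) \<longlonglongrightarrow> ln (D x)" if "D x > 0" for x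
    unfolding h_def using that by (intro tendsto_ln glim) auto
  \<comment> \<open>Either \<open>D x \<le> g k x\<close> or \<open>1 \<le> g k x\<close>, so one
    integrable majorant serves all \<open>k\<close>.\<close>
  have Dg: "D x / g k x \<le> 1 + D x" for k x
  proof (cases "D x \<le> real (Suc k)")
    case True
    then have "D x \<le> g k x" by (auto simp: g_def)
    then have "D x / g k x \<le> 1" using gpos by (simp add: divide_le_eq)
    then show ?thesis using D0 by (smt (verit))
  next
    case False
    then have "1 \<le> g k x" by (auto simp: g_def)
    then have "D x / g k x \<le> D x / 1" using D0 by (intro divide_left_mono) auto
    then show ?thesis by simp
  qed
  have ig1: "integrable \<mu> (\<lambda>x. D x * (1 / g k x))" for k
    by (rule Bochner_Integration.integrable_bound[of _ "\<lambda>x. 1 + D x"])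
      (use Di D0 Dg gpos in \<open>auto simp: abs_of_nonneg less_imp_le simp del: of_nat_Suc\<close>)
  have ig: "integrable \<nu> (\<lambda>x. 1 / g k x)" for k
    unfolding dens by (subst integrable_density) (use D0 ig1 in auto)
  have ig2: "(\<integral>x. 1 / g k x \<partial>\<nu>) \<le> 2" for k
  proof -
    have "(\<integral>x. 1 / g k x \<partial>\<nu>) = (\<integral>x. D x * (1 / g k x) \<partial>\<mu>)"
      unfolding dens by (subst integral_density) (use D0 in auto)
    also have "\<dots> \<le> (\<integral>x. 1 + D x \<partial>\<mu>)"
      by (intro integral_mono ig1) (use Di Dg in auto)
    also have "\<dots> = 2" using Di D1 by (simp add: \<mu>.prob_space)
    finally show ?thesis .
  qed
  text \<open>The corrections \<open>- 1 + 1 / g\<close> make the truncated logarithms nonnegative, so that Fatou applies.\<close>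
  define u where "u k x = h k x - 1 + 1 / g k x" for k x
  have u [measurable]: "u k \<in> borel_measurable \<mu>" for k unfolding u_def by measurable
  have ln_inv: "0 \<le> ln y - 1 + 1 / y" if "y > 0" for y :: real
    using ln_le_minus_one[of "1/y"] that by (simp add: ln_div)
  have u0: "0 \<le> u k x" for k x unfolding u_def h_def by (intro ln_inv gpos)
  have ui: "integrable \<nu> (u k)" for k unfolding u_def using hi ig by auto
  obtain K where K: "\<And>k. (\<integral>x. g k x \<partial>\<mu>) \<le> K"
  proof -
    have "Bseq (\<lambda>k. \<integral>x. g k x \<partial>\<mu>)" using convergentI[OF intg] by (rule convergent_imp_Bseq)
    then obtain K where "\<forall>k. norm (\<integral>x. g k x \<partial>\<mu>) \<le> K" unfolding Bseq_def by blast
    then show thesis by (intro that[of K]) (metis abs_le_D1 real_norm_def)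
  qed
  have ub: "(\<integral>x. u k x \<partial>\<nu>) \<le> c + K" for k
    unfolding u_def using hi ig ig2[of k] hv[of k] K[of k] by (simp add: \<nu>.prob_space)
  have "(\<integral>\<^sup>+x. ennreal (ln (D x) - 1 + 1 / D x) \<partial>\<nu>) = (\<integral>\<^sup>+x. liminf (\<lambda>k. ennreal (u k x)) \<partial>\<nu>)"
  proof (rule nn_integral_cong_AE)
    show "AE x in \<nu>. ennreal (ln (D x) - 1 + 1 / D x) = liminf (\<lambda>k. ennreal (u k x))"
      using Dpos
    proof eventually_elim
      case (elim x)
      have "(\<lambda>k. u k x) \<longlonglongrightarrow> ln (D x) - 1 + 1 / D x"
        unfolding u_def using elim by (intro tendsto_intros hlim glim) auto
      from lim_imp_Liminf[OF _ tendsto_ennrealI[OF this]] show ?case by simp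
    qed
  qed
  also have "\<dots> \<le> liminf (\<lambda>k. \<integral>\<^sup>+x. ennreal (u k x) \<partial>\<nu>)"
    by (rule nn_integral_liminf) (rule measurable_compose[OF mv[OF u] measurable_ennreal])
  also have "\<dots> \<le> ennreal (c + K)"
    using ui u0 ub by (intro Liminf_le) (auto simp: nn_integral_eq_integral intro!: ennreal_leI always_eventually)
  also have "\<dots> < \<infinity>" by simp
  finally have fin: "(\<integral>\<^sup>+x. ennreal (ln (D x) - 1 + 1 / D x) \<partial>\<nu>) < \<infinity>" .
  have iu: "integrable \<nu> (\<lambda>x. ln (D x) - 1 + 1 / D x)"
    using fin Dpos ln_inv by (intro integrableI_nonneg mv) (auto elim: eventually_mono)
  have "integrable \<mu> (\<lambda>x. D x * (1 / D x))"
    by (intro \<mu>.integrable_const_bound[where B=1]) auto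
  then have iD: "integrable \<nu> (\<lambda>x. 1 / D x)"
    unfolding dens by (subst integrable_density) (use D0 in auto)
  \<comment> \<open>Fatou made the nonnegative combination integrable; removing the integrable
    \<open>1 / D\<close> and the constant leaves \<open>ln D\<close>.\<close>
  have li: "integrable \<nu> (\<lambda>x. ln (D x))"
    using Bochner_Integration.integrable_diff[OF iu Bochner_Integration.integrable_diff[OF iD \<nu>.integrable_const[of 1]]]
    by simp
  have "(\<lambda>k. \<integral>x. h k x \<partial>\<nu>) \<longlonglongrightarrow> (\<integral>x. ln (D x) \<partial>\<nu>)"
  proof (rule integral_dominated_convergence[where w="\<lambda>x. \<bar>ln (D x)\<bar>"])
    show "integrable \<nu> (\<lambda>x. \<bar>ln (D x)\<bar>)" using li by simp
    show "AE x in \<nu>. (\<lambda>k. h k x) \<longlonglongrightarrow> ln (D x)" using Dpos by eventually_elim (rule hlim)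
    show "AE x in \<nu>. norm (h k x) \<le> \<bar>ln (D x)\<bar>" for k using Dpos by eventually_elim (simp add: hD)
  qed (rule mv borel_measurable_ln D h)+
  moreover have "(\<lambda>k. c - 1 + (\<integral>x. g k x \<partial>\<mu>)) \<longlonglongrightarrow> c - 1 + 1" by (intro tendsto_intros intg)
  ultimately have "(\<integral>x. ln (D x) \<partial>\<nu>) \<le> c - 1 + 1"
    by (rule LIMSEQ_le) (use hv in auto)
  moreover
  have em [measurable]: "entropy_density (exp 1) \<mu> \<nu> \<in> borel_measurable \<nu>"
    by (rule mv[OF measurable_entropy_density])
  have "integrable \<nu> (entropy_density (exp 1) \<mu> \<nu>)"
    using li by (subst integrable_cong_AE[where g="\<lambda>x. ln (D x)"])
      (use ent em in \<open>auto elim: eventually_mono intro!: mv borel_measurable_ln\<close>)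
  moreover have "KL_divergence (exp 1) \<mu> \<nu> = (\<integral>x. ln (D x) \<partial>\<nu>)"
    unfolding KL_divergence_def by (intro integral_cong_AE em mv borel_measurable_ln D ent)
  ultimately show ?thesis unfolding KL_def using ac by simp
qed

section \<open>Normal laws on the line\<close>

text \<open>Admitting \<open>s = 0\<close> for the Dirac measures keeps the family closed under
  limits of its parameters.\<close>

definition normal_law :: "real measure \<Rightarrow> real \<Rightarrow> real \<Rightarrow> bool" where
  "normal_law M a s \<longleftrightarrow> s = 0 \<and> M = return borel a \<or>
     0 < s \<and> M = density lborel (\<lambda>x. ennreal (normal_density a s x))"

lemma gaussian_on_reals_iff: "gaussian_on_reals M \<longleftrightarrow> (\<exists>a s. normal_law M a s)"
  unfolding gaussian_on_reals_def normal_law_def by blast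

lemma normal_law_nonneg: "normal_law M a s \<Longrightarrow> 0 \<le> s"
  unfolding normal_law_def by auto

lemma normal_law_real_distribution: "normal_law M a s \<Longrightarrow> real_distribution M"
  unfolding normal_law_def real_distribution_def real_distribution_axioms_def
  by (auto intro: prob_space_return prob_space_normal_density)

lemma normal_law_char:
  assumes "normal_law M a s"
  shows "char M t = iexp (a * t) * complex_of_real (exp (- ((s * t)\<^sup>2) / 2))"
proof (cases "s = 0")
  case True
  then have "M = return borel a" using assms by (simp add: normal_law_def)
  then show ?thesis using True by (simp add: char_def integral_return mult.commute)
next
  case False
  then have s: "0 < s" and M: "M = density lborel (\<lambda>x. ennreal (normal_density a s x))"
    using assms by (auto simp: normal_law_def)
  interpret S: real_distribution std_normal_distribution by (rule real_dist_normal_dist)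
  have "distributed std_normal_distribution lborel (\<lambda>x. x) std_normal_density"
    unfolding distributed_def by (auto simp: distr_id2)
  from S.normal_density_affine[OF this _, of s a] s
  have "distributed std_normal_distribution lborel (\<lambda>x. a + s * x) (normal_density a s)" by simp
  then have "M = distr std_normal_distribution lborel (\<lambda>x. a + s * x)"
    unfolding M by (simp add: distributed_def)
  then have "char M t = (CLINT x|std_normal_distribution. iexp (t * (a + s * x)))"
    unfolding char_def by (simp add: integral_distr)
  also have "\<dots> = (CLINT x|std_normal_distribution. iexp (a * t) * iexp (s * t * x))"
    by (intro Bochner_Integration.integral_cong) (auto simp: exp_add[symmetric] algebra_simps)
  also have "\<dots> = iexp (a * t) * char std_normal_distribution (s * t)"
    unfolding char_def by simp
  finally show ?thesis by (simp add: char_std_normal_distribution)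
qed

lemma normal_law_ex:
  assumes "0 \<le> s" obtains N where "normal_law N a s"
  using assms by (cases "s = 0") (auto simp: normal_law_def)

lemma normal_law_iff_char:
  assumes "real_distribution M" "0 \<le> s"
    and "\<And>t. char M t = iexp (a * t) * complex_of_real (exp (- ((s * t)\<^sup>2) / 2))"
  shows "normal_law M a s"
proof -
  obtain N where N: "normal_law N a s" using normal_law_ex[OF assms(2)] .
  have "M = N"
    using assms(3) normal_law_char[OF N]
    by (intro Levy_uniqueness assms(1) normal_law_real_distribution[OF N]) auto
  then show ?thesis using N by simp
qed

lemma normal_law_moments:
  assumes "normal_law M a s"
  shows "has_bochner_integral M (\<lambda>x. x) a" "has_bochner_integral M (\<lambda>x. (x - a)\<^sup>2) (s\<^sup>2)"
proof -
  have "has_bochner_integral M (\<lambda>x. x) a \<and> has_bochner_integral M (\<lambda>x. (x - a)\<^sup>2) (s\<^sup>2)"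
  proof (cases "s = 0")
    case True
    then have M: "M = return borel a" using assms by (simp add: normal_law_def)
    interpret prob_space M unfolding M by (rule prob_space_return) simp
    have [measurable_cong]: "sets M = sets borel" by (simp add: M)
    have hb: "has_bochner_integral M f (f a)" if [measurable]: "f \<in> borel_measurable borel" for f :: "real \<Rightarrow> real"
    proof -
      have "AE x in M. f x = f a" unfolding M by (subst AE_return) auto
      then have "has_bochner_integral M f c \<longleftrightarrow> has_bochner_integral M (\<lambda>x. f a) c" for c
        by (intro has_bochner_integral_cong_AE) auto
      moreover have "has_bochner_integral M (\<lambda>x. f a) (f a)"
        by (simp add: has_bochner_integral_iff prob_space)
      ultimately show ?thesis by simp
    qed
    have "has_bochner_integral M (\<lambda>x. (x - a)\<^sup>2) ((a - a)\<^sup>2)" by (rule hb) simp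
    moreover have "has_bochner_integral M (\<lambda>x. x) a" by (rule hb) simp
    ultimately show ?thesis by (simp only: True) simp
  next
    case False
    then have s: "0 < s" and M: "M = density lborel (\<lambda>x. ennreal (normal_density a s x))"
      using assms by (auto simp: normal_law_def)
    show ?thesis
    proof
      show "has_bochner_integral M (\<lambda>x. x) a"
        unfolding M using normal_moment_nz_1[OF s, of a] by (intro has_bochner_integral_density) auto
      have "has_bochner_integral lborel (\<lambda>x. normal_density a s x * (x - a)\<^sup>2) (s\<^sup>2)"
        using normal_moment_even[OF s, of a 1] by (simp add: fact_numeral power2_eq_square)
      then show "has_bochner_integral M (\<lambda>x. (x - a)\<^sup>2) (s\<^sup>2)"
        unfolding M by (intro has_bochner_integral_density) auto
    qed
  qed
  then show "has_bochner_integral M (\<lambda>x. x) a" "has_bochner_integral M (\<lambda>x. (x - a)\<^sup>2) (s\<^sup>2)"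
    by auto
qed

text \<open>Medians, unlike means, are controlled by the mass of a bounded set.\<close>

lemma normal_law_median:
  assumes "normal_law M a s"
  shows "1/2 \<le> measure M {a..}" "1/2 \<le> measure M {..a}"
proof -
  interpret real_distribution M by (rule normal_law_real_distribution[OF assms])
  \<comment> \<open>Reflection about \<open>a\<close> preserves the characteristic function, so the
    two half-lines at \<open>a\<close> have equal mass; together they cover the line.\<close>
  have "distr M borel (\<lambda>x. 2 * a - x) = M"
  proof (intro Levy_uniqueness ext)
    show "real_distribution (distr M borel (\<lambda>x. 2 * a - x))" by (rule real_distribution_distr) simp
    show "real_distribution M" by (rule normal_law_real_distribution[OF assms])
    fix t
    have "char (distr M borel (\<lambda>x. 2 * a - x)) t = (CLINT x|M. iexp (2 * a * t) * iexp (- t * x))"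
      unfolding char_def
      by (subst integral_distr) (auto intro!: Bochner_Integration.integral_cong simp: exp_add[symmetric] algebra_simps)
    also have "\<dots> = iexp (2 * a * t) * char M (- t)" unfolding char_def by simp
    also have "\<dots> = char M t"
      by (simp add: normal_law_char[OF assms] exp_add[symmetric] mult.assoc[symmetric])
    finally show "char (distr M borel (\<lambda>x. 2 * a - x)) t = char M t" .
  qed
  then have "measure M {a..} = measure (distr M borel (\<lambda>x. 2 * a - x)) {a..}" by simp
  also have "\<dots> = measure M {..a}"
    by (subst measure_distr) (auto intro!: arg_cong[where f="measure M"])
  finally have eq: "measure M {a..} = measure M {..a}" .
  have "1 = measure M ({a..} \<union> {..a})" using prob_space
    by (metis UNIV_I Un_iff atLeast_iff atMost_iff linorder_linear space_eq_univ subsetI subset_antisym top_greatest)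
  also have "\<dots> \<le> measure M {a..} + measure M {..a}" by (intro measure_Un_le) auto
  finally show "1/2 \<le> measure M {a..}" "1/2 \<le> measure M {..a}" using eq by auto
qed

lemma setwise_limit_char:
  assumes "\<And>n. real_distribution (V n)" "real_distribution M" "setwise_limit V M"
  shows "(\<lambda>n. char (V n) t) \<longlonglongrightarrow> char M t"
proof -
  have Re: "(\<integral>x. cos (t * x) \<partial>W) = Re (char W t)" and Im: "(\<integral>x. sin (t * x) \<partial>W) = Im (char W t)"
    if "real_distribution W" for W
  proof -
    interpret real_distribution W by fact
    have i: "integrable W (\<lambda>x. iexp (t * x))" by (intro integrable_const_bound[where B=1]) auto
    show "(\<integral>x. cos (t * x) \<partial>W) = Re (char W t)" "(\<integral>x. sin (t * x) \<partial>W) = Im (char W t)"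
      unfolding char_def using integral_Re[OF i] integral_Im[OF i] by (simp_all add: Re_exp Im_exp)
  qed
  have p: "prob_space W" "sets W = sets borel" if "real_distribution W" for W
    using that unfolding real_distribution_def real_distribution_axioms_def by auto
  interpret M: real_distribution M by (rule assms)
  have "(\<lambda>n. \<integral>x. cos (t * x) \<partial>V n) \<longlonglongrightarrow> (\<integral>x. cos (t * x) \<partial>M)"
    by (rule setwise_limit_integral[where C=1]) (use assms p in auto)
  moreover have "(\<lambda>n. \<integral>x. sin (t * x) \<partial>V n) \<longlonglongrightarrow> (\<integral>x. sin (t * x) \<partial>M)"
    by (rule setwise_limit_integral[where C=1]) (use assms p in auto)
  ultimately show ?thesis
    by (simp add: tendsto_complex_iff Re Im assms(1,2))
qed

text \<open>Both parameters stay bounded: the scale because the characteristic function of the limit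
  is continuous at \<open>0\<close>, the location because it is a median. A convergent subsequence
  of parameters then determines the characteristic function of \<open>M\<close>.\<close>

lemma normal_law_setwise_limit:
  assumes V: "\<And>n. normal_law (V n) (a n) (s n)" and M: "real_distribution M"
    and lim: "setwise_limit V M"
  shows "\<exists>r b q. strict_mono (r :: nat \<Rightarrow> nat) \<and> (\<lambda>n. a (r n)) \<longlonglongrightarrow> b \<and> (\<lambda>n. s (r n)) \<longlonglongrightarrow> q \<and> normal_law M b q"
proof -
  interpret real_distribution M by fact
  note rd = normal_law_real_distribution[OF V]
  note ch = setwise_limit_char[OF rd M lim]
  have s0: "0 \<le> s n" for n by (rule normal_law_nonneg[OF V])
  \<comment> \<open>At the fixed point \<open>d/2\<close> the limit has modulus above
    \<open>1/2\<close>, while the modulus for \<open>V n\<close> is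
    \<open>exp (- (s n * d/2)\<^sup>2 / 2)\<close>; this bounds \<open>s n\<close> for large
    \<open>n\<close>.\<close>
  have "eventually (\<lambda>t. norm (char M t) > 1/2) (at 0)"
    using isCont_char[of 0] by (intro order_tendstoD(1)[where y="norm (char M 0)"] tendsto_norm)
      (auto simp: isCont_def char_zero)
  then obtain d where "d > 0" "\<And>t. t \<noteq> 0 \<Longrightarrow> dist t 0 < d \<Longrightarrow> norm (char M t) > 1/2"
    unfolding eventually_at by auto
  then have t0: "norm (char M (d/2)) > 1/2" "d > 0" by (auto simp: dist_real_def)
  have "eventually (\<lambda>n. norm (char (V n) (d/2)) > 1/2) sequentially"
    by (rule order_tendstoD(1)[OF tendsto_norm[OF ch] t0(1)])
  then have evs: "eventually (\<lambda>n. s n \<le> 2 / d * sqrt (2 * ln 2)) sequentially"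
  proof eventually_elim
    case (elim n)
    have "exp (- ((s n * (d/2))\<^sup>2) / 2) > 1/2"
      using elim unfolding normal_law_char[OF V] by (simp add: norm_mult)
    then have "- ((s n * (d/2))\<^sup>2) / 2 > ln (1/2)" by (subst (asm) ln_less_cancel_iff[symmetric]) auto
    then have "(s n * (d/2))\<^sup>2 < 2 * ln 2" by (simp add: ln_div)
    then have "s n * (d/2) \<le> sqrt (2 * ln 2)" by (intro real_le_rsqrt) auto
    then show ?case using t0(2) by (simp add: field_simps)
  qed
  have "(\<lambda>n. measure M {- real n..real n}) \<longlonglongrightarrow> measure M (\<Union>n. {- real n..real n})"
    by (intro finite_Lim_measure_incseq) (auto simp: incseq_def)
  moreover have "(\<Union>n. {- real n..real n}) = UNIV"
  proof -
    have "\<exists>n. x \<in> {- real n..real n}" for x :: real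
      using real_arch_simple[of "\<bar>x\<bar>"] by (auto simp: abs_le_iff minus_le_iff)
    then show ?thesis by auto
  qed
  ultimately have "(\<lambda>n. measure M {- real n..real n}) \<longlonglongrightarrow> 1" using prob_space by simp
  then have "eventually (\<lambda>n. measure M {- real n..real n} > 1/2) sequentially"
    by (rule order_tendstoD) simp
  then obtain K where K: "measure M {- real K..real K} > 1/2"
    using eventually_sequentially by auto
  have "(\<lambda>n. measure (V n) {- real K..real K}) \<longlonglongrightarrow> measure M {- real K..real K}"
    using lim by (auto simp: setwise_limit_def)
  then have "eventually (\<lambda>n. measure (V n) {- real K..real K} > 1/2) sequentially"
    using K by (rule order_tendstoD)
  then have eva: "eventually (\<lambda>n. \<bar>a n\<bar> \<le> real K) sequentially"
  proof eventually_elim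
    case (elim n)
    interpret W: real_distribution "V n" by (rule rd)
    \<comment> \<open>A set of mass at least \<open>1/2\<close>, such as a half-line ending at the
      median, cannot miss an interval of mass greater than \<open>1/2\<close>.\<close>
    have dis: "False" if "S \<inter> {- real K..real K} = {}" "1/2 \<le> measure (V n) S" "S \<in> sets borel" for S
    proof -
      have "measure (V n) S + measure (V n) {- real K..real K} = measure (V n) (S \<union> {- real K..real K})"
        using that by (intro W.finite_measure_Union[symmetric]) auto
      also have "\<dots> \<le> 1" by simp
      finally show False using that elim by simp
    qed
    show ?case
    proof (rule ccontr)
      assume "\<not> \<bar>a n\<bar> \<le> real K"
      then have "a n > real K \<or> a n < - real K" by linarith
      then show False
        using dis[of "{a n..}"] dis[of "{..a n}"] normal_law_median[OF V, of n] by auto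
    qed
  qed
  obtain N where N: "\<And>n. n \<ge> N \<Longrightarrow> \<bar>a n\<bar> \<le> real K \<and> s n \<le> 2 / d * sqrt (2 * ln 2)"
    using eventually_conj[OF eva evs] unfolding eventually_sequentially by blast
  have "bounded (range (\<lambda>n. (a (n + N), s (n + N))))"
  proof (rule bounded_subset)
    show "bounded ({- real K..real K} \<times> {0..2 / d * sqrt (2 * ln 2)})"
      by (intro bounded_Times bounded_closed_interval)
    show "range (\<lambda>n. (a (n + N), s (n + N))) \<subseteq> {- real K..real K} \<times> {0..2 / d * sqrt (2 * ln 2)}"
      using N s0 by (auto simp: abs_le_iff minus_le_iff)
  qed
  then obtain l r where r: "strict_mono (r :: nat \<Rightarrow> nat)"
    and l: "((\<lambda>n. (a (n + N), s (n + N))) \<circ> r) \<longlonglongrightarrow> l"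
    using bounded_imp_convergent_subsequence by blast
  define b where "b = fst l"
  define q where "q = snd l"
  define r' where "r' n = r n + N" for n
  have r': "strict_mono r'" using r by (auto simp: r'_def strict_mono_def)
  have la: "(\<lambda>n. a (r' n)) \<longlonglongrightarrow> b" and ls: "(\<lambda>n. s (r' n)) \<longlonglongrightarrow> q"
    using tendsto_fst[OF l] tendsto_snd[OF l] by (simp_all add: b_def q_def r'_def comp_def)
  have "0 \<le> q" by (rule LIMSEQ_le_const[OF ls]) (use s0 in auto)
  have "normal_law M b q"
  proof (rule normal_law_iff_char[OF M \<open>0 \<le> q\<close>])
    fix t
    have "(\<lambda>n. char (V (r' n)) t) \<longlonglongrightarrow> char M t"
      using LIMSEQ_subseq_LIMSEQ[OF ch r'] by (simp add: comp_def)
    moreover have "(\<lambda>n. char (V (r' n)) t) \<longlonglongrightarrow> iexp (b * t) * complex_of_real (exp (- ((q * t)\<^sup>2) / 2))"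
      unfolding normal_law_char[OF V] by (intro tendsto_intros la ls) simp_all
    ultimately show "char M t = iexp (b * t) * complex_of_real (exp (- ((q * t)\<^sup>2) / 2))"
      by (rule LIMSEQ_unique)
  qed
  then show ?thesis using r' la ls by blast
qed

section \<open>Gaussian measures on a Hilbert space\<close>

text \<open>Riesz representation by the direct method: the representing vector minimises the energy
  \<open>J\<close>. The parallelogram law makes minimising sequences Cauchy, and the first variation
  at the minimum gives the identity.\<close>

lemma bounded_functional_inner_representation:
  fixes f :: "'a::{real_inner, banach} \<Rightarrow> real"
  assumes "bounded_linear f"
  shows "\<exists>m. \<forall>h. f h = m \<bullet> h"
proof -
  interpret f: bounded_linear f by fact
  obtain K where K: "\<And>x. \<bar>f x\<bar> \<le> norm x * K" using f.bounded by auto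
  define J where "J x = (x \<bullet> x) / 2 - f x" for x
  have Jlow: "- K\<^sup>2 / 2 \<le> J x" for x
  proof -
    have "f x \<le> norm x * K" using K[of x] by linarith
    moreover have "0 \<le> (norm x - K)\<^sup>2" by simp
    ultimately show ?thesis
      unfolding J_def power2_norm_eq_inner[symmetric] by (simp add: power2_eq_square algebra_simps)
  qed
  define I where "I = Inf (range J)"
  have bdd: "bdd_below (range J)" using Jlow by (intro bdd_belowI[of _ "- K\<^sup>2 / 2"]) blast
  have IJ: "I \<le> J x" for x unfolding I_def by (rule cInf_lower[OF _ bdd]) simp
  have "\<exists>x. J x < I + 1 / real (Suc n)" for n
  proof -
    have "Inf (range J) < I + 1 / real (Suc n)" by (simp add: I_def)
    from cInf_lessD[OF _ this] show ?thesis by auto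
  qed
  then obtain X where X: "\<And>n. J (X n) < I + 1 / real (Suc n)" by metis
  \<comment> \<open>The linear part of \<open>J\<close> cancels, so two points with nearly minimal
    energy are close to each other.\<close>
  have par: "(norm (x - y))\<^sup>2 = 4 * (J x + J y - 2 * J ((1/2) *\<^sub>R (x + y)))" for x y
    unfolding J_def power2_norm_eq_inner
    by (simp add: f.add f.scaleR inner_add inner_diff inner_commute field_simps)
  have "Cauchy X"
  proof (rule CauchyI)
    fix e :: real assume e: "e > 0"
    then obtain N where N: "1 / real (Suc N) < e\<^sup>2 / 8"
      using nat_approx_posE[of "e\<^sup>2/8"] by auto
    have "norm (X m - X n) < e" if "m \<ge> N" "n \<ge> N" for m n
    proof -
      have "1 / real (Suc m) \<le> 1 / real (Suc N)" "1 / real (Suc n) \<le> 1 / real (Suc N)"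
        using that by (auto simp: field_simps)
      then have "J (X m) + J (X n) - 2 * J ((1/2) *\<^sub>R (X m + X n)) < e\<^sup>2 / 4"
        using X[of m] X[of n] IJ[of "(1/2) *\<^sub>R (X m + X n)"] N by linarith
      then have "(norm (X m - X n))\<^sup>2 < e\<^sup>2" unfolding par by simp
      then show ?thesis by (rule power2_less_imp_less) (use e in simp)
    qed
    then show "\<exists>M. \<forall>m\<ge>M. \<forall>n\<ge>M. norm (X m - X n) < e" by blast
  qed
  then obtain m where m: "X \<longlonglongrightarrow> m" using Cauchy_convergent convergent_def by blast
  have "(\<lambda>n. J (X n)) \<longlonglongrightarrow> J m"
    unfolding J_def by (intro tendsto_intros f.tendsto m) auto
  moreover have "(\<lambda>n. I + 1 / real (Suc n)) \<longlonglongrightarrow> I + 0"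
    by (intro tendsto_intros LIMSEQ_Suc[OF lim_1_over_n])
  ultimately have "J m \<le> I + 0" by (rule LIMSEQ_le) (use X less_imp_le in blast)
  then have min: "J m \<le> J x" for x using IJ[of x] by linarith
  have "f h = m \<bullet> h" for h
  proof (rule ccontr)
    assume ne: "f h \<noteq> m \<bullet> h"
    define c where "c = f h - m \<bullet> h"
    \<comment> \<open>The perturbation \<open>t = c / b\<close> lowers \<open>J\<close> by at least
      \<open>c * (c / b) / 2\<close>; the summand \<open>1\<close> keeps \<open>b\<close>
      positive.\<close>
    define b where "b = h \<bullet> h + 1"
    have b: "b > 0" unfolding b_def by (simp add: add_nonneg_pos)
    have "J (m + t *\<^sub>R h) = J m - c * t + t\<^sup>2 * (h \<bullet> h) / 2" for t
      unfolding J_def c_def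
      by (simp add: f.add f.scaleR inner_add inner_commute[of h m] power2_eq_square field_simps)
    from this[of "c / b"]
    have "J (m + (c / b) *\<^sub>R h) = J m - c * (c/b) + (c/b)\<^sup>2 * (h \<bullet> h) / 2" .
    moreover have "(c/b)\<^sup>2 * (h \<bullet> h) \<le> (c/b)\<^sup>2 * b" unfolding b_def by (intro mult_left_mono) auto
    moreover have "(c/b)\<^sup>2 * b = c * (c/b)" using b by (simp add: power2_eq_square)
    moreover have "c * (c / b) > 0" using ne b by (simp add: c_def zero_less_mult_iff zero_less_divide_iff) linarith
    ultimately show False using min[of "m + (c / b) *\<^sub>R h"] by linarith
  qed
  then show ?thesis by blast
qed

text \<open>Mean and covariance as functionals of test vectors, usable before a mean vector or a
  covariance operator is known to exist.\<close>

definition gmean :: "'h::real_inner measure \<Rightarrow> 'h \<Rightarrow> real" where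
  "gmean M h = (\<integral>x. x \<bullet> h \<partial>M)"

definition gcov :: "'h::real_inner measure \<Rightarrow> 'h \<Rightarrow> 'h \<Rightarrow> real" where
  "gcov M h k = (\<integral>x. (x \<bullet> h - gmean M h) * (x \<bullet> k - gmean M k) \<partial>M)"

lemma gaussian_prob_space: "gaussian_measure M \<Longrightarrow> prob_space M"
  and gaussian_sets: "gaussian_measure M \<Longrightarrow> sets M = sets borel"
  by (auto simp: gaussian_measure_def)

lemma inner_borel_measurable:
  "sets M = sets borel \<Longrightarrow> (\<lambda>x. x \<bullet> h) \<in> borel_measurable (M :: 'h::real_inner measure)"
  by (simp cong: measurable_cong_sets) (intro borel_measurable_continuous_onI continuous_intros)

text \<open>The parameters of the marginal are recovered from its first two moments; as
  \<open>s\<close> is nonnegative it must be the root of the variance, also in the degenerate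
  case.\<close>

lemma gaussian_inner:
  assumes "gaussian_measure M"
  shows "normal_law (distr M borel (\<lambda>x. x \<bullet> h)) (gmean M h) (sqrt (gcov M h h))"
    and "has_bochner_integral M (\<lambda>x. x \<bullet> h) (gmean M h)"
    and "has_bochner_integral M (\<lambda>x. (x \<bullet> h - gmean M h)\<^sup>2) (gcov M h h)"
proof -
  note m [measurable] = inner_borel_measurable[OF gaussian_sets[OF assms], of h]
  have "bounded_linear (\<lambda>x. x \<bullet> h)" by (rule bounded_linear_inner_left)
  then obtain a s where as: "normal_law (distr M borel (\<lambda>x. x \<bullet> h)) a s"
    using assms unfolding gaussian_measure_def gaussian_on_reals_iff by blast
  have 1: "has_bochner_integral M (\<lambda>x. x \<bullet> h) a"
    using normal_law_moments(1)[OF as] by (simp add: has_bochner_integral_iff integrable_distr_eq integral_distr)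
  then have a: "gmean M h = a" unfolding gmean_def by (rule has_bochner_integral_integral_eq)
  have 2: "has_bochner_integral M (\<lambda>x. (x \<bullet> h - a)\<^sup>2) (s\<^sup>2)"
    using normal_law_moments(2)[OF as] by (simp add: has_bochner_integral_iff integrable_distr_eq integral_distr)
  then have c: "gcov M h h = s\<^sup>2"
    unfolding gcov_def a power2_eq_square[symmetric] by (rule has_bochner_integral_integral_eq)
  have s: "sqrt (gcov M h h) = s" unfolding c using normal_law_nonneg[OF as] by simp
  show "normal_law (distr M borel (\<lambda>x. x \<bullet> h)) (gmean M h) (sqrt (gcov M h h))"
    unfolding s a by (rule as)
  show "has_bochner_integral M (\<lambda>x. x \<bullet> h) (gmean M h)" unfolding a by (rule 1)
  show "has_bochner_integral M (\<lambda>x. (x \<bullet> h - gmean M h)\<^sup>2) (gcov M h h)"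
    unfolding a c by (rule 2)
qed

lemma gcov_nonneg: "gaussian_measure M \<Longrightarrow> 0 \<le> gcov M h h"
  unfolding gcov_def by simp

lemma gaussian_integrable:
  assumes "gaussian_measure M"
  shows "integrable M (\<lambda>x. x \<bullet> h)"
    and "integrable M (\<lambda>x. (x \<bullet> h - gmean M h) * (x \<bullet> k - gmean M k))"
proof -
  note m [measurable] = inner_borel_measurable[OF gaussian_sets[OF assms]]
  show "integrable M (\<lambda>x. x \<bullet> h)"
    using gaussian_inner(2)[OF assms, of h] by (simp add: has_bochner_integral_iff)
  have i: "integrable M (\<lambda>x. (x \<bullet> h - gmean M h)\<^sup>2)" for h
    using gaussian_inner(3)[OF assms, of h] by (simp add: has_bochner_integral_iff)
  show "integrable M (\<lambda>x. (x \<bullet> h - gmean M h) * (x \<bullet> k - gmean M k))"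
  proof (rule Bochner_Integration.integrable_bound[OF Bochner_Integration.integrable_add[OF i[of h] i[of k]]])
    have "\<bar>u * v\<bar> \<le> u\<^sup>2 + v\<^sup>2" for u v :: real
    proof -
      have "2 * (\<bar>u\<bar> * \<bar>v\<bar>) \<le> u\<^sup>2 + v\<^sup>2"
        using sum_squares_bound[of "\<bar>u\<bar>" "\<bar>v\<bar>"] by simp
      moreover have "0 \<le> \<bar>u\<bar> * \<bar>v\<bar>" by simp
      ultimately show ?thesis unfolding abs_mult by linarith
    qed
    then show "AE x in M. norm ((x \<bullet> h - gmean M h) * (x \<bullet> k - gmean M k))
        \<le> norm ((x \<bullet> h - gmean M h)\<^sup>2 + (x \<bullet> k - gmean M k)\<^sup>2)"
      by simp
  qed measurable
qed

lemma gmean_add: "gaussian_measure M \<Longrightarrow> gmean M (h + k) = gmean M h + gmean M k"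
  unfolding gmean_def using gaussian_integrable(1)[of M] by (simp add: inner_add)

lemma gmean_scaleR: "gmean M (c *\<^sub>R h) = c * gmean M h"
  unfolding gmean_def by simp

lemma gmean_sum:
  assumes "gaussian_measure M" "finite I"
  shows "gmean M (\<Sum>i\<in>I. t i *\<^sub>R e i) = (\<Sum>i\<in>I. t i * gmean M (e i))"
  using assms(2)
  by induction (simp add: gmean_def, simp add: gmean_add[OF assms(1)] gmean_scaleR)

lemma gcov_commute: "gcov M h k = gcov M k h"
  unfolding gcov_def by (simp add: mult.commute)

lemma gcov_add_left:
  assumes "gaussian_measure M"
  shows "gcov M (h + h') k = gcov M h k + gcov M h' k"
proof -
  have "gcov M (h + h') k = (\<integral>x. (x \<bullet> h - gmean M h) * (x \<bullet> k - gmean M k)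
      + (x \<bullet> h' - gmean M h') * (x \<bullet> k - gmean M k) \<partial>M)"
    unfolding gcov_def gmean_add[OF assms]
    by (intro Bochner_Integration.integral_cong) (auto simp: inner_add algebra_simps)
  then show ?thesis
    unfolding gcov_def using gaussian_integrable(2)[OF assms] by simp
qed

lemma gcov_scaleR_left: "gcov M (c *\<^sub>R h) k = c * gcov M h k"
proof -
  have "gcov M (c *\<^sub>R h) k = (\<integral>x. c * ((x \<bullet> h - gmean M h) * (x \<bullet> k - gmean M k)) \<partial>M)"
    unfolding gcov_def gmean_scaleR
    by (intro Bochner_Integration.integral_cong) (auto simp: algebra_simps)
  then show ?thesis unfolding gcov_def by simp
qed

lemma gcov_sum_left:
  assumes "gaussian_measure M" "finite I"
  shows "gcov M (\<Sum>i\<in>I. t i *\<^sub>R e i) k = (\<Sum>i\<in>I. t i * gcov M (e i) k)"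
  using assms(2)
  by induction (simp add: gcov_def gmean_def, simp add: gcov_add_left[OF assms(1)] gcov_scaleR_left)

text \<open>The mean is obtained weakly, without integrability of the norm: medians bound the linear
  functional \<open>gmean M\<close>, and Riesz turns it into a vector. It is needed for the third
  class, where a covariance presupposes some mean.\<close>

lemma gaussian_has_mean:
  fixes M :: "'h::{banach, real_inner, second_countable_topology} measure"
  assumes G: "gaussian_measure M"
  shows "\<exists>m. has_mean M m"
proof -
  interpret prob_space M using G by (rule gaussian_prob_space)
  note sb [measurable_cong] = gaussian_sets[OF G]
  have sp: "space M = UNIV" using sets_eq_imp_space_eq[OF sb] by simp
  have cb [measurable]: "cball 0 r \<in> sets M" for r :: real using sb by simp
  have "(\<lambda>n. measure M (cball 0 (real n))) \<longlonglongrightarrow> measure M (\<Union>n. cball 0 (real n))"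
    by (rule finite_Lim_measure_incseq) (use cb in blast, simp add: incseq_def subset_cball)
  moreover have "(\<Union>n. cball (0::'h) (real n)) = UNIV"
    by (auto simp: real_arch_simple)
  ultimately have "(\<lambda>n. measure M (cball 0 (real n))) \<longlonglongrightarrow> 1" using prob_space sp by simp
  then have "eventually (\<lambda>n. measure M (cball 0 (real n)) > 1/2) sequentially"
    by (rule order_tendstoD) simp
  then obtain K where K: "measure M (cball 0 (real K)) > 1/2"
    using eventually_sequentially by auto
  text \<open>A half-space of mass \<open>1/2\<close> meets every ball of larger mass, which bounds the mean functional.\<close>
  have up: "gmean M h \<le> norm h * real K" for h
  proof (rule ccontr)
    assume c: "\<not> gmean M h \<le> norm h * real K"
    have m [measurable]: "(\<lambda>x. x \<bullet> h) \<in> borel_measurable M" by (rule inner_borel_measurable[OF sb])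
    let ?S = "{x \<in> space M. gmean M h \<le> x \<bullet> h}"
    have "1/2 \<le> measure (distr M borel (\<lambda>x. x \<bullet> h)) {gmean M h..}"
      by (rule normal_law_median(1)[OF gaussian_inner(1)[OF G]])
    also have "\<dots> = measure M ?S"
      by (subst measure_distr) (auto intro!: arg_cong[where f="measure M"])
    finally have S: "1/2 \<le> measure M ?S" .
    have "?S \<inter> cball 0 (real K) = {}"
    proof -
      have False if "gmean M h \<le> x \<bullet> h" "norm x \<le> real K" for x
      proof -
        have "x \<bullet> h \<le> norm x * norm h" by (rule norm_cauchy_schwarz)
        also have "\<dots> \<le> real K * norm h" using that by (intro mult_right_mono) auto
        finally show False using that c by (simp add: mult.commute)
      qed
      then show ?thesis by auto
    qed
    then have "measure M (?S \<union> cball 0 (real K)) = measure M ?S + measure M (cball 0 (real K))"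
      by (intro finite_measure_Union) measurable
    then show False using S K prob_le_1[of "?S \<union> cball 0 (real K)"] by linarith
  qed
  have "bounded_linear (gmean M)"
  proof (rule bounded_linear_intro)
    show "norm (gmean M h) \<le> norm h * real K" for h
      using up[of h] up[of "- h"] gmean_scaleR[of M "-1" h] by (simp add: abs_le_iff)
  qed (simp_all add: gmean_add[OF G] gmean_scaleR)
  then obtain m where m: "\<forall>h. gmean M h = m \<bullet> h"
    using bounded_functional_inner_representation by blast
  have "has_bochner_integral M (\<lambda>x. x \<bullet> h) (m \<bullet> h)" for h
    using gaussian_inner(2)[OF G, of h] m by simp
  then show ?thesis unfolding has_mean_def by blast
qed

section \<open>Stability of Gaussian measures and their moments under setwise limits\<close>

lemma setwise_limit_distr:
  assumes "\<And>n. sets (V n) = sets M" "f \<in> measurable M N" "setwise_limit V M"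
  shows "setwise_limit (\<lambda>n. distr (V n) N f) (distr M N f)"
proof -
  have m: "f \<in> measurable (V n) N" for n using assms(1,2) by (simp cong: measurable_cong_sets)
  have "space (V n) = space M" for n using assms(1) by (rule sets_eq_imp_space_eq)
  then show ?thesis
    using assms(3) measurable_sets[OF assms(2)]
    unfolding setwise_limit_def by (auto simp: measure_distr[OF m] measure_distr[OF assms(2)])
qed

lemma gaussian_setwise_limit_law:
  assumes V: "\<And>n. gaussian_measure (V n)" and M: "prob_space M" "sets M = sets borel"
    and lim: "setwise_limit V M" and f: "bounded_linear f"
    and law: "\<And>n. normal_law (distr (V n) borel f) (a n) (s n)"
  shows "\<exists>r b q. strict_mono (r :: nat \<Rightarrow> nat) \<and> (\<lambda>n. a (r n)) \<longlonglongrightarrow> b \<and> (\<lambda>n. s (r n)) \<longlonglongrightarrow> q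
    \<and> normal_law (distr M borel f) b q"
proof (rule normal_law_setwise_limit[OF law])
  have "f \<in> borel_measurable borel"
    using f by (intro borel_measurable_continuous_onI linear_continuous_on)
  then have fm: "f \<in> borel_measurable M" using M(2) by (simp cong: measurable_cong_sets)
  show "real_distribution (distr M borel f)"
    using prob_space.real_distribution_distr[OF M(1) fm] .
  show "setwise_limit (\<lambda>n. distr (V n) borel f) (distr M borel f)"
    using gaussian_sets[OF V] M(2) fm lim by (intro setwise_limit_distr) auto
qed

lemma gaussian_setwise_limit:
  assumes V: "\<And>n. gaussian_measure (V n)" and M: "prob_space M" "sets M = sets borel"
    and lim: "setwise_limit V M"
  shows "gaussian_measure M"
  unfolding gaussian_measure_def
proof (intro conjI allI impI M)
  fix f :: "'a \<Rightarrow> real" assume f: "bounded_linear f"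
  have "\<exists>a s. normal_law (distr (V n) borel f) a s" for n
    using V f unfolding gaussian_measure_def gaussian_on_reals_iff by blast
  then obtain a s where "\<And>n. normal_law (distr (V n) borel f) (a n) (s n)" by metis
  from gaussian_setwise_limit_law[OF V M lim f this] show "gaussian_on_reals (distr M borel f)"
    unfolding gaussian_on_reals_iff by blast
qed

text \<open>The functional \<open>x \<bullet> h\<close> is unbounded, so setwise convergence does
  not reach its moments directly. They pass to the limit because they are the parameters of the
  marginals, which converge along a subsequence.\<close>

lemma gaussian_setwise_limit_moments:
  assumes V: "\<And>n. gaussian_measure (V n)" and M: "prob_space M" "sets M = sets borel"
    and lim: "setwise_limit V M"
  shows "(\<And>n. gmean (V n) h = a) \<Longrightarrow> gmean M h = a"
    and "(\<And>n. gcov (V n) h h = c) \<Longrightarrow> gcov M h h = c"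
proof -
  note G = gaussian_setwise_limit[OF assms]
  have "bounded_linear (\<lambda>x. x \<bullet> h)" by (rule bounded_linear_inner_left)
  from gaussian_setwise_limit_law[OF V M lim this gaussian_inner(1)[OF V]]
  obtain r b q where r: "(\<lambda>n. gmean (V (r n)) h) \<longlonglongrightarrow> b"
    "(\<lambda>n. sqrt (gcov (V (r n)) h h)) \<longlonglongrightarrow> q"
    and law: "normal_law (distr M borel (\<lambda>x. x \<bullet> h)) b q" by blast
  have law': "normal_law (distr M borel (\<lambda>x. x \<bullet> h)) (gmean M h) (sqrt (gcov M h h))"
    by (rule gaussian_inner(1)[OF G])
  have b: "b = gmean M h"
    using normal_law_moments(1)[OF law] normal_law_moments(1)[OF law'] by (rule has_bochner_integral_eq)
  have q: "q\<^sup>2 = (sqrt (gcov M h h))\<^sup>2"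
    using normal_law_moments(2)[OF law] normal_law_moments(2)[OF law'] unfolding b
    by (rule has_bochner_integral_eq)
  show "gmean M h = a" if "\<And>n. gmean (V n) h = a"
    using r(1) b unfolding that by (simp add: LIMSEQ_const_iff)
  show "gcov M h h = c" if "\<And>n. gcov (V n) h h = c"
  proof -
    have "sqrt c = q" using r(2) unfolding that by (simp add: LIMSEQ_const_iff)
    moreover have "0 \<le> c" using gcov_nonneg[OF V, of 0 h] that by simp
    ultimately show ?thesis using q gcov_nonneg[OF G, of h] by (metis real_sqrt_pow2)
  qed
qed

lemma gaussian_has_mean_iff:
  assumes "gaussian_measure M"
  shows "has_mean M m \<longleftrightarrow> (\<forall>h. gmean M h = m \<bullet> h)"
  using gaussian_inner(2)[OF assms] unfolding has_mean_def
  by (metis gmean_def has_bochner_integral_integral_eq)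

lemma has_covariance_gcov:
  assumes "gaussian_measure M" "has_covariance M C"
  shows "gcov M h k = C h \<bullet> k"
proof -
  from assms(2) obtain m where m: "has_mean M m"
    and c: "has_bochner_integral M (\<lambda>x. ((x - m) \<bullet> h) * ((x - m) \<bullet> k)) (C h \<bullet> k)"
    unfolding has_covariance_def by blast
  show ?thesis
    using has_bochner_integral_integral_eq[OF c] m gaussian_has_mean_iff[OF assms(1), of m]
    unfolding gcov_def by (simp add: inner_diff)
qed

lemma has_mean_setwise_limit:
  assumes V: "\<And>n. gaussian_measure (V n)" and M: "prob_space M" "sets M = sets borel"
    and lim: "setwise_limit V M" and m: "\<And>n. has_mean (V n) m"
  shows "has_mean M m"
proof -
  have "gmean (V n) h = m \<bullet> h" for n h
    using m gaussian_has_mean_iff[OF V] by blast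
  then have "gmean M h = m \<bullet> h" for h
    by (rule gaussian_setwise_limit_moments(1)[OF V M lim])
  then show ?thesis
    using gaussian_has_mean_iff[OF gaussian_setwise_limit[OF V M lim]] by blast
qed

text \<open>Only variances pass to the limit directly. Polarisation recovers the mixed terms, with
  the symmetry of \<open>C\<close> read off from the covariance of \<open>V 0\<close>.\<close>

lemma has_covariance_setwise_limit:
  fixes M :: "'h::{banach, real_inner, second_countable_topology} measure"
  assumes V: "\<And>n. gaussian_measure (V n)" and M: "prob_space M" "sets M = sets borel"
    and lim: "setwise_limit V M" and c: "\<And>n. has_covariance (V n) C"
  shows "has_covariance M C"
proof -
  note G = gaussian_setwise_limit[OF V M lim]
  obtain m where m: "has_mean M m" using gaussian_has_mean[OF G] by blast
  have diag: "gcov M h h = C h \<bullet> h" for h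
    using gaussian_setwise_limit_moments(2)[OF V M lim] has_covariance_gcov[OF V c] by blast
  have sym: "C h \<bullet> k = C k \<bullet> h" for h k
    using gcov_commute[of "V 0" h k] by (simp add: has_covariance_gcov[OF V c])
  have "gcov M h k = C h \<bullet> k" for h k
  proof -
    have "gcov M (h + k) (h + k) = gcov M h h + 2 * gcov M h k + gcov M k k"
      using gcov_add_left[OF G] gcov_commute[of M] by (smt (verit))
    then show ?thesis unfolding diag using sym[of h k]
      by (simp add: blinfun.add_right inner_add)
  qed
  then have "has_bochner_integral M (\<lambda>x. ((x - m) \<bullet> h) * ((x - m) \<bullet> k)) (C h \<bullet> k)" for h k
    using gaussian_integrable(2)[OF G, of h k] m gaussian_has_mean_iff[OF G, of m]
    unfolding gcov_def by (simp add: has_bochner_integral_iff inner_diff)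
  then show ?thesis unfolding has_covariance_def using m by blast
qed

section \<open>Independence from factorising characteristic functions\<close>

text \<open>Levy uniqueness applied to the law of \<open>X\<close> under a reweighted measure: a
  weight that acts on all exponentials of \<open>X\<close> as the constant \<open>\<kappa>\<close>
  acts so on its indicators too. This is the exchange of one exponential for one indicator on which
  \<open>measure_prod_char\<close> rests.\<close>

lemma real_weight_char:
  fixes X :: "'a \<Rightarrow> real" and w :: "'a \<Rightarrow> real"
  assumes P: "prob_space M" and X [measurable]: "X \<in> borel_measurable M"
    and w [measurable]: "w \<in> borel_measurable M" and w1: "\<And>x. \<bar>w x\<bar> \<le> 1"
    and eq: "\<And>t. (CLINT x|M. complex_of_real (w x) * iexp (t * X x)) = complex_of_real \<kappa> * (CLINT x|M. iexp (t * X x))"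
    and B [measurable]: "B \<in> sets borel"
  shows "(\<integral>x. w x * indicator B (X x) \<partial>M) = \<kappa> * measure M (X -` B \<inter> space M)"
proof -
  interpret prob_space M by fact
  have wi: "integrable M w" by (intro integrable_const_bound[where B=1]) (use w1 in auto)
  have iei: "integrable M (\<lambda>x. iexp (t * X x))" for t by (intro integrable_const_bound[where B=1]) auto
  have wiei: "integrable M (\<lambda>x. complex_of_real (w x) * iexp (t * X x))" for t
    by (intro integrable_const_bound[where B=1]) (use w1 in \<open>auto simp: norm_mult\<close>)
  \<comment> \<open>At frequency \<open>0\<close> the hypothesis identifies \<open>\<kappa>\<close>
    as the mean of the weight, which bounds it by \<open>1\<close>.\<close>
  have ex1: "(\<integral>x. w x \<partial>M) = \<kappa>"
  proof -
    have "complex_of_real (\<integral>x. w x \<partial>M) = complex_of_real \<kappa>"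
      using eq[of 0] by (simp add: prob_space)
    then show ?thesis by simp
  qed
  have "\<bar>\<integral>x. w x \<partial>M\<bar> \<le> (\<integral>x. \<bar>w x\<bar> \<partial>M)" by (rule integral_abs_bound)
  also have "\<dots> \<le> (\<integral>x. 1 \<partial>M)" by (intro integral_mono) (use wi w1 in auto)
  finally have "\<bar>\<kappa>\<bar> \<le> 1" unfolding ex1 by (simp add: prob_space)
  \<comment> \<open>A shift by \<open>1\<close> would leave the normaliser
    \<open>1 + \<kappa>\<close>, which may vanish; a shift by \<open>2\<close> keeps it
    positive.\<close>
  then have k: "2 + \<kappa> > 0" by linarith
  text \<open>Shifting the weight by \<open>2\<close> gives a probability density, to which Levy's uniqueness theorem applies.\<close>
  define f where "f x = (2 + w x) / (2 + \<kappa>)" for x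
  have f [measurable]: "f \<in> borel_measurable M" unfolding f_def[abs_def] by measurable
  have f0: "0 \<le> f x" for x using w1[of x] k unfolding f_def by (intro divide_nonneg_pos) linarith+
  have fi: "integrable M f" unfolding f_def[abs_def] using wi by auto
  have f1: "(\<integral>x. f x \<partial>M) = 1" unfolding f_def[abs_def] using wi ex1 k by (simp add: prob_space)
  define N where "N = density M (\<lambda>x. ennreal (f x))"
  have [measurable]: "X \<in> borel_measurable N" unfolding N_def by simp
  interpret N: prob_space N unfolding N_def
    by (intro prob_spaceI) (use fi f0 f1 in \<open>simp add: emeasure_density nn_integral_eq_integral cong: nn_integral_cong\<close>)
  have "distr N borel X = distr M borel X"
  proof (intro Levy_uniqueness ext)
    show "real_distribution (distr N borel X)" "real_distribution (distr M borel X)"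
      by (rule N.real_distribution_distr real_distribution_distr, measurable)+
    fix t
    have "char (distr N borel X) t = (CLINT x|N. iexp (t * X x))"
      unfolding char_def by (simp add: integral_distr)
    also have "\<dots> = (CLINT x|M. f x *\<^sub>R iexp (t * X x))"
      unfolding N_def by (intro integral_density) (use f0 in auto)
    also have "\<dots> = (CLINT x|M. (2 / (2 + \<kappa>)) *\<^sub>R iexp (t * X x) + (1 / (2 + \<kappa>)) *\<^sub>R (complex_of_real (w x) * iexp (t * X x)))"
      unfolding f_def scaleR_conv_of_real
      by (intro Bochner_Integration.integral_cong) (auto simp: add_divide_distrib distrib_right)
    also have "\<dots> = (2 / (2 + \<kappa>)) *\<^sub>R (CLINT x|M. iexp (t * X x)) + (1 / (2 + \<kappa>)) *\<^sub>R (CLINT x|M. complex_of_real (w x) * iexp (t * X x))"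
      using iei wiei by simp
    also have "\<dots> = (2 / (2 + \<kappa>)) *\<^sub>R (CLINT x|M. iexp (t * X x)) + (1 / (2 + \<kappa>)) *\<^sub>R (complex_of_real \<kappa> * (CLINT x|M. iexp (t * X x)))"
      by (simp only: eq)
    also have "\<dots> = ((2 + \<kappa>) / (2 + \<kappa>)) *\<^sub>R (CLINT x|M. iexp (t * X x))"
      unfolding add_divide_distrib by (simp add: scaleR_conv_of_real algebra_simps)
    also have "\<dots> = (CLINT x|M. iexp (t * X x))" using k by simp
    also have "\<dots> = char (distr M borel X) t"
      unfolding char_def by (simp add: integral_distr)
    finally show "char (distr N borel X) t = char (distr M borel X) t" .
  qed
  then have "(\<integral>x. indicator B x \<partial>distr N borel X) = (\<integral>x. indicator B x \<partial>distr M borel X :: real)" by simp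
  then have e1: "(\<integral>x. indicator B (X x) \<partial>N) = (\<integral>x. indicator B (X x) \<partial>M :: real)"
    by (subst (asm) (1 2) integral_distr) auto
  have e2: "(\<integral>x. indicator B (X x) \<partial>N) = (\<integral>x. f x * indicator B (X x) \<partial>M :: real)"
    unfolding N_def by (subst integral_density) (use f0 in auto)
  have ib: "integrable M (\<lambda>x. indicator B (X x) :: real)"
    by (intro integrable_const_bound[where B=1]) (auto simp: indicator_def)
  have iwb: "integrable M (\<lambda>x. w x * indicator B (X x) :: real)"
    by (intro integrable_const_bound[where B=1]) (use w1 in \<open>auto simp: indicator_def\<close>)
  have "(\<integral>x. f x * indicator B (X x) \<partial>M :: real) = (\<integral>x. (2 / (2 + \<kappa>)) * indicator B (X x) + (1 / (2 + \<kappa>)) * (w x * indicator B (X x)) \<partial>M)"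
    unfolding f_def by (intro Bochner_Integration.integral_cong) (auto simp: add_divide_distrib distrib_right)
  also have "\<dots> = (2 / (2 + \<kappa>)) * (\<integral>x. indicator B (X x) \<partial>M) + (1 / (2 + \<kappa>)) * (\<integral>x. w x * indicator B (X x) \<partial>M)"
    using ib iwb by simp
  finally have e3: "(\<integral>x. f x * indicator B (X x) \<partial>M :: real) = (2 / (2 + \<kappa>)) * (\<integral>x. indicator B (X x) \<partial>M) + (1 / (2 + \<kappa>)) * (\<integral>x. w x * indicator B (X x) \<partial>M)" .
  have "(2 / (2 + \<kappa>)) * (\<integral>x. indicator B (X x) \<partial>M) + (1 / (2 + \<kappa>)) * (\<integral>x. w x * indicator B (X x) \<partial>M) = (\<integral>x. indicator B (X x) \<partial>M :: real)"
    using e1 e2 e3 by simp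
  note main = this
  have "(\<integral>x. w x * indicator B (X x) \<partial>M) = \<kappa> * (\<integral>x. indicator B (X x) \<partial>M)"
  proof -
    have "v = \<kappa> * i" if "2 / (2 + \<kappa>) * i + 1 / (2 + \<kappa>) * v = i" for i v
    proof -
      have "(2 + \<kappa>) * (2 / (2 + \<kappa>) * i + 1 / (2 + \<kappa>) * v) = 2 * i + v"
        using k by (simp add: distrib_left)
      then show ?thesis unfolding that by (simp add: distrib_right)
    qed
    then show ?thesis using main by blast
  qed
  also have "(\<integral>x. indicator B (X x) \<partial>M :: real) = (\<integral>x. indicator (X -` B \<inter> space M) x \<partial>M)"
    by (intro Bochner_Integration.integral_cong) (auto simp: indicator_def)
  finally show ?thesis by simp
qed

text \<open>The real and imaginary parts of the weight satisfy the hypothesis separately, because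
  the conjugate weight satisfies it with \<open>cnj \<kappa>\<close>.\<close>

lemma complex_weight_char:
  fixes X :: "'a \<Rightarrow> real" and w :: "'a \<Rightarrow> complex"
  assumes P: "prob_space M" and X [measurable]: "X \<in> borel_measurable M"
    and w [measurable]: "w \<in> borel_measurable M" and w1: "\<And>x. norm (w x) \<le> 1"
    and eq: "\<And>t. (CLINT x|M. w x * iexp (t * X x)) = \<kappa> * (CLINT x|M. iexp (t * X x))"
    and B [measurable]: "B \<in> sets borel"
  shows "(CLINT x|M. w x * indicator B (X x)) = \<kappa> * complex_of_real (measure M (X -` B \<inter> space M))"
proof -
  interpret prob_space M by fact
  have wi: "integrable M (\<lambda>x. w x * iexp (t * X x))" for t
    by (intro integrable_const_bound[where B=1]) (use w1 in \<open>auto simp: norm_mult\<close>)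
  have [measurable]: "(\<lambda>x. cnj (w x)) \<in> borel_measurable M"
    by (rule measurable_compose[OF w]) (intro borel_measurable_continuous_onI continuous_intros)
  have cwi: "integrable M (\<lambda>x. cnj (w x) * iexp (t * X x))" for t
    by (intro integrable_const_bound[where B=1]) (use w1 in \<open>auto simp: norm_mult\<close>)
  \<comment> \<open>The hypothesis is conjugated at frequency \<open>- t\<close>; conjugation
    reverses the sign, and the exponential with \<open>t\<close> reappears on both sides.\<close>
  have ceq: "(CLINT x|M. cnj (w x) * iexp (t * X x)) = cnj \<kappa> * (CLINT x|M. iexp (t * X x))" for t
  proof -
    have cn: "cnj (iexp (- t * y)) = iexp (t * y)" for y by (simp add: exp_cnj)
    have "(CLINT x|M. cnj (w x) * iexp (t * X x)) = (CLINT x|M. cnj (w x * iexp (- t * X x)))"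
      by (simp only: complex_cnj_mult cn)
    also have "\<dots> = cnj (\<kappa> * (CLINT x|M. iexp (- t * X x)))" by (simp only: Bochner_Integration.integral_cnj eq)
    also have "\<dots> = cnj \<kappa> * (CLINT x|M. cnj (iexp (- t * X x)))" by (simp only: Bochner_Integration.integral_cnj complex_cnj_mult)
    finally show ?thesis by (simp only: cn)
  qed
  have re: "(CLINT x|M. complex_of_real (Re (w x)) * iexp (t * X x)) = complex_of_real (Re \<kappa>) * (CLINT x|M. iexp (t * X x))" for t
  proof -
    have *: "complex_of_real (Re z) = (z + cnj z) / 2" for z by (simp add: complex_add_cnj)
    have "(CLINT x|M. complex_of_real (Re (w x)) * iexp (t * X x))
      = (CLINT x|M. (w x * iexp (t * X x) + cnj (w x) * iexp (t * X x)) / 2)"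
      by (simp only: * times_divide_eq_left distrib_right)
    also have "\<dots> = ((CLINT x|M. w x * iexp (t * X x)) + (CLINT x|M. cnj (w x) * iexp (t * X x))) / 2"
      using wi cwi by simp
    also have "\<dots> = (\<kappa> * (CLINT x|M. iexp (t * X x)) + cnj \<kappa> * (CLINT x|M. iexp (t * X x))) / 2"
      by (simp only: eq ceq)
    also have "\<dots> = (\<kappa> + cnj \<kappa>) / 2 * (CLINT x|M. iexp (t * X x))" by (simp only: distrib_right times_divide_eq_left)
    finally show ?thesis by (simp add: complex_add_cnj)
  qed
  have im: "(CLINT x|M. complex_of_real (Im (w x)) * iexp (t * X x)) = complex_of_real (Im \<kappa>) * (CLINT x|M. iexp (t * X x))" for t
  proof -
    have *: "complex_of_real (Im z) = (z - cnj z) / (2 * \<i>)" for z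
    by (simp add: complex_eq_iff Re_divide Im_divide power2_eq_square)
    have "(CLINT x|M. complex_of_real (Im (w x)) * iexp (t * X x))
      = (CLINT x|M. (w x * iexp (t * X x) - cnj (w x) * iexp (t * X x)) / (2 * \<i>))"
      by (simp only: * times_divide_eq_left left_diff_distrib)
    also have "\<dots> = ((CLINT x|M. w x * iexp (t * X x)) - (CLINT x|M. cnj (w x) * iexp (t * X x))) / (2 * \<i>)"
      using wi cwi by simp
    also have "\<dots> = (\<kappa> * (CLINT x|M. iexp (t * X x)) - cnj \<kappa> * (CLINT x|M. iexp (t * X x))) / (2 * \<i>)"
      by (simp only: eq ceq)
    also have "\<dots> = (\<kappa> - cnj \<kappa>) / (2 * \<i>) * (CLINT x|M. iexp (t * X x))" by (simp only: left_diff_distrib times_divide_eq_left)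
    finally show ?thesis by (simp only: *)
  qed
  have R: "(\<integral>x. Re (w x) * indicator B (X x) \<partial>M) = Re \<kappa> * measure M (X -` B \<inter> space M)"
    by (rule real_weight_char[OF P X _ _ re B]) (measurable, rule order_trans[OF abs_Re_le_cmod w1])
  have I: "(\<integral>x. Im (w x) * indicator B (X x) \<partial>M) = Im \<kappa> * measure M (X -` B \<inter> space M)"
    by (rule real_weight_char[OF P X _ _ im B]) (measurable, rule order_trans[OF abs_Im_le_cmod w1])
  have wb: "integrable M (\<lambda>x. w x * indicator B (X x))"
    by (intro integrable_const_bound[where B=1]) (use w1 in \<open>auto simp: indicator_def\<close>)
  have "Re (w x * indicator B (X x)) = Re (w x) * indicator B (X x)"
    "Im (w x * indicator B (X x)) = Im (w x) * indicator B (X x)" for x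
    by (auto simp: indicator_def)
  then have "Re (CLINT x|M. w x * indicator B (X x)) = Re \<kappa> * measure M (X -` B \<inter> space M)"
    "Im (CLINT x|M. w x * indicator B (X x)) = Im \<kappa> * measure M (X -` B \<inter> space M)"
    using integral_Re[OF wb] integral_Im[OF wb] R I by simp_all
  then show ?thesis by (simp add: complex_eq_iff)
qed

text \<open>Kac's theorem: a factorising joint characteristic function gives independence.
  Uniqueness on the line suffices, since all coordinates but one can be absorbed into a bounded
  weight.\<close>

lemma measure_prod_char:
  fixes X :: "'i \<Rightarrow> 'a \<Rightarrow> real"
  assumes P: "prob_space M" and I: "finite I" and X: "\<And>i. i \<in> I \<Longrightarrow> X i \<in> borel_measurable M"
    and eq: "\<And>t. (CLINT x|M. iexp (\<Sum>i\<in>I. t i * X i x)) = (\<Prod>i\<in>I. CLINT x|M. iexp (t i * X i x))"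
    and B: "\<And>i. i \<in> I \<Longrightarrow> B i \<in> sets borel"
  shows "measure M {x \<in> space M. \<forall>i\<in>I. X i x \<in> B i} = (\<Prod>i\<in>I. measure M (X i -` B i \<inter> space M))"
proof -
  interpret prob_space M by fact
  text \<open>The exponentials are exchanged for indicators one coordinate at a time.\<close>
  have "\<forall>t. (CLINT x|M. (\<Prod>j\<in>J. indicator (B j) (X j x)) * iexp (\<Sum>i\<in>I - J. t i * X i x))
    = (\<Prod>j\<in>J. complex_of_real (measure M (X j -` B j \<inter> space M))) * (\<Prod>i\<in>I-J. CLINT x|M. iexp (t i * X i x))"
    if "J \<subseteq> I" for J
    using finite_subset[OF that I] that
  proof (induction J rule: finite_induct)
    case empty
    then show ?case using eq by simp
  next
    case (insert j J)
    then have j: "j \<in> I" "j \<notin> J" "J \<subseteq> I" and IJ: "I - J = insert j (I - insert j J)" "j \<notin> I - insert j J"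
      and fin: "finite J" "finite (I - insert j J)" using I by auto
    show ?case
    proof
      fix t
      \<comment> \<open>The weight collects the indicators already exchanged and the exponentials
        still waiting; its modulus is at most \<open>1\<close>.\<close>
      define w where "w x = (\<Prod>j\<in>J. indicator (B j) (X j x)) * iexp (\<Sum>i\<in>I - insert j J. t i * X i x)" for x
      define \<kappa> where "\<kappa> = (\<Prod>j\<in>J. complex_of_real (measure M (X j -` B j \<inter> space M))) * (\<Prod>i\<in>I-insert j J. CLINT x|M. iexp (t i * X i x))"
      have wm: "w \<in> borel_measurable M"
      proof -
        have "(\<lambda>x. indicator (B i) (X i x) :: complex) \<in> borel_measurable M" if "i \<in> J" for i
          using X[of i] B[of i] that j by (intro measurable_compose[OF X]) auto
        moreover have "(\<lambda>x. \<Sum>i\<in>I - insert j J. t i * X i x) \<in> borel_measurable M"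
          using X by (intro borel_measurable_sum borel_measurable_times) auto
        ultimately show ?thesis unfolding w_def[abs_def] by measurable
      qed
      have w1: "norm (w x) \<le> 1" for x
        unfolding w_def norm_mult prod_norm[symmetric]
        by (simp, intro prod_le_1) (auto simp: indicator_def)
      have "(CLINT x|M. w x * indicator (B j) (X j x)) = \<kappa> * complex_of_real (measure M (X j -` B j \<inter> space M))"
      proof (rule complex_weight_char[OF P X[OF j(1)] wm w1 _ B[OF j(1)]])
        fix s
        \<comment> \<open>Only the \<open>j\<close>-th frequency varies, so the induction hypothesis
          at \<open>t'\<close> describes the effect of \<open>w\<close> on every exponential of
          \<open>X j\<close>.\<close>
        define t' where "t' = t(j := s)"
        have sj: "(\<Sum>i\<in>I - J. t' i * X i x) = s * X j x + (\<Sum>i\<in>I - insert j J. t i * X i x)" for x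
          unfolding IJ(1) sum.insert[OF fin(2) IJ(2)] by (auto simp: t'_def intro!: sum.cong)
        have pj: "(\<Prod>i\<in>I-J. CLINT x|M. iexp (t' i * X i x)) = (CLINT x|M. iexp (s * X j x)) * (\<Prod>i\<in>I-insert j J. CLINT x|M. iexp (t i * X i x))"
          unfolding IJ(1) prod.insert[OF fin(2) IJ(2)] by (auto simp: t'_def intro!: prod.cong)
        have "(CLINT x|M. w x * iexp (s * X j x)) = (CLINT x|M. (\<Prod>j\<in>J. indicator (B j) (X j x)) * iexp (\<Sum>i\<in>I - J. t' i * X i x))"
          unfolding sj w_def by (intro Bochner_Integration.integral_cong refl) (simp add: distrib_left exp_add mult.commute mult.left_commute)
        also have "\<dots> = (\<Prod>j\<in>J. complex_of_real (measure M (X j -` B j \<inter> space M))) * (\<Prod>i\<in>I-J. CLINT x|M. iexp (t' i * X i x))"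
          by (rule spec[OF insert.IH[OF j(3)]])
        also have "\<dots> = \<kappa> * (CLINT x|M. iexp (s * X j x))"
          unfolding pj \<kappa>_def by (simp only: mult_ac)
        finally show "(CLINT x|M. w x * iexp (s * X j x)) = \<kappa> * (CLINT x|M. iexp (s * X j x))" .
      qed
      then show "(CLINT x|M. (\<Prod>j\<in>insert j J. indicator (B j) (X j x)) * iexp (\<Sum>i\<in>I - insert j J. t i * X i x))
        = (\<Prod>j\<in>insert j J. complex_of_real (measure M (X j -` B j \<inter> space M))) * (\<Prod>i\<in>I-insert j J. CLINT x|M. iexp (t i * X i x))"
        using j(2) fin(1) unfolding w_def \<kappa>_def by (simp add: mult_ac)
    qed
  qed
  from this[OF subset_refl]
  have c: "(CLINT x|M. (\<Prod>j\<in>I. indicator (B j) (X j x))) = complex_of_real (\<Prod>j\<in>I. measure M (X j -` B j \<inter> space M))"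
    by simp
  have p: "(\<Prod>j\<in>I. indicator (B j) (X j x)) = complex_of_real (indicator {x \<in> space M. \<forall>i\<in>I. X i x \<in> B i} x)"
    if "x \<in> space M" for x
    using that I by (auto simp: indicator_def prod.If_cases intro!: prod.neutral)
  have "(CLINT x|M. (\<Prod>j\<in>I. indicator (B j) (X j x))) = (CLINT x|M. complex_of_real (indicator {x \<in> space M. \<forall>i\<in>I. X i x \<in> B i} x))"
    by (intro Bochner_Integration.integral_cong refl) (rule p)
  also have "\<dots> = complex_of_real (measure M {x \<in> space M. \<forall>i\<in>I. X i x \<in> B i})"
  proof -
    have "{x \<in> space M. \<forall>i\<in>I. X i x \<in> B i} \<inter> space M = {x \<in> space M. \<forall>i\<in>I. X i x \<in> B i}" by auto
    then show ?thesis by (simp only: integral_complex_of_real Bochner_Integration.integral_indicator)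
  qed
  finally show ?thesis unfolding c by (simp only: of_real_eq_iff)
qed

section \<open>Simultaneous diagonalisation of two quadratic forms\<close>

lemma bounded_sequences_convergent_subseq:
  fixes c :: "nat \<Rightarrow> nat \<Rightarrow> real"
  assumes "\<And>n k. \<bar>c n k\<bar> \<le> C k"
  shows "\<exists>r l. strict_mono (r :: nat \<Rightarrow> nat) \<and> (\<forall>k. (\<lambda>n. c (r n) k) \<longlonglongrightarrow> l k)"
proof -
  have "\<exists>r :: nat \<Rightarrow> nat. strict_mono r \<and> (\<forall>k. convergent (\<lambda>n. c (r n) k))"
    using assms by (rule diagonal_convergent)
  then show ?thesis unfolding convergent_def by metis
qed

text \<open>Meant for the covariance forms of the two Gaussian measures: \<open>A\<close> plays the
  inner product, while \<open>B\<close> is merely a symmetric bilinear form.\<close>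

locale two_forms =
  fixes A B :: "'v::real_vector \<Rightarrow> 'v \<Rightarrow> real"
  assumes A_add: "A (x + y) z = A x z + A y z" and A_scale: "A (c *\<^sub>R x) z = c * A x z"
    and A_sym: "A x y = A y x" and A_pos: "x \<noteq> 0 \<Longrightarrow> 0 < A x x"
    and B_add: "B (x + y) z = B x z + B y z" and B_scale: "B (c *\<^sub>R x) z = c * B x z"
    and B_sym: "B x y = B y x"
begin

lemma A_scale_right: "A z (c *\<^sub>R x) = c * A z x"
  by (simp add: A_sym[of z] A_scale)

lemma A_add_right: "A z (x + y) = A z x + A z y"
  by (simp add: A_sym[of z] A_add)

lemma B_scale_right: "B z (c *\<^sub>R x) = c * B z x"
  by (simp add: B_sym[of z] B_scale)

lemma B_add_right: "B z (x + y) = B z x + B z y"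
  by (simp add: B_sym[of z] B_add)

lemma form_sum: "A (\<Sum>i\<in>I. t i *\<^sub>R e i) z = (\<Sum>i\<in>I. t i * A (e i) z)"
  "B (\<Sum>i\<in>I. t i *\<^sub>R e i) z = (\<Sum>i\<in>I. t i * B (e i) z)"
proof -
  have 0: "A 0 z = 0" "B 0 z = 0" using A_scale[of 0 0 z] B_scale[of 0 0 z] by auto
  show "A (\<Sum>i\<in>I. t i *\<^sub>R e i) z = (\<Sum>i\<in>I. t i * A (e i) z)"
    by (induction I rule: infinite_finite_induct) (auto simp: 0 A_add A_scale)
  show "B (\<Sum>i\<in>I. t i *\<^sub>R e i) z = (\<Sum>i\<in>I. t i * B (e i) z)"
    by (induction I rule: infinite_finite_induct) (auto simp: 0 B_add B_scale)
qed

definition orthonormal_on :: "'v set \<Rightarrow> nat \<Rightarrow> (nat \<Rightarrow> 'v) \<Rightarrow> bool" where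
  "orthonormal_on V k e \<longleftrightarrow> (\<forall>i<k. e i \<in> V) \<and> (\<forall>i<k. \<forall>j<k. A (e i) (e j) = (if i = j then 1 else 0))"

text \<open>Orthonormal vectors are independent; the resulting bound on the length is what makes a
  longest system exist.\<close>

lemma orthonormal_on_card:
  assumes S: "finite S" and e: "orthonormal_on (span S) k e"
  shows "k \<le> card S"
proof -
  have o: "A (e i) (e j) = (if i = j then 1 else 0)" if "i < k" "j < k" for i j
    using e that by (auto simp: orthonormal_on_def)
  have inj: "inj_on e {..<k}"
  proof (rule inj_onI)
    fix i j assume "i \<in> {..<k}" "j \<in> {..<k}" "e i = e j"
    then show "i = j" using o[of i j] o[of j j] by (auto split: if_splits)
  qed
  have "independent (e ` {..<k})"
  proof (rule independent_if_scalars_zero)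
    fix f x assume s: "(\<Sum>x\<in>e ` {..<k}. f x *\<^sub>R x) = 0" and x: "x \<in> e ` {..<k}"
    then obtain j where j: "j < k" "x = e j" by auto
    have "(\<Sum>i<k. f (e i) *\<^sub>R e i) = 0" using s sum.reindex[OF inj, of "\<lambda>x. f x *\<^sub>R x"] by simp
    then have "0 = A (\<Sum>i<k. f (e i) *\<^sub>R e i) (e j)" using A_scale[of 0 0 "e j"] by simp
    also have "\<dots> = (\<Sum>i<k. f (e i) * A (e i) (e j))" by (rule form_sum)
    also have "\<dots> = (\<Sum>i<k. if i = j then f (e j) else 0)" using j by (intro sum.cong) (auto simp: o)
    also have "\<dots> = f x" using j by simp
    finally show "f x = 0" by simp
  qed simp
  moreover have "e ` {..<k} \<subseteq> span S" using e by (auto simp: orthonormal_on_def)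
  ultimately have "card (e ` {..<k}) \<le> card S" using S independent_span_bound by blast
  then show ?thesis using card_image[OF inj] by simp
qed

lemma orthonormal_residual:
  assumes e: "orthonormal_on (span S) k e" and v: "v \<in> span S"
  defines "w \<equiv> v - (\<Sum>i<k. A (e i) v *\<^sub>R e i)"
  shows "w \<in> span S" "\<And>j. j < k \<Longrightarrow> A (e j) w = 0"
proof -
  have "(\<Sum>i<k. A (e i) v *\<^sub>R e i) \<in> span S"
    using e by (intro span_sum span_scale) (auto simp: orthonormal_on_def)
  then show "w \<in> span S" unfolding w_def using v by (intro span_diff)
  fix j assume j: "j < k"
  have m: "A (x - y) z = A x z - A y z" for x y z
    using A_add[of x "- y" z] A_scale[of "-1" y z] by simp
  have "A w (e j) = A v (e j) - (\<Sum>i<k. A (e i) v * A (e i) (e j))"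
    unfolding w_def by (simp add: m form_sum)
  also have "(\<Sum>i<k. A (e i) v * A (e i) (e j)) = (\<Sum>i<k. if i = j then A (e j) v else 0)"
    using e j by (intro sum.cong) (auto simp: orthonormal_on_def)
  finally show "A (e j) w = 0" using j by (simp add: A_sym)
qed

text \<open>The predicate \<open>P\<close> is an invariant that the extension step has to preserve.\<close>

lemma maximal_orthonormal:
  assumes S: "finite S" and P: "P 0 e0"
    and step: "\<And>k e v. P k e \<Longrightarrow> orthonormal_on (span S) k e \<Longrightarrow> v \<in> span S \<Longrightarrow> v \<noteq> 0 \<Longrightarrow>
      (\<And>i. i < k \<Longrightarrow> A (e i) v = 0) \<Longrightarrow> \<exists>e'. P (Suc k) e' \<and> orthonormal_on (span S) (Suc k) e'"
  shows "\<exists>k e. P k e \<and> orthonormal_on (span S) k e \<and> (\<forall>v\<in>span S. v = (\<Sum>i<k. A (e i) v *\<^sub>R e i))"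
proof -
  let ?Q = "\<lambda>k. \<exists>e. P k e \<and> orthonormal_on (span S) k e"
  have "?Q 0" using P by (auto simp: orthonormal_on_def)
  moreover have "\<forall>k. ?Q k \<longrightarrow> k \<le> card S" using orthonormal_on_card[OF S] by blast
  ultimately obtain k where k: "?Q k" "\<And>j. ?Q j \<Longrightarrow> j \<le> k"
    using ex_has_greatest_nat[of ?Q 0 "\<lambda>k. k" "card S + 1"] by (metis le_imp_less_Suc Suc_eq_plus1)
  then obtain e where e: "P k e" "orthonormal_on (span S) k e" by blast
  have "v = (\<Sum>i<k. A (e i) v *\<^sub>R e i)" if v: "v \<in> span S" for v
  proof (rule ccontr)
    assume "v \<noteq> (\<Sum>i<k. A (e i) v *\<^sub>R e i)"
    then have "v - (\<Sum>i<k. A (e i) v *\<^sub>R e i) \<noteq> 0" by simp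
    from step[OF e orthonormal_residual(1)[OF e(2) v] this orthonormal_residual(2)[OF e(2) v]]
    have "?Q (Suc k)" .
    then show False using k(2) by fastforce
  qed
  then show ?thesis using e by blast
qed

lemma orthonormal_extend:
  assumes e: "orthonormal_on (span S) k e" and v: "v \<in> span S" "A v v = 1"
    and "\<And>i. i < k \<Longrightarrow> A (e i) v = 0"
  shows "orthonormal_on (span S) (Suc k) (e(k := v))"
proof -
  have "A v (e i) = 0" if "i < k" for i using assms(4)[OF that] by (simp add: A_sym[of v])
  then show ?thesis using assms unfolding orthonormal_on_def by (auto simp: less_Suc_eq)
qed

lemma normalize_form:
  assumes "v \<noteq> 0"
  shows "A ((1 / sqrt (A v v)) *\<^sub>R v) ((1 / sqrt (A v v)) *\<^sub>R v) = 1"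
proof -
  have s: "sqrt (A v v) * sqrt (A v v) = A v v" "A v v \<noteq> 0" using A_pos[OF assms] by auto
  have "A ((1 / sqrt (A v v)) *\<^sub>R v) ((1 / sqrt (A v v)) *\<^sub>R v) = (1 / sqrt (A v v)) * ((1 / sqrt (A v v)) * A v v)"
    by (simp only: A_scale A_scale_right)
  also have "\<dots> = A v v / (sqrt (A v v) * sqrt (A v v))" by simp
  finally show ?thesis using s by simp
qed

lemma orthonormal_basis_exists:
  assumes S: "finite S"
  shows "\<exists>k e. orthonormal_on (span S) k e \<and> (\<forall>v\<in>span S. v = (\<Sum>i<k. A (e i) v *\<^sub>R e i))"
proof -
  have "\<exists>k e. True \<and> orthonormal_on (span S) k e \<and> (\<forall>v\<in>span S. v = (\<Sum>i<k. A (e i) v *\<^sub>R e i))"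
  proof (rule maximal_orthonormal[OF S, where P="\<lambda>_ _. True"])
    fix k e v
    assume e: "orthonormal_on (span S) k e" and v: "v \<in> span S" "v \<noteq> 0" "\<And>i. i < k \<Longrightarrow> A (e i) v = 0"
    have "orthonormal_on (span S) (Suc k) (e(k := (1 / sqrt (A v v)) *\<^sub>R v))"
      using v by (intro orthonormal_extend e normalize_form span_scale) (simp_all add: A_scale_right)
    then show "\<exists>e'. True \<and> orthonormal_on (span S) (Suc k) e'" by blast
  qed simp
  then show ?thesis by simp
qed

text \<open>In coordinates with respect to an orthonormal basis the constrained unit sphere is
  compact and the quadratic form of \<open>B\<close> is a polynomial, so a maximising sequence has a
  subsequence converging to a maximiser.\<close>

lemma constrained_maximum:
  assumes S: "finite S" and v: "v \<in> span S" "v \<noteq> 0" "\<And>i. i < k \<Longrightarrow> A (e i) v = 0"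
  shows "\<exists>w\<in>span S. A w w = 1 \<and> (\<forall>i<k. A (e i) w = 0) \<and>
    (\<forall>x\<in>span S. A x x = 1 \<longrightarrow> (\<forall>i<k. A (e i) x = 0) \<longrightarrow> B x x \<le> B w w)"
proof -
  obtain n u where u: "orthonormal_on (span S) n u"
    and exp: "\<And>v. v \<in> span S \<Longrightarrow> v = (\<Sum>i<n. A (u i) v *\<^sub>R u i)"
    using orthonormal_basis_exists[OF S] by blast
  have uo: "A (u i) (u j) = (if i = j then 1 else 0)" if "i < n" "j < n" for i j
    using u that by (auto simp: orthonormal_on_def)
  define vec where "vec c = (\<Sum>i<n. c i *\<^sub>R u i)" for c :: "nat \<Rightarrow> real"
  have vec: "vec c \<in> span S" for c
    unfolding vec_def using u by (intro span_sum span_scale) (auto simp: orthonormal_on_def)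
  have Avec: "A (vec c) (vec c) = (\<Sum>i<n. (c i)\<^sup>2)" for c
  proof -
    have "A (u i) (vec c) = c i" if "i < n" for i
    proof -
      have "A (vec c) (u i) = (\<Sum>j<n. c j * A (u j) (u i))" unfolding vec_def by (rule form_sum)
      also have "\<dots> = (\<Sum>j<n. if j = i then c i else 0)" using that by (intro sum.cong) (auto simp: uo)
      finally show ?thesis using that by (simp add: A_sym)
    qed
    then show ?thesis unfolding vec_def[of c] form_sum(1)
      by (intro sum.cong) (auto simp: vec_def power2_eq_square)
  qed
  have Bvec: "B (vec c) (vec c) = (\<Sum>i<n. c i * (\<Sum>j<n. c j * B (u i) (u j)))" for c
  proof -
    have "B (u i) (vec c) = (\<Sum>j<n. c j * B (u i) (u j))" for i
      unfolding B_sym[of "u i" "vec c"] unfolding vec_def form_sum by (intro sum.cong) (auto simp: B_sym)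
    then show ?thesis unfolding vec_def[of c] form_sum(2) by (simp add: vec_def)
  qed
  have Aevec: "A (e i) (vec c) = (\<Sum>j<n. c j * A (u j) (e i))" for c i
    unfolding A_sym[of "e i"] vec_def by (rule form_sum)
  define W where "W = {x \<in> span S. A x x = 1 \<and> (\<forall>i<k. A (e i) x = 0)}"
  have cb: "\<bar>A (u i) x\<bar> \<le> 1" if "x \<in> W" "i < n" for x i
  proof -
    have "x = vec (\<lambda>i. A (u i) x)" using exp that unfolding vec_def W_def by blast
    then have "(\<Sum>i<n. (A (u i) x)\<^sup>2) = 1" using Avec[of "\<lambda>i. A (u i) x"] that by (simp add: W_def)
    moreover have "(A (u i) x)\<^sup>2 \<le> (\<Sum>i<n. (A (u i) x)\<^sup>2)" using that by (intro member_le_sum) auto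
    ultimately show ?thesis using abs_square_le_1 by auto
  qed
  have xvec: "x = vec (\<lambda>i. A (u i) x)" if "x \<in> W" for x
    using exp that unfolding vec_def W_def by blast
  define b where "b = (\<Sum>i<n. \<Sum>j<n. \<bar>B (u i) (u j)\<bar>)"
  have Bb: "B x x \<le> b" if "x \<in> W" for x
  proof -
    have "B x x = (\<Sum>i<n. A (u i) x * (\<Sum>j<n. A (u j) x * B (u i) (u j)))"
      using Bvec[of "\<lambda>i. A (u i) x"] xvec[OF that] by simp
    also have "\<dots> = (\<Sum>i<n. \<Sum>j<n. A (u i) x * A (u j) x * B (u i) (u j))"
      by (simp add: sum_distrib_left mult.assoc)
    also have "\<dots> \<le> b" unfolding b_def
    proof (intro sum_mono)
      fix i j assume ij: "i \<in> {..<n}" "j \<in> {..<n}"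
      have "A (u i) x * A (u j) x * B (u i) (u j) \<le> \<bar>A (u i) x\<bar> * \<bar>A (u j) x\<bar> * \<bar>B (u i) (u j)\<bar>"
        by (metis abs_ge_self abs_mult)
      also have "\<dots> \<le> 1 * 1 * \<bar>B (u i) (u j)\<bar>"
        using cb[OF that] ij by (intro mult_mono) auto
      finally show "A (u i) x * A (u j) x * B (u i) (u j) \<le> \<bar>B (u i) (u j)\<bar>" by simp
    qed
    finally show ?thesis .
  qed
  \<comment> \<open>The vector \<open>v\<close>, once normalised, witnesses that the constraints can
    be satisfied.\<close>
  have ne: "W \<noteq> {}"
  proof -
    define y where "y = (1 / sqrt (A v v)) *\<^sub>R v"
    have "y \<in> span S" unfolding y_def by (rule span_scale[OF v(1)])
    moreover have "A y y = 1" unfolding y_def by (rule normalize_form[OF v(2)])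
    moreover have "A (e i) y = 0" if "i < k" for i
      unfolding y_def A_scale_right v(3)[OF that] by simp
    ultimately have "y \<in> W" unfolding W_def by blast
    then show ?thesis by blast
  qed
  define s where "s = Sup ((\<lambda>x. B x x) ` W)"
  have bdd: "bdd_above ((\<lambda>x. B x x) ` W)" using Bb by (intro bdd_aboveI[of _ b]) auto
  have "\<exists>x\<in>W. s - 1 / real (Suc m) < B x x" for m
  proof -
    have "s - 1 / real (Suc m) < s" by simp
    then show ?thesis unfolding s_def using less_cSup_iff[OF _ bdd] ne by auto
  qed
  then obtain x where x: "\<And>m. x m \<in> W" "\<And>m. s - 1 / real (Suc m) < B (x m) (x m)" by metis
  \<comment> \<open>Padding with \<open>0\<close> beyond the dimension fits the coordinates to the
    diagonal argument, which runs over all indices.\<close>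
  define c where "c m i = (if i < n then A (u i) (x m) else 0)" for m i
  have "\<bar>c m i\<bar> \<le> 1" for m i using cb[OF x(1)] by (simp add: c_def)
  from bounded_sequences_convergent_subseq[OF this]
  obtain r where "\<exists>l. strict_mono (r :: nat \<Rightarrow> nat) \<and> (\<forall>i. (\<lambda>m. c (r m) i) \<longlonglongrightarrow> l i)" ..
  then obtain l where rl: "strict_mono r \<and> (\<forall>i. (\<lambda>m. c (r m) i) \<longlonglongrightarrow> l i)" ..
  have r: "strict_mono r" using rl by (rule conjunct1)
  have l: "(\<lambda>m. c (r m) i) \<longlonglongrightarrow> l i" for i using conjunct2[OF rl] by (rule spec)
  have xc: "x m = vec (c m)" for m
    using xvec[OF x(1)[of m]] unfolding vec_def c_def by simp
  have lW: "vec l \<in> W" unfolding W_def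
  proof (intro CollectI conjI allI impI vec)
    have "(\<lambda>m. \<Sum>i<n. (c (r m) i)\<^sup>2) \<longlonglongrightarrow> (\<Sum>i<n. (l i)\<^sup>2)" by (intro tendsto_intros l)
    moreover have "(\<Sum>i<n. (c (r m) i)\<^sup>2) = 1" for m
      using x(1)[of "r m"] Avec[of "c (r m)"] xc[of "r m"] by (simp add: W_def)
    ultimately show "A (vec l) (vec l) = 1" unfolding Avec by (simp add: LIMSEQ_const_iff)
    fix i assume i: "i < k"
    have "(\<lambda>m. \<Sum>j<n. c (r m) j * A (u j) (e i)) \<longlonglongrightarrow> (\<Sum>j<n. l j * A (u j) (e i))"
      by (intro tendsto_intros l)
    moreover have "(\<Sum>j<n. c (r m) j * A (u j) (e i)) = 0" for m
      using x(1)[of "r m"] Aevec[of i "c (r m)"] xc[of "r m"] i by (simp add: W_def)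
    ultimately show "A (e i) (vec l) = 0" unfolding Aevec by (simp add: LIMSEQ_const_iff)
  qed
  have "(\<lambda>m. B (x (r m)) (x (r m))) \<longlonglongrightarrow> B (vec l) (vec l)"
    unfolding xc Bvec by (intro tendsto_intros l)
  moreover have "(\<lambda>m. s - 1 / real (Suc (r m))) \<longlonglongrightarrow> s - 0"
    by (intro tendsto_intros LIMSEQ_subseq_LIMSEQ[OF LIMSEQ_Suc[OF lim_1_over_n] r, unfolded comp_def])
  ultimately have "s - 0 \<le> B (vec l) (vec l)"
    by (intro LIMSEQ_le) (use x(2) less_imp_le in blast)+
  then have "B y y \<le> B (vec l) (vec l)" if "y \<in> W" for y
    using cSup_upper[OF imageI[OF that] bdd] unfolding s_def by linarith
  then show ?thesis using lW unfolding W_def by blast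
qed

text \<open>Rayleigh quotients: each new vector maximises \<open>B x x\<close> among
  \<open>A\<close>-unit vectors that are \<open>A\<close>-orthogonal to the earlier ones.
  Stationarity at the maximiser turns \<open>A\<close>-orthogonality to it into
  \<open>B\<close>-orthogonality.\<close>

lemma simultaneous_diagonalisation:
  assumes S: "finite S"
  shows "\<exists>k e. orthonormal_on (span S) k e \<and> (\<forall>i<k. \<forall>j<k. i \<noteq> j \<longrightarrow> B (e i) (e j) = 0) \<and>
    (\<forall>v\<in>span S. v = (\<Sum>i<k. A (e i) v *\<^sub>R e i))"
proof -
  \<comment> \<open>The second conjunct is the working part of the invariant: it makes the next
    maximiser, taken in the \<open>A\<close>-complement, automatically \<open>B\<close>-orthogonal
    to the earlier vectors.\<close>
  define P where "P k e \<longleftrightarrow> (\<forall>i<k. \<forall>j<k. i \<noteq> j \<longrightarrow> B (e i) (e j) = 0) \<and>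
    (\<forall>v\<in>span S. (\<forall>i<k. A (e i) v = 0) \<longrightarrow> (\<forall>i<k. B (e i) v = 0))" for k :: nat and e :: "nat \<Rightarrow> 'v"
  have "\<exists>k e. P k e \<and> orthonormal_on (span S) k e \<and> (\<forall>v\<in>span S. v = (\<Sum>i<k. A (e i) v *\<^sub>R e i))"
  proof (rule maximal_orthonormal[OF S])
    show "P 0 (\<lambda>_. 0)" by (simp add: P_def)
    fix k e v
    assume P: "P k e" and e: "orthonormal_on (span S) k e"
      and v: "v \<in> span S" "v \<noteq> 0" "\<And>i. i < k \<Longrightarrow> A (e i) v = 0"
    from constrained_maximum[OF S v] obtain w where w1: "w \<in> span S"
      and w2: "A w w = 1 \<and> (\<forall>i<k. A (e i) w = 0) \<and>
        (\<forall>x\<in>span S. A x x = 1 \<longrightarrow> (\<forall>i<k. A (e i) x = 0) \<longrightarrow> B x x \<le> B w w)" ..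
    have w: "w \<in> span S" "A w w = 1" "\<And>i. i < k \<Longrightarrow> A (e i) w = 0" using w1 w2 by simp_all
    have max: "B x x \<le> B w w" if "x \<in> span S" "A x x = 1" "\<And>i. i < k \<Longrightarrow> A (e i) x = 0" for x
      using w2 that by simp
    have ext: "orthonormal_on (span S) (Suc k) (e(k := w))"
      by (rule orthonormal_extend[OF e w])
    \<comment> \<open>The homogeneous form of maximality, so that perturbations of \<open>w\<close>
      need not be normalised again.\<close>
    have maxx: "B x x \<le> B w w * A x x" if x: "x \<in> span S" "\<And>i. i < k \<Longrightarrow> A (e i) x = 0" for x
    proof (cases "x = 0")
      case True
      then show ?thesis using A_scale[of 0 0 0] B_scale[of 0 0 0] by simp
    next
      case False
      define a where "a = A x x"
      have a: "a > 0" unfolding a_def by (rule A_pos[OF False])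
      let ?y = "(1 / sqrt a) *\<^sub>R x"
      have "B ?y ?y \<le> B w w"
        using normalize_form[OF False] x
        by (intro max span_scale) (simp_all add: a_def A_scale_right)
      moreover have "B ?y ?y = B x x / a"
      proof -
        have "B ?y ?y = (1 / sqrt a) * ((1 / sqrt a) * B x x)" by (simp only: B_scale B_scale_right)
        also have "\<dots> = B x x / (sqrt a * sqrt a)" by simp
        finally show ?thesis using a by simp
      qed
      ultimately show ?thesis using a by (simp add: divide_le_eq a_def)
    qed
    text \<open>First variation of the quotient \<open>B x x / A x x\<close> at its maximiser \<open>w\<close>.\<close>
    have Bw: "B w x = 0" if x: "x \<in> span S" "\<And>i. i < k \<Longrightarrow> A (e i) x = 0" and Awx: "A w x = 0" for x
    proof (rule ccontr)
      assume ne: "B w x \<noteq> 0"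
      define d where "d = B w w * A x x - B x x"
      have ineq: "2 * t * B w x \<le> t\<^sup>2 * d" for t
      proof -
        have "B (w + t *\<^sub>R x) (w + t *\<^sub>R x) \<le> B w w * A (w + t *\<^sub>R x) (w + t *\<^sub>R x)"
        proof (rule maxx)
          show "w + t *\<^sub>R x \<in> span S" using w x by (intro span_add span_scale)
          show "A (e i) (w + t *\<^sub>R x) = 0" if "i < k" for i
            using w(3)[OF that] x(2)[OF that] by (simp add: A_add_right A_scale_right)
        qed
        moreover have "A (w + t *\<^sub>R x) (w + t *\<^sub>R x) = 1 + t\<^sup>2 * A x x"
          using w(2) Awx by (simp add: A_add A_scale A_add_right A_scale_right A_sym[of x w] power2_eq_square)
        moreover have "B (w + t *\<^sub>R x) (w + t *\<^sub>R x) = B w w + 2 * t * B w x + t\<^sup>2 * B x x"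
          by (simp add: B_add B_scale B_add_right B_scale_right B_sym[of x w] power2_eq_square distrib_left)
        ultimately show ?thesis unfolding d_def by (simp add: algebra_simps)
      qed
      define \<beta> where "\<beta> = B w x"
      \<comment> \<open>At \<open>t = \<beta> / q\<close> the linear gain is twice a quantity that
        bounds the quadratic loss; the summand \<open>1\<close> keeps \<open>q\<close>
        positive.\<close>
      define q where "q = \<bar>d\<bar> + 1"
      have q: "q > 0" "d \<le> q" unfolding q_def by auto
      have "2 * (\<beta> / q) * \<beta> \<le> (\<beta> / q)\<^sup>2 * d" using ineq[of "\<beta> / q"] by (simp add: \<beta>_def)
      also have "\<dots> \<le> (\<beta> / q)\<^sup>2 * q" using q by (intro mult_left_mono) auto
      also have "\<dots> = (\<beta> / q) * \<beta>" using q by (simp add: power2_eq_square)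
      finally have "(\<beta> / q) * \<beta> \<le> 0" by simp
      moreover have "(\<beta> / q) * \<beta> = \<beta>\<^sup>2 / q" by (simp add: power2_eq_square)
      moreover have "\<beta>\<^sup>2 / q > 0" using ne q by (simp add: \<beta>_def)
      ultimately show False by linarith
    qed
    have Bew: "B (e i) w = 0" if "i < k" for i
      using P w that unfolding P_def by blast
    have "P (Suc k) (e(k := w))"
      unfolding P_def
    proof (intro conjI allI impI ballI)
      fix i j assume "i < Suc k" "j < Suc k" "i \<noteq> j"
      then show "B ((e(k := w)) i) ((e(k := w)) j) = 0"
        using P Bew B_sym[of w] unfolding P_def by (auto simp: less_Suc_eq)
    next
      fix x i assume x: "x \<in> span S" "\<forall>i<Suc k. A ((e(k := w)) i) x = 0" and i: "i < Suc k"
      have "A w x = 0" using x(2)[rule_format, of k] by simp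
      moreover have ex: "A (e i) x = 0" if "i < k" for i using x(2)[rule_format, of i] that by simp
      ultimately have "B w x = 0" using Bw x(1) by blast
      moreover have "B (e i) x = 0" if "i < k" for i using P x(1) ex that unfolding P_def by blast
      ultimately show "B ((e(k := w)) i) x = 0" using i by (auto simp: less_Suc_eq)
    qed
    then show "\<exists>e'. P (Suc k) e' \<and> orthonormal_on (span S) (Suc k) e'" using ext by blast
  qed
  then show ?thesis unfolding P_def by blast
qed

end

section \<open>Affinity and divergence of normal laws and their products\<close>

text \<open>
  Hellinger affinity of \<open>N(a, 1)\<close> and \<open>N(b, s\<^sup>2)\<close>, and divergence of the former from the latter.
\<close>

definition normal_affinity :: "real \<Rightarrow> real \<Rightarrow> real \<Rightarrow> real" where
  "normal_affinity a b s = sqrt (2 * s / (1 + s\<^sup>2)) * exp (- ((a - b)\<^sup>2) / (4 * (1 + s\<^sup>2)))"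

definition normal_divergence :: "real \<Rightarrow> real \<Rightarrow> real \<Rightarrow> real" where
  "normal_divergence a b s = ln s + (1 + (a - b)\<^sup>2) / (2 * s\<^sup>2) - 1 / 2"

definition normal_ratio :: "real \<Rightarrow> real \<Rightarrow> real \<Rightarrow> real \<Rightarrow> real" where
  "normal_ratio a b s x = normal_density b s x / normal_density a 1 x"

lemma normal_affinity_pos: "s > 0 \<Longrightarrow> 0 < normal_affinity a b s"
  unfolding normal_affinity_def by (intro mult_pos_pos) (auto intro!: divide_pos_pos add_pos_nonneg)

lemma normal_ratio_pos: "s > 0 \<Longrightarrow> 0 < normal_ratio a b s x"
  unfolding normal_ratio_def by (intro divide_pos_pos normal_density_pos) auto

lemma borel_measurable_normal_ratio [measurable]: "normal_ratio a b s \<in> borel_measurable borel"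
  unfolding normal_ratio_def[abs_def] by measurable

lemma normal_ratio_density:
  assumes "s > 0"
  shows "density (density lborel (\<lambda>x. ennreal (normal_density a 1 x))) (\<lambda>x. ennreal (normal_ratio a b s x))
    = density lborel (\<lambda>x. ennreal (normal_density b s x))"
proof -
  have "ennreal (normal_density a 1 x) * ennreal (normal_ratio a b s x) = ennreal (normal_density b s x)" for x
    using normal_density_pos[of 1 a x] by (simp add: normal_ratio_def ennreal_mult[symmetric])
  then show ?thesis by (simp add: density_density_eq)
qed

text \<open>Completing the square: the geometric mean of two normal densities is a multiple of a
  third one, and the multiple is the affinity.\<close>

lemma sqrt_normal_densities:
  assumes s: "s > 0"
  shows "sqrt (normal_density a 1 x * normal_density b s x)
    = normal_affinity a b s * normal_density ((s\<^sup>2 * a + b) / (1 + s\<^sup>2)) (sqrt (2 * s\<^sup>2 / (1 + s\<^sup>2))) x"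
proof -
  define c where "c = (s\<^sup>2 * a + b) / (1 + s\<^sup>2)"
  define q where "q = 1 + s\<^sup>2"
  have q: "q > 0" unfolding q_def by (simp add: add_pos_nonneg)
  have s2: "s\<^sup>2 > 0" "s\<^sup>2 = q - 1" using s by (auto simp: q_def)
  have cq: "c * q = s\<^sup>2 * a + b" unfolding c_def q_def[symmetric] using q by simp
  \<comment> \<open>The centre \<open>c\<close> is the mean of \<open>a\<close> and \<open>b\<close>
    weighted by the precisions \<open>1\<close> and \<open>1 / s\<^sup>2\<close>; the factor
    \<open>4\<close> comes from halving both exponents.\<close>
  have expo: "(x - a)\<^sup>2 / 4 + (x - b)\<^sup>2 / (4 * s\<^sup>2) = (a - b)\<^sup>2 / (4 * q) + (x - c)\<^sup>2 * q / (4 * s\<^sup>2)"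
  proof -
    have "q * (s\<^sup>2 * (x - a)\<^sup>2 + (x - b)\<^sup>2) = s\<^sup>2 * (a - b)\<^sup>2 + (q * x - (s\<^sup>2 * a + b))\<^sup>2"
      unfolding q_def by (simp add: power2_eq_square algebra_simps)
    also have "(q * x - (s\<^sup>2 * a + b))\<^sup>2 = q * (q * (x - c)\<^sup>2)"
      unfolding cq[symmetric] by (simp add: power2_eq_square algebra_simps)
    finally have "(s\<^sup>2 * (x - a)\<^sup>2 + (x - b)\<^sup>2) = (s\<^sup>2 * (a - b)\<^sup>2 + q * (q * (x - c)\<^sup>2)) / q"
      using q by (simp add: field_simps)
    then have "(s\<^sup>2 * (x - a)\<^sup>2 + (x - b)\<^sup>2) / (4 * s\<^sup>2) = (s\<^sup>2 * (a - b)\<^sup>2 + q * (q * (x - c)\<^sup>2)) / q / (4 * s\<^sup>2)"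
      by simp
    moreover have "(s\<^sup>2 * (x - a)\<^sup>2 + (x - b)\<^sup>2) / (4 * s\<^sup>2) = (x - a)\<^sup>2 / 4 + (x - b)\<^sup>2 / (4 * s\<^sup>2)"
      using s2(1) by (simp add: add_divide_distrib)
    moreover have "(s\<^sup>2 * (a - b)\<^sup>2 + q * (q * (x - c)\<^sup>2)) / q / (4 * s\<^sup>2) = (a - b)\<^sup>2 / (4 * q) + (x - c)\<^sup>2 * q / (4 * s\<^sup>2)"
      using s2(1) q by (simp add: add_divide_distrib mult.commute)
    ultimately show ?thesis by simp
  qed
  have L: "normal_density a 1 x * normal_density b s x
     = 1 / (2 * pi * s) * exp (- 2 * ((x - a)\<^sup>2 / 4 + (x - b)\<^sup>2 / (4 * s\<^sup>2)))"
  proof -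
    have "sqrt (2 * pi * s\<^sup>2) = sqrt (2 * pi) * s" using s by (simp add: real_sqrt_mult)
    then have "normal_density a 1 x * normal_density b s x
      = 1 / (sqrt (2 * pi) * (sqrt (2 * pi) * s)) * (exp (- (x - a)\<^sup>2 / 2) * exp (- (x - b)\<^sup>2 / (2 * s\<^sup>2)))"
      unfolding normal_density_def by simp
    also have "sqrt (2 * pi) * (sqrt (2 * pi) * s) = 2 * pi * s" by (simp add: mult.assoc[symmetric])
    also have "exp (- (x - a)\<^sup>2 / 2) * exp (- (x - b)\<^sup>2 / (2 * s\<^sup>2)) = exp (- 2 * ((x - a)\<^sup>2 / 4 + (x - b)\<^sup>2 / (4 * s\<^sup>2)))"
      by (simp add: exp_add[symmetric] field_simps)
    finally show ?thesis .
  qed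
  have R: "normal_affinity a b s * normal_density c (sqrt (2 * s\<^sup>2 / q)) x
     = sqrt (2 * s / q) / sqrt (2 * pi * (2 * s\<^sup>2 / q)) * exp (- ((x - a)\<^sup>2 / 4 + (x - b)\<^sup>2 / (4 * s\<^sup>2)))"
  proof -
    have "(sqrt (2 * s\<^sup>2 / q))\<^sup>2 = 2 * s\<^sup>2 / q" using q by simp
    then have "normal_affinity a b s * normal_density c (sqrt (2 * s\<^sup>2 / q)) x
      = sqrt (2 * s / q) / sqrt (2 * pi * (2 * s\<^sup>2 / q)) * (exp (- ((a - b)\<^sup>2) / (4 * q)) * exp (- (x - c)\<^sup>2 / (2 * (2 * s\<^sup>2 / q))))"
      unfolding normal_affinity_def normal_density_def q_def[symmetric] by simp
    also have "exp (- ((a - b)\<^sup>2) / (4 * q)) * exp (- (x - c)\<^sup>2 / (2 * (2 * s\<^sup>2 / q))) = exp (- ((a - b)\<^sup>2 / (4 * q) + (x - c)\<^sup>2 * q / (4 * s\<^sup>2)))"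
      by (simp add: exp_add[symmetric])
    finally show ?thesis unfolding expo .
  qed
  have "sqrt (2 * s / q) / sqrt (2 * pi * (2 * s\<^sup>2 / q)) = sqrt (1 / (2 * pi * s))"
    using q s by (simp add: real_sqrt_divide[symmetric] power2_eq_square)
  then have "normal_affinity a b s * normal_density c (sqrt (2 * s\<^sup>2 / q)) x
     = sqrt (1 / (2 * pi * s)) * exp (- ((x - a)\<^sup>2 / 4 + (x - b)\<^sup>2 / (4 * s\<^sup>2)))" unfolding R by simp
  also have "\<dots> = sqrt (normal_density a 1 x * normal_density b s x)"
  proof -
    have e: "exp (- 2 * y) = (exp (- y))\<^sup>2" for y :: real by (simp add: exp_double[symmetric])
    show ?thesis by (simp only: L e real_sqrt_mult real_sqrt_abs abs_exp_cancel)
  qed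
  finally show ?thesis unfolding c_def q_def by simp
qed

lemma normal_affinity_integral:
  assumes s: "s > 0"
  shows "(\<integral>\<^sup>+x. ennreal (sqrt (normal_ratio a b s x)) \<partial>density lborel (\<lambda>x. ennreal (normal_density a 1 x)))
    = ennreal (normal_affinity a b s)"
proof -
  let ?c = "(s\<^sup>2 * a + b) / (1 + s\<^sup>2)" and ?\<tau> = "sqrt (2 * s\<^sup>2 / (1 + s\<^sup>2))"
  have t: "?\<tau> > 0" using s by (simp add: add_pos_nonneg)
  have "ennreal (normal_density a 1 x) * ennreal (sqrt (normal_ratio a b s x))
      = ennreal (normal_affinity a b s) * ennreal (normal_density ?c ?\<tau> x)" for x
  proof -
    have p: "normal_density a 1 x > 0" by (rule normal_density_pos) simp
    have "normal_density a 1 x * sqrt (normal_ratio a b s x) = sqrt ((normal_density a 1 x)\<^sup>2 * normal_ratio a b s x)"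
      using p by (simp add: real_sqrt_mult)
    also have "\<dots> = sqrt (normal_density a 1 x * normal_density b s x)"
      using p by (simp add: normal_ratio_def power2_eq_square)
    also have "\<dots> = normal_affinity a b s * normal_density ?c ?\<tau> x" by (rule sqrt_normal_densities[OF s])
    finally show ?thesis using p normal_affinity_pos[OF s, of a b] normal_ratio_pos[OF s, of a b x]
      by (simp add: ennreal_mult[symmetric])
  qed
  then have "(\<integral>\<^sup>+x. ennreal (sqrt (normal_ratio a b s x)) \<partial>density lborel (\<lambda>x. ennreal (normal_density a 1 x)))
    = ennreal (normal_affinity a b s) * (\<integral>\<^sup>+x. ennreal (normal_density ?c ?\<tau> x) \<partial>lborel)"
    by (simp add: nn_integral_density nn_integral_cmult)
  also have "(\<integral>\<^sup>+x. ennreal (normal_density ?c ?\<tau> x) \<partial>lborel) = 1"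
    using t by (simp add: nn_integral_eq_integral)
  finally show ?thesis by simp
qed

lemma ln_normal_ratio:
  assumes s: "s > 0"
  shows "- ln (normal_ratio a b s x) = ln s + (x - b)\<^sup>2 / (2 * s\<^sup>2) - (x - a)\<^sup>2 / 2"
proof -
  have ln_nd: "ln (normal_density m u x) = - ln (sqrt (2 * pi)) - ln u - (x - m)\<^sup>2 / (2 * u\<^sup>2)" if "u > 0" for m u
  proof -
    have "normal_density m u x = 1 / (sqrt (2 * pi) * u) * exp (- ((x - m)\<^sup>2 / (2 * u\<^sup>2)))"
      using that by (simp add: normal_density_def real_sqrt_mult)
    then show ?thesis using that by (simp add: ln_mult ln_div)
  qed
  have "ln (normal_ratio a b s x) = ln (normal_density b s x) - ln (normal_density a 1 x)"
    unfolding normal_ratio_def using s by (intro ln_divide_pos normal_density_pos) auto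
  then show ?thesis using s by (simp add: ln_nd)
qed

lemma normal_divergence_integral:
  assumes s: "s > 0"
  shows "has_bochner_integral (density lborel (\<lambda>x. ennreal (normal_density a 1 x)))
    (\<lambda>x. - ln (normal_ratio a b s x)) (normal_divergence a b s)"
proof -
  let ?P = "density lborel (\<lambda>x. ennreal (normal_density a 1 x))"
  interpret prob_space ?P by (rule prob_space_normal_density) simp
  have 1: "has_bochner_integral ?P (\<lambda>x. x) a"
    using normal_moment_nz_1[of 1 a] by (intro has_bochner_integral_density) auto
  have 2: "has_bochner_integral ?P (\<lambda>x. (x - a)\<^sup>2) 1"
    using normal_moment_even[of 1 a 1] by (intro has_bochner_integral_density) (auto simp: fact_numeral)
  have c: "has_bochner_integral ?P (\<lambda>x. c) c" for c :: real
    using prob_space by (simp add: has_bochner_integral_iff)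
  \<comment> \<open>Expanded about the mean \<open>a\<close>, the logarithm needs only the first two
    moments of \<open>N(a, 1)\<close>.\<close>
  have eq: "- ln (normal_ratio a b s x) = ln s + ((x - a)\<^sup>2 + 2 * (a - b) * (x - a) + (a - b)\<^sup>2) * (1 / (2 * s\<^sup>2)) - (x - a)\<^sup>2 * (1/2)" for x
  proof -
    have "(x - b)\<^sup>2 = (x - a)\<^sup>2 + 2 * (a - b) * (x - a) + (a - b)\<^sup>2"
      by (simp add: power2_eq_square algebra_simps)
    then show ?thesis unfolding ln_normal_ratio[OF s] by simp
  qed
  have "has_bochner_integral ?P (\<lambda>x. ln s + ((x - a)\<^sup>2 + 2 * (a - b) * (x - a) + (a - b)\<^sup>2) * (1 / (2 * s\<^sup>2)) - (x - a)\<^sup>2 * (1/2))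
    (ln s + (1 + 2 * (a - b) * (a - a) + (a - b)\<^sup>2) * (1 / (2 * s\<^sup>2)) - 1 * (1/2))"
    by (intro has_bochner_integral_add has_bochner_integral_diff has_bochner_integral_mult_left has_bochner_integral_mult_right c 1 2)
  then show ?thesis unfolding eq normal_divergence_def by simp
qed

text \<open>Both sides vanish to second order at \<open>s = 1\<close>, \<open>a = b\<close>. The
  bound \<open>C\<close> confines the scale to a region where they are comparable: it caps
  \<open>u\<close> by \<open>exp (2 * C) - 1\<close> and keeps \<open>1 / s\<close> below
  \<open>2 * exp (2 * C)\<close>.\<close>

lemma normal_divergence_le:
  assumes s: "s > 0" and C: "- ln (normal_affinity a b s) \<le> C"
  shows "normal_divergence a b s \<le> (4 * exp (2 * C) + 4 * (exp (2 * C))\<^sup>2 + 2 + 8 * (exp (2 * C))\<^sup>2) * (- ln (normal_affinity a b s))"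
    and "0 \<le> - ln (normal_affinity a b s)"
proof -
  define E where "E = exp (2 * C)"
  define q where "q = 1 + s\<^sup>2"
  have q: "q > 0" unfolding q_def by (simp add: add_pos_nonneg)
  \<comment> \<open>Chosen so that \<open>(1 + s\<^sup>2) / (2 * s) = 1 + u\<close>; minus the
    logarithm of the affinity then splits into the scale part \<open>ln (1 + u) / 2\<close> and the
    location part \<open>d\<close>.\<close>
  define u where "u = (s - 1)\<^sup>2 / (2 * s)"
  have u0: "0 \<le> u" unfolding u_def using s by simp
  have u1: "q / (2 * s) = 1 + u" unfolding u_def q_def using s by (simp add: field_simps power2_eq_square)
  define d where "d = (a - b)\<^sup>2 / (4 * q)"
  have d0: "0 \<le> d" unfolding d_def using q by simp
  have H: "- ln (normal_affinity a b s) = ln (1 + u) / 2 + d"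
  proof -
    have "2 * s / q = inverse (1 + u)" unfolding u1[symmetric] by simp
    then have "ln (normal_affinity a b s) = ln (sqrt (inverse (1 + u))) + ln (exp (- d))"
      unfolding normal_affinity_def q_def[symmetric] d_def using u0 by (subst ln_mult_pos) auto
    also have "ln (sqrt (inverse (1 + u))) = - ln (1 + u) / 2" using u0 by (simp add: ln_sqrt ln_inverse)
    finally show ?thesis by simp
  qed
  have l0: "0 \<le> ln (1 + u)" using u0 by simp
  show H0: "0 \<le> - ln (normal_affinity a b s)" unfolding H using l0 d0 by simp
  have "ln (1 + u) \<le> 2 * C" using C d0 unfolding H by linarith
  then have "exp (ln (1 + u)) \<le> E" unfolding E_def by simp
  then have "1 + u \<le> E" using u0 by simp
  then have uE: "q / (2 * s) \<le> E" using u1 by simp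
  have E1: "1 \<le> E" using \<open>1 + u \<le> E\<close> u0 by linarith
  have qE: "q \<le> 2 * s * E" using uE s by (simp add: divide_le_eq mult.commute)
  have sinv: "1 / s \<le> 2 * E"
  proof -
    have "1 \<le> q" unfolding q_def by simp
    then have "1 \<le> 2 * s * E" using qE by linarith
    then show ?thesis using s by (simp add: divide_le_eq mult_ac)
  qed
  have uln: "u \<le> E * ln (1 + u)"
  proof -
    have "1 - 1 / (1 + u) \<le> ln (1 + u)"
      using ln_le_minus_one[of "1 / (1 + u)"] u0 by (simp add: ln_div)
    moreover have "1 - 1 / (1 + u) = u / (1 + u)" using u0 by (simp add: field_simps)
    ultimately have "u \<le> ln (1 + u) * (1 + u)" using u0 by (simp add: divide_le_eq)
    also have "\<dots> \<le> ln (1 + u) * E" using l0 \<open>1 + u \<le> E\<close> by (intro mult_left_mono)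
    finally show ?thesis by (simp add: mult.commute)
  qed
  \<comment> \<open>Replacing \<open>ln s\<close> by \<open>s - 1\<close> leaves a rational function
    with a double zero at \<open>s = 1\<close>, hence an exact multiple of \<open>u\<close>.\<close>
  have k1: "ln s + 1 / (2 * s\<^sup>2) - 1 / 2 \<le> u * (2 + 1 / s)"
  proof -
    have "ln s \<le> s - 1" using s by (rule ln_le_minus_one)
    moreover have "(s - 1) + 1 / (2 * s\<^sup>2) - 1 / 2 = u * (2 + 1 / s)"
      unfolding u_def using s by (simp add: field_simps power2_eq_square)
    ultimately show ?thesis by linarith
  qed
  have k2: "u * (2 + 1 / s) \<le> (2 + 2 * E) * (E * ln (1 + u))"
  proof -
    have "u * (2 + 1 / s) \<le> u * (2 + 2 * E)" using u0 sinv by (intro mult_left_mono) auto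
    also have "\<dots> \<le> (E * ln (1 + u)) * (2 + 2 * E)" using uln E1 by (intro mult_right_mono) auto
    finally show ?thesis by (simp add: mult.commute)
  qed
  have k3: "(a - b)\<^sup>2 / (2 * s\<^sup>2) \<le> d * (2 + 8 * E\<^sup>2)"
  proof -
    have "(1 / s)\<^sup>2 \<le> (2 * E)\<^sup>2" using sinv s by (intro power_mono) auto
    then have "1 / s\<^sup>2 \<le> 4 * E\<^sup>2" by (simp add: power_divide power_mult_distrib)
    then have "2 * q / s\<^sup>2 \<le> 2 + 8 * E\<^sup>2" unfolding q_def using s by (simp add: add_divide_distrib distrib_left)
    then have "d * (2 * q / s\<^sup>2) \<le> d * (2 + 8 * E\<^sup>2)" using d0 by (intro mult_left_mono)
    moreover have "d * (2 * q / s\<^sup>2) = (a - b)\<^sup>2 / (2 * s\<^sup>2)" unfolding d_def using q s by simp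
    ultimately show ?thesis by simp
  qed
  have "normal_divergence a b s = (ln s + 1 / (2 * s\<^sup>2) - 1 / 2) + (a - b)\<^sup>2 / (2 * s\<^sup>2)"
    unfolding normal_divergence_def by (simp add: add_divide_distrib)
  also have "\<dots> \<le> (4 * E + 4 * E\<^sup>2) * (ln (1 + u) / 2) + (2 + 8 * E\<^sup>2) * d"
    using order_trans[OF k1 k2] k3 by (simp add: power2_eq_square algebra_simps)
  \<comment> \<open>The coefficients of the scale and location parts are simply added, so that one
    constant serves their sum.\<close>
  also have "\<dots> \<le> (4 * E + 4 * E\<^sup>2 + 2 + 8 * E\<^sup>2) * (ln (1 + u) / 2) + (4 * E + 4 * E\<^sup>2 + 2 + 8 * E\<^sup>2) * d"
    using l0 d0 E1 by (intro add_mono mult_right_mono) auto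
  also have "\<dots> = (4 * E + 4 * E\<^sup>2 + 2 + 8 * E\<^sup>2) * (- ln (normal_affinity a b s))"
    unfolding H by (simp add: distrib_left)
  finally show "normal_divergence a b s \<le> (4 * exp (2 * C) + 4 * (exp (2 * C))\<^sup>2 + 2 + 8 * (exp (2 * C))\<^sup>2) * (- ln (normal_affinity a b s))"
    unfolding E_def .
qed

section \<open>Finite products of normal laws\<close>

lemma density_PiM:
  fixes f :: "'i \<Rightarrow> 'a \<Rightarrow> ennreal"
  assumes I: "finite I" and M: "\<And>i. prob_space (M i)" and f: "\<And>i. f i \<in> borel_measurable (M i)"
    and N: "\<And>i. prob_space (density (M i) (f i))"
  shows "density (PiM I M) (\<lambda>x. \<Prod>i\<in>I. f i (x i)) = PiM I (\<lambda>i. density (M i) (f i))"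
proof -
  interpret M: product_sigma_finite M
    unfolding product_sigma_finite_def using M by (auto intro: prob_space_imp_sigma_finite)
  interpret N: product_sigma_finite "\<lambda>i. density (M i) (f i)"
    unfolding product_sigma_finite_def using N by (auto intro: prob_space_imp_sigma_finite)
  have fm: "(\<lambda>x. f i (x i)) \<in> borel_measurable (PiM I M)" if "i \<in> I" for i
    by (rule measurable_compose[OF measurable_component_singleton[OF that] f])
  show ?thesis
  proof (rule N.PiM_eqI[OF I])
    show "sets (density (PiM I M) (\<lambda>x. \<Prod>i\<in>I. f i (x i))) = sets (PiM I (\<lambda>i. density (M i) (f i)))"
      by (simp cong: sets_PiM_cong)
    fix A assume "\<And>i. i \<in> I \<Longrightarrow> A i \<in> sets (density (M i) (f i))"
    then have A: "\<And>i. i \<in> I \<Longrightarrow> A i \<in> sets (M i)" by simp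
    have "emeasure (density (PiM I M) (\<lambda>x. \<Prod>i\<in>I. f i (x i))) (Pi\<^sub>E I A)
      = (\<integral>\<^sup>+x. (\<Prod>i\<in>I. f i (x i)) * indicator (Pi\<^sub>E I A) x \<partial>PiM I M)"
      using I A fm by (intro emeasure_density sets_PiM_I_finite borel_measurable_prod_ennreal) auto
    also have "\<dots> = (\<integral>\<^sup>+x. (\<Prod>i\<in>I. f i (x i) * indicator (A i) (x i)) \<partial>PiM I M)"
    proof (intro nn_integral_cong)
      fix x assume "x \<in> space (PiM I M)"
      then have "indicator (Pi\<^sub>E I A) x = (\<Prod>i\<in>I. indicator (A i) (x i) :: ennreal)"
        using I by (auto simp: indicator_def space_PiM PiE_def Pi_def prod_zero_iff split: if_splits intro!: prod.neutral)
      then show "(\<Prod>i\<in>I. f i (x i)) * indicator (Pi\<^sub>E I A) x = (\<Prod>i\<in>I. f i (x i) * indicator (A i) (x i))"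
        by (simp add: prod.distrib)
    qed
    also have "\<dots> = (\<Prod>i\<in>I. \<integral>\<^sup>+x. f i x * indicator (A i) x \<partial>M i)"
      using A f by (intro M.product_nn_integral_prod[OF I]) auto
    also have "\<dots> = (\<Prod>i\<in>I. emeasure (density (M i) (f i)) (A i))"
      using A f by (intro prod.cong refl emeasure_density[symmetric]) auto
    finally show "emeasure (density (PiM I M) (\<lambda>x. \<Prod>i\<in>I. f i (x i))) (Pi\<^sub>E I A)
      = (\<Prod>i\<in>I. emeasure (density (M i) (f i)) (A i))" .
  qed
qed

definition normal_product :: "nat \<Rightarrow> (nat \<Rightarrow> real) \<Rightarrow> (nat \<Rightarrow> real) \<Rightarrow> (nat \<Rightarrow> real) measure" where
  "normal_product m a s = PiM {..<m} (\<lambda>i. density lborel (\<lambda>x. ennreal (normal_density (a i) (s i) x)))"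

lemma normal_product_prob_space:
  assumes "\<And>i. s i > 0" shows "prob_space (normal_product m a s)"
  unfolding normal_product_def using assms by (intro prob_space_PiM prob_space_normal_density)

lemma sets_normal_product: "sets (normal_product m a s) = sets (PiM {..<m} (\<lambda>_. borel))"
  unfolding normal_product_def by (intro sets_PiM_cong) auto

definition product_ratio where
  "product_ratio m a b s y = (\<Prod>i<m. normal_ratio (a i) (b i) (s i) (y i))"

lemma product_ratio_pos: "(\<And>i. s i > 0) \<Longrightarrow> 0 < product_ratio m a b s y"
  unfolding product_ratio_def by (intro prod_pos) (auto intro: normal_ratio_pos)

lemma product_ratio_measurable: "product_ratio m a b s \<in> borel_measurable (normal_product m a' s')"
proof -
  have "(\<lambda>y. normal_ratio (a i) (b i) (s i) (y i)) \<in> borel_measurable (PiM {..<m} (\<lambda>_. borel))" if "i \<in> {..<m}" for i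
    by (rule measurable_compose[OF measurable_component_singleton[OF that]]) simp
  then have "product_ratio m a b s \<in> borel_measurable (PiM {..<m} (\<lambda>_. borel))"
    unfolding product_ratio_def[abs_def] by (intro borel_measurable_prod)
  then show ?thesis by (simp cong: measurable_cong_sets add: sets_normal_product)
qed

lemma normal_product_density:
  assumes s: "\<And>i. s i > 0"
  shows "normal_product m b s = density (normal_product m a (\<lambda>_. 1)) (\<lambda>y. ennreal (product_ratio m a b s y))"
proof -
  let ?P = "\<lambda>i. density lborel (\<lambda>x. ennreal (normal_density (a i) 1 x))"
  let ?f = "\<lambda>i x. ennreal (normal_ratio (a i) (b i) (s i) x)"
  have d: "density (?P i) (?f i) = density lborel (\<lambda>x. ennreal (normal_density (b i) (s i) x))" for i
    by (rule normal_ratio_density[OF s])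
  have "density (PiM {..<m} ?P) (\<lambda>x. \<Prod>i<m. ?f i (x i)) = PiM {..<m} (\<lambda>i. density (?P i) (?f i))"
    by (rule density_PiM) (auto simp: d intro!: prob_space_normal_density s)
  moreover have "(\<Prod>i<m. ?f i (x i)) = ennreal (product_ratio m a b s x)" for x
    unfolding product_ratio_def using normal_ratio_pos[OF s] by (intro prod_ennreal) (auto intro: less_imp_le)
  ultimately show ?thesis unfolding normal_product_def d by simp
qed

lemma product_affinity:
  assumes s: "\<And>i. s i > 0"
  shows "(\<integral>\<^sup>+y. ennreal (sqrt (product_ratio m a b s y)) \<partial>normal_product m a (\<lambda>_. 1))
    = ennreal (\<Prod>i<m. normal_affinity (a i) (b i) (s i))"
proof -
  let ?P = "\<lambda>i. density lborel (\<lambda>x. ennreal (normal_density (a i) 1 x))"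
  interpret product_sigma_finite ?P
    unfolding product_sigma_finite_def
    by (auto intro!: prob_space_imp_sigma_finite prob_space_normal_density)
  have "ennreal (sqrt (product_ratio m a b s y)) = (\<Prod>i<m. ennreal (sqrt (normal_ratio (a i) (b i) (s i) (y i))))" for y
  proof -
    have "sqrt (product_ratio m a b s y) = (\<Prod>i<m. sqrt (normal_ratio (a i) (b i) (s i) (y i)))"
      unfolding product_ratio_def by (induction m) (auto simp: real_sqrt_mult)
    then show ?thesis using normal_ratio_pos[OF s] by (simp add: prod_ennreal less_imp_le)
  qed
  then have "(\<integral>\<^sup>+y. ennreal (sqrt (product_ratio m a b s y)) \<partial>normal_product m a (\<lambda>_. 1))
    = (\<integral>\<^sup>+y. (\<Prod>i<m. ennreal (sqrt (normal_ratio (a i) (b i) (s i) (y i)))) \<partial>PiM {..<m} ?P)"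
    unfolding normal_product_def by simp
  also have "\<dots> = (\<Prod>i<m. \<integral>\<^sup>+x. ennreal (sqrt (normal_ratio (a i) (b i) (s i) x)) \<partial>?P i)"
    by (intro product_nn_integral_prod) auto
  also have "\<dots> = (\<Prod>i<m. ennreal (normal_affinity (a i) (b i) (s i)))"
    by (simp only: normal_affinity_integral[OF s])
  also have "\<dots> = ennreal (\<Prod>i<m. normal_affinity (a i) (b i) (s i))"
    using normal_affinity_pos[OF s] by (intro prod_ennreal) (auto intro: less_imp_le)
  finally show ?thesis .
qed

text \<open>The likelihood ratio test: where the ratio exceeds \<open>1\<close> its root is at least
  \<open>1\<close>, elsewhere the ratio is at most its root. Both errors are therefore bounded by
  the integral of the root, which is the affinity.\<close>

lemma affinity_separation:
  fixes m :: nat and a b s :: "nat \<Rightarrow> real"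
  assumes s: "\<And>i. s i > 0"
  defines "\<rho> \<equiv> \<Prod>i<m. normal_affinity (a i) (b i) (s i)"
  shows "\<exists>D\<in>sets (PiM {..<m} (\<lambda>_. borel)). measure (normal_product m a (\<lambda>_. 1)) D \<le> \<rho>
    \<and> 1 - \<rho> \<le> measure (normal_product m b s) D"
proof -
  let ?P = "normal_product m a (\<lambda>_. 1)" and ?R = "product_ratio m a b s"
  interpret P: prob_space ?P by (rule normal_product_prob_space) simp
  interpret Q: prob_space "normal_product m b s" by (rule normal_product_prob_space[OF s])
  note R [measurable] = product_ratio_measurable[of m a b s a "\<lambda>_. 1"]
  have R0: "0 < ?R y" for y by (rule product_ratio_pos[OF s])
  have \<rho>0: "0 \<le> \<rho>" unfolding \<rho>_def using normal_affinity_pos[OF s] by (intro prod_nonneg) (auto intro: less_imp_le)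
  define D where "D = {y \<in> space ?P. 1 < ?R y}"
  have D [measurable]: "D \<in> sets ?P" unfolding D_def by measurable
  have "emeasure ?P D = (\<integral>\<^sup>+y. indicator D y \<partial>?P)" by simp
  also have "\<dots> \<le> (\<integral>\<^sup>+y. ennreal (sqrt (?R y)) \<partial>?P)"
    by (intro nn_integral_mono) (auto simp: D_def indicator_def)
  also have "\<dots> = ennreal \<rho>" unfolding \<rho>_def by (rule product_affinity[OF s])
  finally have 1: "measure ?P D \<le> \<rho>" using \<rho>0 by (simp add: P.emeasure_eq_measure)
  have "emeasure (normal_product m b s) (space ?P - D) = (\<integral>\<^sup>+y. ennreal (?R y) * indicator (space ?P - D) y \<partial>?P)"
    unfolding normal_product_density[OF s, where m=m and b=b and a=a] by (intro emeasure_density) auto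
  also have "\<dots> \<le> (\<integral>\<^sup>+y. ennreal (sqrt (?R y)) \<partial>?P)"
  proof (intro nn_integral_mono)
    fix y assume y: "y \<in> space ?P"
    have "?R y \<le> sqrt (?R y)" if "?R y \<le> 1"
    proof (rule real_le_rsqrt)
      have "?R y * ?R y \<le> ?R y * 1" using that R0[of y] by (intro mult_left_mono) auto
      then show "(?R y)\<^sup>2 \<le> ?R y" by (simp add: power2_eq_square)
    qed
    then show "ennreal (?R y) * indicator (space ?P - D) y \<le> ennreal (sqrt (?R y))"
      using y by (auto simp: D_def indicator_def intro!: ennreal_leI)
  qed
  also have "\<dots> = ennreal \<rho>" unfolding \<rho>_def by (rule product_affinity[OF s])
  finally have 2: "measure (normal_product m b s) (space ?P - D) \<le> \<rho>"
    using \<rho>0 by (simp add: Q.emeasure_eq_measure)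
  have sets: "sets (normal_product m b s) = sets ?P" by (simp add: sets_normal_product)
  have "measure (normal_product m b s) (space ?P - D) = 1 - measure (normal_product m b s) D"
    using Q.prob_compl[of D] D sets sets_eq_imp_space_eq[OF sets] by simp
  then show ?thesis using 1 2 D by (intro bexI[of _ D]) (auto simp: sets_normal_product)
qed

text \<open>The entropy inequality for the test function \<open>K * indicator E\<close>, with the
  law of unit variances in the first place and the other as reference. The divergence is a sum
  because the logarithm of the product ratio is a sum over coordinates.\<close>

lemma product_gibbs:
  assumes s: "\<And>i. s i > 0" and E: "E \<in> sets (PiM {..<m} (\<lambda>_. borel))"
  shows "K * measure (normal_product m a (\<lambda>_. 1)) E
    \<le> (\<Sum>i<m. normal_divergence (a i) (b i) (s i)) + exp K * measure (normal_product m b s) E"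
proof -
  let ?P = "normal_product m a (\<lambda>_. 1)" and ?R = "product_ratio m a b s" and ?Q = "normal_product m b s"
  let ?N = "\<lambda>i. density lborel (\<lambda>x. ennreal (normal_density (a i) 1 x))"
  interpret P: prob_space ?P by (rule normal_product_prob_space) simp
  interpret Q: prob_space ?Q by (rule normal_product_prob_space[OF s])
  note R [measurable] = product_ratio_measurable[of m a b s a "\<lambda>_. 1"]
  have E' [measurable]: "E \<in> sets ?P" using E by (simp add: sets_normal_product)
  have sQ: "sets ?Q = sets ?P" by (simp add: sets_normal_product)
  have R0: "0 < ?R y" for y by (rule product_ratio_pos[OF s])
  have coord: "has_bochner_integral ?P (\<lambda>y. - ln (normal_ratio (a i) (b i) (s i) (y i))) (normal_divergence (a i) (b i) (s i))"
    if "i \<in> {..<m}" for i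
  proof -
    have d: "distr ?P (?N i) (\<lambda>y. y i) = ?N i"
      unfolding normal_product_def using that
      by (intro distr_PiM_component) (auto intro!: prob_space_normal_density)
    have mc: "(\<lambda>y. y i) \<in> measurable ?P (?N i)"
      unfolding normal_product_def by (rule measurable_component_singleton[OF that])
    have lm: "(\<lambda>x. - ln (normal_ratio (a i) (b i) (s i) x)) \<in> borel_measurable (?N i)" by simp
    have "has_bochner_integral (distr ?P (?N i) (\<lambda>y. y i)) (\<lambda>x. - ln (normal_ratio (a i) (b i) (s i) x)) (normal_divergence (a i) (b i) (s i))"
      unfolding d by (rule normal_divergence_integral[OF s])
    then show ?thesis
      unfolding has_bochner_integral_iff integrable_distr_eq[OF mc lm] integral_distr[OF mc lm] .
  qed
  have lnR: "- ln (?R y) = (\<Sum>i<m. - ln (normal_ratio (a i) (b i) (s i) (y i)))" for y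
    unfolding product_ratio_def sum_negf using normal_ratio_pos[OF s] by (subst ln_prod) (auto simp: less_imp_neq[THEN not_sym])
  have hl: "has_bochner_integral ?P (\<lambda>y. - ln (?R y)) (\<Sum>i<m. normal_divergence (a i) (b i) (s i))"
    unfolding lnR by (rule has_bochner_integral_sum[OF coord])
  have Qi: "integrable ?P (\<lambda>y. f y * ?R y)" "(\<integral>y. f y * ?R y \<partial>?P) = (\<integral>y. f y \<partial>?Q)"
    if f: "f \<in> borel_measurable ?P" and i: "integrable ?Q f" for f :: "_ \<Rightarrow> real"
  proof -
    show "integrable ?P (\<lambda>y. f y * ?R y)"
      using i f R0 unfolding normal_product_density[OF s, where m=m and b=b and a=a]
      by (subst (asm) integrable_density) (auto simp: less_imp_le mult.commute)
    show "(\<integral>y. f y * ?R y \<partial>?P) = (\<integral>y. f y \<partial>?Q)"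
      using f R0 unfolding normal_product_density[OF s, where m=m and b=b and a=a]
      by (subst integral_density) (auto simp: less_imp_le mult.commute)
  qed
  \<comment> \<open>This is \<open>exp (K * indicator E y)\<close>, written affinely in the
    indicator so that its integral is immediate.\<close>
  define f where "f y = 1 + (exp K - 1) * indicator E y" for y :: "nat \<Rightarrow> real"
  have f: "f \<in> borel_measurable ?P" unfolding f_def[abs_def] by measurable
  have EQ: "E \<in> sets ?Q" using sQ by simp
  have iEQ: "integrable ?Q (\<lambda>y. indicator E y :: real)" by (rule integrable_real_indicator[OF EQ]) (simp add: Q.emeasure_eq_measure)
  have iEP: "integrable ?P (\<lambda>y. indicator E y :: real)" by (rule integrable_real_indicator[OF E']) (simp add: P.emeasure_eq_measure)
  have fQ: "integrable ?Q f" unfolding f_def[abs_def] using iEQ by simp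
  have EP: "E \<inter> space ?P = E" "E \<inter> space ?Q = E" using sets.sets_into_space[OF E'] sets.sets_into_space[OF EQ] by auto
  have fQ1: "(\<integral>y. f y \<partial>?Q) = 1 + (exp K - 1) * measure ?Q E"
    unfolding f_def using iEQ by (simp add: Q.prob_space EP)
  have "(\<integral>y. K * indicator E y \<partial>?P) \<le> (\<integral>y. - ln (?R y) + (f y * ?R y - 1) \<partial>?P)"
  proof (rule integral_mono)
    show "integrable ?P (\<lambda>y. K * indicator E y)" using iEP by simp
    show "integrable ?P (\<lambda>y. - ln (?R y) + (f y * ?R y - 1))"
      using hl Qi(1)[OF f fQ] by (auto simp: has_bochner_integral_iff)
    fix y
    have "f y = exp (K * indicator E y)" by (auto simp: f_def indicator_def)
    then have "K * indicator E y + ln (?R y) = ln (f y * ?R y)" using R0[of y] by (simp add: ln_mult)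
    moreover have "f y * ?R y > 0" using R0[of y] \<open>f y = exp (K * indicator E y)\<close> by simp
    then have "ln (f y * ?R y) \<le> f y * ?R y - 1" by (rule ln_le_minus_one)
    ultimately show "K * indicator E y \<le> - ln (?R y) + (f y * ?R y - 1)" by linarith
  qed
  also have "\<dots> = (\<Sum>i<m. normal_divergence (a i) (b i) (s i)) + ((\<integral>y. f y * ?R y \<partial>?P) - 1)"
    using hl Qi(1)[OF f fQ] by (simp add: has_bochner_integral_iff P.prob_space)
  also have "\<dots> = (\<Sum>i<m. normal_divergence (a i) (b i) (s i)) + (exp K - 1) * measure ?Q E"
    unfolding Qi(2)[OF f fQ] fQ1 by simp
  also have "\<dots> \<le> (\<Sum>i<m. normal_divergence (a i) (b i) (s i)) + exp K * measure ?Q E"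
    by (simp add: left_diff_distrib)
  finally show ?thesis using iEP by (simp add: EP)
qed

text \<open>All terms \<open>- ln (normal_affinity ...)\<close> are nonnegative with sum at most
  \<open>C\<close>, so each is at most \<open>C\<close> and the comparison constant is common to all
  coordinates. Summation then gives a bound free of \<open>m\<close>.\<close>

lemma divergence_bound:
  fixes m :: nat and a b s :: "nat \<Rightarrow> real" and r :: real
  assumes s: "\<And>i. s i > 0" and r: "0 < r" "r \<le> (\<Prod>i<m. normal_affinity (a i) (b i) (s i))"
  defines "C \<equiv> - ln r"
  shows "(\<Sum>i<m. normal_divergence (a i) (b i) (s i))
    \<le> (4 * exp (2 * C) + 4 * (exp (2 * C))\<^sup>2 + 2 + 8 * (exp (2 * C))\<^sup>2) * C"
proof -
  let ?l = "\<lambda>i. - ln (normal_affinity (a i) (b i) (s i))"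
  let ?c = "4 * exp (2 * C) + 4 * (exp (2 * C))\<^sup>2 + 2 + 8 * (exp (2 * C))\<^sup>2"
  have l0: "0 \<le> ?l i" for i by (rule normal_divergence_le(2)[OF s order_refl])
  have "(\<Sum>i<m. ?l i) = - ln (\<Prod>i<m. normal_affinity (a i) (b i) (s i))"
    unfolding sum_negf using normal_affinity_pos[OF s] by (subst ln_prod) (auto simp: less_imp_neq[THEN not_sym])
  also have "\<dots> \<le> C" unfolding C_def using r by simp
  finally have lC: "(\<Sum>i<m. ?l i) \<le> C" .
  have "(\<Sum>i<m. normal_divergence (a i) (b i) (s i)) \<le> (\<Sum>i<m. ?c * ?l i)"
  proof (intro sum_mono normal_divergence_le(1)[OF s])
    fix i assume "i \<in> {..<m}"
    then have "?l i \<le> (\<Sum>i<m. ?l i)" using l0 by (intro member_le_sum) auto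
    then show "?l i \<le> C" using lC by linarith
  qed
  also have "\<dots> = ?c * (\<Sum>i<m. ?l i)" by (simp only: sum_distrib_left)
  also have "\<dots> \<le> ?c * C" using lC by (intro mult_left_mono) (auto intro!: add_nonneg_nonneg)
  finally show ?thesis .
qed

section \<open>Half of the Feldman--Hajek dichotomy\<close>

text \<open>Uncorrelated functionals of a Gaussian measure are independent: each linear combination
  is again a functional with normal law, and its characteristic function factorises once the mixed
  covariances vanish.\<close>

lemma gaussian_orthogonal_law:
  fixes M :: "'h::{real_inner, second_countable_topology} measure" and e :: "nat \<Rightarrow> 'h"
  assumes G: "gaussian_measure M"
    and o: "\<And>i j. i < m \<Longrightarrow> j < m \<Longrightarrow> i \<noteq> j \<Longrightarrow> gcov M (e i) (e j) = 0"
    and p: "\<And>i. i < m \<Longrightarrow> s i = sqrt (gcov M (e i) (e i))" and s: "\<And>i. s i > 0"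
    and a: "\<And>i. i < m \<Longrightarrow> a i = gmean M (e i)"
  shows "distr M (PiM {..<m} (\<lambda>_. borel)) (\<lambda>x. \<lambda>i\<in>{..<m}. x \<bullet> e i) = normal_product m a s"
proof -
  interpret prob_space M by (rule gaussian_prob_space[OF G])
  note mb [measurable] = inner_borel_measurable[OF gaussian_sets[OF G]]
  let ?N = "\<lambda>i. density lborel (\<lambda>x. ennreal (normal_density (a i) (s i) x))"
  interpret N: product_sigma_finite ?N
    unfolding product_sigma_finite_def
    by (auto intro!: prob_space_imp_sigma_finite prob_space_normal_density s)
  have law: "distr M borel (\<lambda>x. x \<bullet> e i) = ?N i" if "i < m" for i
    using gaussian_inner(1)[OF G, of "e i"] p[OF that] a[OF that] s[of i]
    unfolding normal_law_def by auto
  have chr: "(CLINT x|M. iexp (t * (x \<bullet> h))) = iexp (gmean M h * t) * complex_of_real (exp (- (gcov M h h * t\<^sup>2) / 2))" for h t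
  proof -
    have "(CLINT x|M. iexp (t * (x \<bullet> h))) = char (distr M borel (\<lambda>x. x \<bullet> h)) t"
      unfolding char_def by (simp add: integral_distr)
    also have "\<dots> = iexp (gmean M h * t) * complex_of_real (exp (- ((sqrt (gcov M h h) * t)\<^sup>2) / 2))"
      by (rule normal_law_char[OF gaussian_inner(1)[OF G]])
    also have "(sqrt (gcov M h h) * t)\<^sup>2 = gcov M h h * t\<^sup>2"
      using gcov_nonneg[OF G, of h] by (simp add: power_mult_distrib)
    finally show ?thesis .
  qed
  have indep: "measure M {x \<in> space M. \<forall>i\<in>{..<m}. x \<bullet> e i \<in> B i}
      = (\<Prod>i<m. measure M ((\<lambda>x. x \<bullet> e i) -` B i \<inter> space M))"
    if B: "\<And>i. i \<in> {..<m} \<Longrightarrow> B i \<in> sets borel" for B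
  proof (rule measure_prod_char[OF prob_space_axioms finite_lessThan])
    fix t :: "nat \<Rightarrow> real"
    let ?h = "\<Sum>i<m. t i *\<^sub>R e i"
    have h: "(\<Sum>i<m. t i * (x \<bullet> e i)) = 1 * (x \<bullet> ?h)" for x
      by (simp add: inner_sum_right)
    have cov: "gcov M ?h ?h = (\<Sum>i<m. gcov M (e i) (e i) * (t i)\<^sup>2)"
    proof -
      have "gcov M (e i) ?h = t i * gcov M (e i) (e i)" if "i < m" for i
      proof -
        have "gcov M (e i) ?h = (\<Sum>j<m. t j * gcov M (e j) (e i))"
          unfolding gcov_commute[of M "e i"] by (rule gcov_sum_left[OF G finite_lessThan])
        also have "\<dots> = (\<Sum>j<m. if j = i then t i * gcov M (e i) (e i) else 0)"
          using o that by (intro sum.cong) auto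
        finally show ?thesis using that by simp
      qed
      then have "(\<Sum>i<m. t i * gcov M (e i) ?h) = (\<Sum>i<m. gcov M (e i) (e i) * (t i)\<^sup>2)"
        by (intro sum.cong) (auto simp: power2_eq_square)
      then show ?thesis using gcov_sum_left[OF G finite_lessThan, where e=e and t=t and k="?h"] by simp
    qed
    have "(CLINT x|M. iexp (\<Sum>i<m. t i * (x \<bullet> e i))) = iexp (gmean M ?h) * complex_of_real (exp (- gcov M ?h ?h / 2))"
      unfolding h chr by simp
    also have "iexp (gmean M ?h) = (\<Prod>i<m. iexp (gmean M (e i) * t i))"
      unfolding gmean_sum[OF G finite_lessThan] by (simp add: exp_sum sum_distrib_left mult.commute)
    also have "complex_of_real (exp (- gcov M ?h ?h / 2)) = (\<Prod>i<m. complex_of_real (exp (- (gcov M (e i) (e i) * (t i)\<^sup>2) / 2)))"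
    proof -
      have "- gcov M ?h ?h / 2 = (\<Sum>i<m. - (gcov M (e i) (e i) * (t i)\<^sup>2) / 2)"
        unfolding cov by (simp add: sum_negf sum_divide_distrib)
      then show ?thesis by (simp only: exp_sum finite_lessThan of_real_prod)
    qed
    also have "(\<Prod>i<m. iexp (gmean M (e i) * t i)) * (\<Prod>i<m. complex_of_real (exp (- (gcov M (e i) (e i) * (t i)\<^sup>2) / 2)))
      = (\<Prod>i<m. CLINT x|M. iexp (t i * (x \<bullet> e i)))"
      unfolding chr by (rule prod.distrib[symmetric])
    finally show "(CLINT x|M. iexp (\<Sum>i\<in>{..<m}. t i * (x \<bullet> e i))) = (\<Prod>i\<in>{..<m}. CLINT x|M. iexp (t i * (x \<bullet> e i)))" .
  qed (use B in auto)
  let ?T = "\<lambda>x. \<lambda>i\<in>{..<m}. x \<bullet> e i"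
  have T: "?T \<in> measurable M (PiM {..<m} (\<lambda>_. borel))" by (intro measurable_restrict) auto
  show ?thesis unfolding normal_product_def
  proof (rule N.PiM_eqI[OF finite_lessThan])
    show "sets (distr M (PiM {..<m} (\<lambda>_. borel)) ?T) = sets (PiM {..<m} ?N)"
      unfolding sets_distr by (intro sets_PiM_cong) auto
    fix B assume "\<And>i. i \<in> {..<m} \<Longrightarrow> B i \<in> sets (?N i)"
    then have B: "\<And>i. i \<in> {..<m} \<Longrightarrow> B i \<in> sets borel" by simp
    have "emeasure (distr M (PiM {..<m} (\<lambda>_. borel)) ?T) (Pi\<^sub>E {..<m} B) = emeasure M (?T -` (Pi\<^sub>E {..<m} B) \<inter> space M)"
      using T B by (intro emeasure_distr sets_PiM_I_finite) auto
    also have "?T -` (Pi\<^sub>E {..<m} B) \<inter> space M = {x \<in> space M. \<forall>i\<in>{..<m}. x \<bullet> e i \<in> B i}"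
      unfolding vimage_def restrict_PiE_iff by blast
    also have "emeasure M \<dots> = ennreal (\<Prod>i<m. measure M ((\<lambda>x. x \<bullet> e i) -` B i \<inter> space M))"
      using indep[OF B] by (simp add: emeasure_eq_measure)
    also have "\<dots> = (\<Prod>i<m. ennreal (measure M ((\<lambda>x. x \<bullet> e i) -` B i \<inter> space M)))"
      by (rule prod_ennreal[symmetric]) simp
    also have "\<dots> = (\<Prod>i<m. emeasure (?N i) (B i))"
    proof (intro prod.cong refl)
      fix i assume i: "i \<in> {..<m}"
      have "emeasure (?N i) (B i) = emeasure (distr M borel (\<lambda>x. x \<bullet> e i)) (B i)" using law i by simp
      also have "\<dots> = emeasure M ((\<lambda>x. x \<bullet> e i) -` B i \<inter> space M)" using B[OF i] by (intro emeasure_distr) auto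
      finally show "ennreal (measure M ((\<lambda>x. x \<bullet> e i) -` B i \<inter> space M)) = emeasure (?N i) (B i)"
        by (simp add: emeasure_eq_measure)
    qed
    finally show "emeasure (distr M (PiM {..<m} (\<lambda>_. borel)) ?T) (Pi\<^sub>E {..<m} B) = (\<Prod>i\<in>{..<m}. emeasure (?N i) (B i))" .
  qed
qed

text \<open>The constant depends on \<open>r\<close> only, not on the number of functionals.\<close>

lemma gaussian_cylinder_bound:
  fixes \<mu> \<nu> :: "'h::{real_inner, second_countable_topology} measure" and d :: "nat \<Rightarrow> 'h"
    and p n :: nat and \<rho> :: "nat \<Rightarrow> nat \<Rightarrow> real" and K r :: real
  assumes G: "gaussian_measure \<mu>" "gaussian_measure \<nu>"
    and pos: "\<And>h. h \<noteq> 0 \<Longrightarrow> 0 < gcov \<mu> h h" "\<And>h. h \<noteq> 0 \<Longrightarrow> 0 < gcov \<nu> h h"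
    and r: "0 < r" "r \<le> 1/2" and ac: "\<And>B. B \<in> sets borel \<Longrightarrow> measure \<mu> B < r \<Longrightarrow> measure \<nu> B < 1/2"
  defines "C \<equiv> - ln r"
  shows "K * measure \<mu> {x. \<exists>k<p. \<forall>j<n. x \<bullet> d j \<le> \<rho> k j}
    \<le> (4 * exp (2 * C) + 4 * (exp (2 * C))\<^sup>2 + 2 + 8 * (exp (2 * C))\<^sup>2) * C
      + exp K * measure \<nu> {x. \<exists>k<p. \<forall>j<n. x \<bullet> d j \<le> \<rho> k j}"
proof -
  interpret two_forms "gcov \<mu>" "gcov \<nu>"
    using G pos(1) by unfold_locales
      (auto simp: gcov_add_left gcov_scaleR_left intro: gcov_commute)
  let ?S = "d ` {..<n}"
  have "finite ?S" by simp
  from simultaneous_diagonalisation[OF this] obtain m e where e: "orthonormal_on (span ?S) m e"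
    and Bo: "\<forall>i<m. \<forall>j<m. i \<noteq> j \<longrightarrow> gcov \<nu> (e i) (e j) = 0"
    and exp: "\<forall>v\<in>span ?S. v = (\<Sum>i<m. gcov \<mu> (e i) v *\<^sub>R e i)"
    by (elim exE conjE) blast
  have Ao: "gcov \<mu> (e i) (e j) = (if i = j then 1 else 0)" if "i < m" "j < m" for i j
    using e that by (auto simp: orthonormal_on_def)
  have ene: "e i \<noteq> 0" if "i < m" for i
    using Ao[OF that that] gcov_scaleR_left[of \<mu> 0 0 0] by auto
  define a where "a i = gmean \<mu> (e i)" for i
  define b where "b i = gmean \<nu> (e i)" for i
  \<comment> \<open>The value \<open>1\<close> outside the range is a default: the product lemmas
    ask for a positive scale at every index.\<close>
  define s where "s i = (if i < m then sqrt (gcov \<nu> (e i) (e i)) else 1)" for i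
  have s: "s i > 0" for i using pos(2)[OF ene, of i] by (simp add: s_def)
  let ?PB = "PiM {..<m} (\<lambda>_. borel :: real measure)"
  let ?T = "\<lambda>x. \<lambda>i\<in>{..<m}. x \<bullet> e i"
  \<comment> \<open>Orthonormality for the covariance of \<open>\<mu>\<close> makes all scales
    \<open>1\<close> here; the diagonalised covariance of \<open>\<nu>\<close> gives the scales
    \<open>s\<close> below.\<close>
  have P: "distr \<mu> ?PB ?T = normal_product m a (\<lambda>_. 1)"
    by (rule gaussian_orthogonal_law[OF G(1)]) (auto simp: Ao a_def)
  have Q: "distr \<nu> ?PB ?T = normal_product m b s"
    by (rule gaussian_orthogonal_law[OF G(2)]) (use Bo s in \<open>auto simp: b_def s_def\<close>)
  have T: "?T \<in> measurable M ?PB" if "sets M = sets borel" for M :: "'h measure"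
    using inner_borel_measurable[OF that] by (intro measurable_restrict) auto
  have TE: "measure (distr M ?PB ?T) E = measure M (?T -` E)" if M: "sets M = sets borel" and E: "E \<in> sets ?PB" for M :: "'h measure" and E
    using measure_distr[OF T[OF M] E] sets_eq_imp_space_eq[OF M] by simp
  have TEm: "?T -` E \<in> sets borel" if E: "E \<in> sets ?PB" for E
    using measurable_sets[OF T[OF refl] E] by simp
  let ?\<rho> = "\<Prod>i<m. normal_affinity (a i) (b i) (s i)"
  \<comment> \<open>If the affinity were smaller than \<open>r\<close>, the separating set would
    have \<open>\<mu>\<close>-mass below \<open>r\<close> but \<open>\<nu>\<close>-mass above
    \<open>1 - r\<close>, which is at least \<open>1/2\<close>.\<close>
  have "r \<le> ?\<rho>"
  proof (rule ccontr)
    assume lt: "\<not> r \<le> ?\<rho>"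
    from affinity_separation[of s m a b, OF s] obtain D where D: "D \<in> sets ?PB"
      "measure (normal_product m a (\<lambda>_. 1)) D \<le> ?\<rho>" "1 - ?\<rho> \<le> measure (normal_product m b s) D" by blast
    have "measure \<mu> (?T -` D) < r"
      using D(2) lt unfolding P[symmetric] TE[OF gaussian_sets[OF G(1)] D(1)] by simp
    then have "measure \<nu> (?T -` D) < 1/2" by (rule ac[OF TEm[OF D(1)]])
    moreover have "1 - ?\<rho> \<le> measure \<nu> (?T -` D)"
      using D(3) unfolding Q[symmetric] TE[OF gaussian_sets[OF G(2)] D(1)] .
    ultimately show False using lt r by linarith
  qed
  from divergence_bound[OF s r(1) this]
  have div: "(\<Sum>i<m. normal_divergence (a i) (b i) (s i)) \<le> (4 * exp (2 * C) + 4 * (exp (2 * C))\<^sup>2 + 2 + 8 * (exp (2 * C))\<^sup>2) * C"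
    unfolding C_def .
  \<comment> \<open>The given functionals lie in the span of the diagonalising ones, so the cylinder
    is a preimage under the independent coordinates.\<close>
  define E where "E = {y \<in> space ?PB. \<exists>k<p. \<forall>j<n. (\<Sum>i<m. gcov \<mu> (e i) (d j) * y i) \<le> \<rho> k j}"
  have [measurable]: "(\<lambda>y. \<Sum>i<m. gcov \<mu> (e i) (d j) * y i) \<in> borel_measurable ?PB" for j
    by (intro borel_measurable_sum borel_measurable_times borel_measurable_const measurable_component_singleton)
  have H: "{y \<in> space ?PB. (\<Sum>i<m. gcov \<mu> (e i) (d j) * y i) \<le> \<rho> k j} \<in> sets ?PB" for k j
    by measurable
  have "E = {y \<in> space ?PB. \<exists>k\<in>{..<p}. \<forall>j\<in>{..<n}. (\<Sum>i<m. gcov \<mu> (e i) (d j) * y i) \<le> \<rho> k j}"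
    unfolding E_def by (simp add: Bex_def Ball_def)
  also have "\<dots> \<in> sets ?PB"
    by (intro sets.sets_Collect_finite_Ex sets.sets_Collect_finite_All H finite_lessThan)
  finally have E: "E \<in> sets ?PB" .
  have "?T -` E = {x. \<exists>k<p. \<forall>j<n. x \<bullet> d j \<le> \<rho> k j}"
  proof -
    have "(\<Sum>i<m. gcov \<mu> (e i) (d j) * ?T x i) = x \<bullet> d j" if "j < n" for x j
    proof -
      have "d j \<in> span ?S" using that by (intro span_base) auto
      then have "d j = (\<Sum>i<m. gcov \<mu> (e i) (d j) *\<^sub>R e i)" using exp by blast
      then have "x \<bullet> d j = x \<bullet> (\<Sum>i<m. gcov \<mu> (e i) (d j) *\<^sub>R e i)" by simp
      also have "\<dots> = (\<Sum>i<m. gcov \<mu> (e i) (d j) * ?T x i)" by (simp add: inner_sum_right)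
      finally show ?thesis by simp
    qed
    then have "(\<forall>j<n. (\<Sum>i<m. gcov \<mu> (e i) (d j) * ?T x i) \<le> \<rho> k j) \<longleftrightarrow> (\<forall>j<n. x \<bullet> d j \<le> \<rho> k j)" for x k
      by simp
    moreover have "?T x \<in> space ?PB" for x by (simp add: space_PiM)
    ultimately show ?thesis unfolding E_def by blast
  qed
  then show ?thesis
    using product_gibbs[of s E m K a b, OF s E] div
    unfolding P[symmetric] Q[symmetric] TE[OF gaussian_sets[OF G(1)] E] TE[OF gaussian_sets[OF G(2)] E] by simp
qed

text \<open>The density exceeds a level \<open>k\<close> only by an amount of small integral, and
  below that level it contributes at most \<open>k\<close> times the mass of
  \<open>B\<close>.\<close>

lemma absolutely_continuous_small:
  assumes \<mu>: "prob_space \<mu>" and \<nu>: "prob_space \<nu>" "sets \<nu> = sets \<mu>" and ac: "absolutely_continuous \<mu> \<nu>"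
    and e: "\<epsilon> > 0"
  shows "\<exists>\<delta>>0. \<forall>B\<in>sets \<mu>. measure \<mu> B < \<delta> \<longrightarrow> measure \<nu> B < \<epsilon>"
proof -
  interpret \<mu>: prob_space \<mu> by fact
  interpret \<nu>: prob_space \<nu> by fact
  from real_density[OF \<mu> \<nu> ac]
  obtain D where D [measurable]: "D \<in> borel_measurable \<mu>" and D0: "\<forall>x. 0 \<le> D x"
    and dens: "\<nu> = density \<mu> (\<lambda>x. ennreal (D x))" and Di: "integrable \<mu> D"
    by (elim exE conjE) blast
  have "(\<lambda>k. \<integral>x. max 0 (D x - real k) \<partial>\<mu>) \<longlonglongrightarrow> (\<integral>x. 0 \<partial>\<mu>)"
  proof (rule integral_dominated_convergence[where w=D])
    show "AE x in \<mu>. (\<lambda>k. max 0 (D x - real k)) \<longlonglongrightarrow> 0"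
    proof (rule AE_I2)
      fix x
      obtain N where "D x \<le> real N" using real_arch_simple by blast
      then have "max 0 (D x - real k) = 0" if "k \<ge> N" for k using that by simp
      then have "eventually (\<lambda>k. 0 = max 0 (D x - real k)) sequentially"
        unfolding eventually_sequentially by (intro exI[of _ N]) simp
      then show "(\<lambda>k. max 0 (D x - real k)) \<longlonglongrightarrow> 0"
        by (rule Lim_transform_eventually[OF tendsto_const])
    qed
    show "AE x in \<mu>. norm (max 0 (D x - real k)) \<le> D x" for k
      using D0 by (intro AE_I2) (simp add: max_def)
  qed (use Di in auto)
  then have "eventually (\<lambda>k. (\<integral>x. max 0 (D x - real k) \<partial>\<mu>) < \<epsilon>/2) sequentially"
    using e by (intro order_tendstoD(2)) auto
  then obtain k where k: "(\<integral>x. max 0 (D x - real k) \<partial>\<mu>) < \<epsilon>/2"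
    by (auto simp: eventually_sequentially)
  have mi: "integrable \<mu> (\<lambda>x. max 0 (D x - real k))"
    by (rule Bochner_Integration.integrable_bound[OF Di]) (use D0 in \<open>auto simp: max_def\<close>)
  show ?thesis
  \<comment> \<open>Using \<open>real k + 1\<close> in place of \<open>real k\<close> avoids a zero
    denominator at \<open>k = 0\<close>.\<close>
  proof (intro exI[of _ "\<epsilon> / (2 * (real k + 1))"] conjI ballI impI)
    show "0 < \<epsilon> / (2 * (real k + 1))" using e by simp
    fix B assume B [measurable]: "B \<in> sets \<mu>" and s: "measure \<mu> B < \<epsilon> / (2 * (real k + 1))"
    have iB: "integrable \<mu> (\<lambda>x. indicator B x :: real)"
      by (rule integrable_real_indicator[OF B]) (simp add: \<mu>.emeasure_eq_measure)
    have DB: "integrable \<mu> (\<lambda>x. D x * indicator B x)"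
      by (rule Bochner_Integration.integrable_bound[OF Di]) (use D0 in \<open>auto simp: indicator_def\<close>)
    have BS: "B \<inter> space \<mu> = B" using sets.sets_into_space[OF B] by auto
    have "measure \<nu> B = (\<integral>x. indicator B x \<partial>\<nu>)"
      using sets_eq_imp_space_eq[OF \<nu>(2)] by (simp add: BS)
    also have "\<dots> = (\<integral>x. D x * indicator B x \<partial>\<mu>)"
      unfolding dens using D0 by (subst integral_density) auto
    also have "\<dots> \<le> (\<integral>x. (real k + 1) * indicator B x + max 0 (D x - real k) \<partial>\<mu>)"
      by (intro integral_mono DB Bochner_Integration.integrable_add mi integrable_mult_right iB) (auto simp: indicator_def)
    also have "\<dots> = (real k + 1) * measure \<mu> B + (\<integral>x. max 0 (D x - real k) \<partial>\<mu>)"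
      using mi iB by (simp add: BS)
    also have "(real k + 1) * measure \<mu> B \<le> (real k + 1) * (\<epsilon> / (2 * (real k + 1)))"
      using s by (intro mult_left_mono) auto
    also have "\<dots> = \<epsilon> / 2" by (simp add: field_simps)
    finally show "measure \<nu> B < \<epsilon>" using k by linarith
  qed
qed

text \<open>A degenerate marginal of \<open>\<nu>\<close> would concentrate \<open>\<nu>\<close> on
  a hyperplane, and that hyperplane is null for \<open>\<mu>\<close>.\<close>

lemma gaussian_nondegenerate_of_ac:
  fixes \<mu> \<nu> :: "'h::{real_inner, second_countable_topology} measure"
  assumes G: "gaussian_measure \<mu>" "gaussian_measure \<nu>" and ac: "absolutely_continuous \<mu> \<nu>"
    and pos: "0 < gcov \<mu> h h"
  shows "0 < gcov \<nu> h h"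
proof (rule ccontr)
  assume "\<not> 0 < gcov \<nu> h h"
  then have z: "gcov \<nu> h h = 0" using gcov_nonneg[OF G(2), of h] by linarith
  define b where "b = gmean \<nu> h"
  let ?B = "(\<lambda>x. x \<bullet> h) -` {b} \<inter> space \<mu>"
  have sp: "space \<nu> = space \<mu>" using gaussian_sets[OF G(1)] gaussian_sets[OF G(2)] by (intro sets_eq_imp_space_eq) simp
  note m1 = inner_borel_measurable[OF gaussian_sets[OF G(1)], of h]
  note m2 = inner_borel_measurable[OF gaussian_sets[OF G(2)], of h]
  have "emeasure \<mu> ?B = emeasure (distr \<mu> borel (\<lambda>x. x \<bullet> h)) {b}" by (simp add: emeasure_distr[OF m1])
  also have "\<dots> = emeasure (density lborel (\<lambda>x. ennreal (normal_density (gmean \<mu> h) (sqrt (gcov \<mu> h h)) x))) {b}"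
    using gaussian_inner(1)[OF G(1), of h] pos unfolding normal_law_def by auto
  also have "\<dots> = 0"
  proof -
    have "{b} \<in> null_sets (density lborel (\<lambda>x. ennreal (normal_density (gmean \<mu> h) (sqrt (gcov \<mu> h h)) x)))"
      by (rule absolutely_continuousI_density[THEN absolutely_continuous_def[THEN iffD1], THEN subsetD]) auto
    then show ?thesis by auto
  qed
  finally have "?B \<in> null_sets \<mu>" using measurable_sets[OF m1, of "{b}"] by auto
  then have "?B \<in> null_sets \<nu>" using ac unfolding absolutely_continuous_def by blast
  then have "emeasure \<nu> ?B = 0" by auto
  moreover have "emeasure \<nu> ?B = emeasure (distr \<nu> borel (\<lambda>x. x \<bullet> h)) {b}" by (simp add: emeasure_distr[OF m2] sp)
  moreover have "distr \<nu> borel (\<lambda>x. x \<bullet> h) = return borel b"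
    using gaussian_inner(1)[OF G(2), of h] z unfolding normal_law_def b_def by auto
  ultimately show False by simp
qed

text \<open>A point outside the ball is cut off by an open set of directions, so a dense sequence of
  directions suffices. This exhibits a ball as a decreasing limit of cylinders.\<close>

lemma cball_halfspaces:
  fixes c :: "'h::real_inner"
  assumes dense: "\<And>X. open X \<Longrightarrow> X \<noteq> {} \<Longrightarrow> \<exists>j. d j \<in> X"
    and R: "0 \<le> R"
  shows "cball c R = {x. \<forall>j. x \<bullet> d j \<le> c \<bullet> d j + R * norm (d j)}"
proof (intro set_eqI iffI)
  fix x assume "x \<in> cball c R"
  then have xc: "norm (x - c) \<le> R" by (simp add: dist_norm norm_minus_commute)
  have "(x - c) \<bullet> d j \<le> R * norm (d j)" for j
    using norm_cauchy_schwarz[of "x - c" "d j"] mult_right_mono[OF xc, of "norm (d j)"] by simp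
  then show "x \<in> {x. \<forall>j. x \<bullet> d j \<le> c \<bullet> d j + R * norm (d j)}" by (simp add: inner_diff_left algebra_simps)
next
  fix x assume x: "x \<in> {x. \<forall>j. x \<bullet> d j \<le> c \<bullet> d j + R * norm (d j)}"
  show "x \<in> cball c R"
  proof (rule ccontr)
    assume "x \<notin> cball c R"
    then have xc: "R < norm (x - c)" by (simp add: dist_norm norm_minus_commute)
    define X where "X = {h. R * norm h < (x - c) \<bullet> h}"
    have "open X" unfolding X_def by (intro open_Collect_less continuous_intros)
    moreover have "x - c \<in> X"
    proof -
      have "R * norm (x - c) < norm (x - c) * norm (x - c)"
        using xc R by (intro mult_strict_right_mono) auto
      then show ?thesis unfolding X_def by (simp add: power2_norm_eq_inner[symmetric] power2_eq_square)
    qed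
    ultimately obtain j where "d j \<in> X" using dense[of X] by blast
    moreover have "x \<bullet> d j \<le> c \<bullet> d j + R * norm (d j)" using x by blast
    ultimately show False by (simp add: X_def inner_diff_left)
  qed
qed

text \<open>The cylinder estimate allows finite unions of polyhedra because it must survive two
  limits: finite unions of balls are decreasing limits of such unions, and open sets are increasing
  limits of finite unions of balls. Outer regularity then reaches the null sets.\<close>

lemma gaussian_ac_imp_ac:
  fixes \<mu> \<nu> :: "'h::{banach, real_inner, second_countable_topology} measure"
  assumes G: "gaussian_measure \<mu>" "gaussian_measure \<nu>"
    and ac: "absolutely_continuous \<mu> \<nu>" and pos: "\<And>h. h \<noteq> 0 \<Longrightarrow> 0 < gcov \<mu> h h"
  shows "absolutely_continuous \<nu> \<mu>"
proof -
  interpret \<mu>: prob_space \<mu> by (rule gaussian_prob_space[OF G(1)])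
  interpret \<nu>: prob_space \<nu> by (rule gaussian_prob_space[OF G(2)])
  note sm = gaussian_sets[OF G(1)] and sn = gaussian_sets[OF G(2)]
  have pos': "0 < gcov \<nu> h h" if "h \<noteq> 0" for h
    by (rule gaussian_nondegenerate_of_ac[OF G ac pos[OF that]])
  have "sets \<nu> = sets \<mu>" using sm sn by simp
  from absolutely_continuous_small[OF \<mu>.prob_space_axioms \<nu>.prob_space_axioms this ac, of "1/2"]
  obtain \<delta> where \<delta>: "\<delta> > 0" "\<forall>B\<in>sets \<mu>. measure \<mu> B < \<delta> \<longrightarrow> measure \<nu> B < 1/2" by auto
  define r where "r = min \<delta> (1/2)"
  have r: "0 < r" "r \<le> 1/2" "\<And>B. B \<in> sets borel \<Longrightarrow> measure \<mu> B < r \<Longrightarrow> measure \<nu> B < 1/2"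
    using \<delta> sm by (auto simp: r_def)
  define C where "C = - ln r"
  define M where "M = (4 * exp (2 * C) + 4 * (exp (2 * C))\<^sup>2 + 2 + 8 * (exp (2 * C))\<^sup>2) * C"
  have cyl: "K * measure \<mu> {x. \<exists>k<p. \<forall>j<n. x \<bullet> d j \<le> \<rho> k j}
    \<le> M + exp K * measure \<nu> {x. \<exists>k<p. \<forall>j<n. x \<bullet> d j \<le> \<rho> k j}" for K and p n :: nat and \<rho> and d :: "nat \<Rightarrow> 'h"
    unfolding M_def C_def by (rule gaussian_cylinder_bound[OF G pos pos' r])
  obtain Ds :: "'h set" where Ds: "countable Ds" "\<And>X. open X \<Longrightarrow> X \<noteq> {} \<Longrightarrow> \<exists>d\<in>Ds. d \<in> X"
    using countable_dense_exists by blast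
  have Dne: "Ds \<noteq> {}" using Ds(2)[of UNIV] by auto
  define d where "d = from_nat_into Ds"
  have dr: "range d = Ds" unfolding d_def by (rule range_from_nat_into[OF Dne Ds(1)])
  have dense: "\<exists>j. d j \<in> X" if "open X" "X \<noteq> {}" for X
    using Ds(2)[OF that] dr by (metis imageE)
  have balls: "K * measure \<mu> (\<Union>k<p. cball (c k) (R k)) \<le> M + exp K * measure \<nu> (\<Union>k<p. cball (c k) (R k))"
    if K: "K \<ge> 0" and R: "\<And>k. 0 \<le> R k" for K p and c :: "nat \<Rightarrow> 'h" and R :: "nat \<Rightarrow> real"
  proof -
    define \<rho> where "\<rho> k j = c k \<bullet> d j + R k * norm (d j)" for k j
    define S where "S n = {x. \<exists>k<p. \<forall>j<n. x \<bullet> d j \<le> \<rho> k j}" for n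
    have cb: "cball (c k) (R k) = {x. \<forall>j. x \<bullet> d j \<le> \<rho> k j}" for k
      unfolding \<rho>_def by (rule cball_halfspaces[OF dense R])
    have SI: "(\<Inter>n. S n) = (\<Union>k<p. cball (c k) (R k))"
    proof (intro equalityI subsetI)
      fix x assume x: "x \<in> (\<Inter>n. S n)"
      show "x \<in> (\<Union>k<p. cball (c k) (R k))"
      proof (rule ccontr)
        assume "x \<notin> (\<Union>k<p. cball (c k) (R k))"
        then have "\<forall>k<p. \<exists>j. \<not> x \<bullet> d j \<le> \<rho> k j" unfolding cb by blast
        then obtain J where J: "\<And>k. k < p \<Longrightarrow> \<not> x \<bullet> d (J k) \<le> \<rho> k (J k)" by metis
        \<comment> \<open>\<open>Suc\<close> of the sum of the witnesses exceeds each of them, so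
          this single stage tests all violated constraints.\<close>
        have "x \<in> S (Suc (\<Sum>k<p. J k))" using x by blast
        then obtain k where k: "k < p" "\<And>j. j < Suc (\<Sum>k<p. J k) \<Longrightarrow> x \<bullet> d j \<le> \<rho> k j" unfolding S_def by blast
        have "J k \<le> (\<Sum>k<p. J k)" using k(1) by (intro member_le_sum) auto
        then show False using J[OF k(1)] k(2)[of "J k"] by simp
      qed
    next
      fix x assume "x \<in> (\<Union>k<p. cball (c k) (R k))"
      then show "x \<in> (\<Inter>n. S n)" unfolding S_def cb by blast
    qed
    have Sb: "S n \<in> sets borel" for n
    proof -
      have "S n = (\<Union>k<p. \<Inter>j\<in>{..<n}. {x. x \<bullet> d j \<le> \<rho> k j})" unfolding S_def by auto
      moreover have "closed {x. x \<bullet> d j \<le> \<rho> k j}" for k j by (intro closed_Collect_le continuous_intros)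
      ultimately show ?thesis by (auto intro!: borel_closed closed_UN closed_INT)
    qed
    have dec: "decseq S" unfolding decseq_def S_def by fastforce
    have lim: "(\<lambda>n. measure W (S n)) \<longlonglongrightarrow> measure W (\<Union>k<p. cball (c k) (R k))"
      if "finite_measure W" "sets W = sets borel" for W :: "'h measure"
      unfolding SI[symmetric] using that Sb dec by (intro finite_measure.finite_Lim_measure_decseq) auto
    show ?thesis
    proof (rule LIMSEQ_le)
      show "(\<lambda>n. K * measure \<mu> (S n)) \<longlonglongrightarrow> K * measure \<mu> (\<Union>k<p. cball (c k) (R k))"
        by (intro tendsto_intros lim \<mu>.finite_measure_axioms sm)
      show "(\<lambda>n. M + exp K * measure \<nu> (S n)) \<longlonglongrightarrow> M + exp K * measure \<nu> (\<Union>k<p. cball (c k) (R k))"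
        by (intro tendsto_intros lim \<nu>.finite_measure_axioms sn)
      show "\<exists>N. \<forall>n\<ge>N. K * measure \<mu> (S n) \<le> M + exp K * measure \<nu> (S n)"
        unfolding S_def using cyl by blast
    qed
  qed
  have opens: "K * measure \<mu> U \<le> M + exp K * measure \<nu> U" if K: "K \<ge> 0" and U: "open U" for K U
  proof (cases "U = {}")
    case True
    have "K * measure \<mu> (\<Union>k<(0::nat). cball (0::'h) 0) \<le> M + exp K * measure \<nu> (\<Union>k<(0::nat). cball (0::'h) 0)"
      by (rule balls[OF K]) simp
    then show ?thesis using True by simp
  next
    case False
    define F where "F = {(c, q). c \<in> Ds \<and> q \<in> \<rat> \<and> 0 < q \<and> cball c q \<subseteq> U}"
    have "F \<subseteq> Ds \<times> \<rat>" unfolding F_def by auto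
    then have cF: "countable F" using Ds(1) countable_rat by (meson countable_SIGMA countable_subset)
    have UF: "U = (\<Union>(c, q)\<in>F. cball c q)"
    proof (intro equalityI subsetI)
      fix x assume "x \<in> U"
      then obtain e where e: "e > 0" "ball x e \<subseteq> U" using U open_contains_ball by blast
      obtain q where q: "q \<in> \<rat>" "0 < q" "q < e / 2" using Rats_dense_in_real[of 0 "e/2"] e by auto
      obtain c where c: "c \<in> Ds" "c \<in> ball x q" using Ds(2)[of "ball x q"] q by auto
      have "cball c q \<subseteq> U"
      proof
        fix y assume "y \<in> cball c q"
        then have "dist x y < e" using c q dist_triangle[of x y c] by simp
        then show "y \<in> U" using e by auto
      qed
      then have "(c, q) \<in> F" unfolding F_def using c q by simp
      moreover have "x \<in> cball c q" using c by (simp add: dist_commute)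
      ultimately show "x \<in> (\<Union>(c, q)\<in>F. cball c q)" by blast
    qed (auto simp: F_def)
    have Fne: "F \<noteq> {}" using False UF by auto
    from Fne have rF: "range (from_nat_into F) = F" using cF by (rule range_from_nat_into)
    define W where "W p = (\<Union>k<p. cball (fst (from_nat_into F k)) (snd (from_nat_into F k)))" for p :: nat
    have UW: "(\<Union>p. W p) = U"
    proof -
      have "(\<Union>p. W p) = (\<Union>k. cball (fst (from_nat_into F k)) (snd (from_nat_into F k)))"
        unfolding W_def by (auto intro: lessI)
      also have "\<dots> = (\<Union>z\<in>range (from_nat_into F). cball (fst z) (snd z))" by blast
      also have "\<dots> = U" unfolding rF UF by (auto simp: case_prod_beta)
      finally show ?thesis .
    qed
    have R: "0 \<le> snd (from_nat_into F k)" for k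
      using from_nat_into[OF Fne, of k] unfolding F_def by auto
    have inc: "incseq W" unfolding incseq_def W_def by (auto intro: less_le_trans)
    have Wb: "W p \<in> sets borel" for p unfolding W_def by auto
    have lim: "(\<lambda>p. measure Z (W p)) \<longlonglongrightarrow> measure Z U"
      if "finite_measure Z" "sets Z = sets borel" for Z :: "'h measure"
      unfolding UW[symmetric] using that Wb inc by (intro finite_measure.finite_Lim_measure_incseq) auto
    show ?thesis
    proof (rule LIMSEQ_le)
      show "(\<lambda>p. K * measure \<mu> (W p)) \<longlonglongrightarrow> K * measure \<mu> U"
        by (intro tendsto_intros lim \<mu>.finite_measure_axioms sm)
      show "(\<lambda>p. M + exp K * measure \<nu> (W p)) \<longlonglongrightarrow> M + exp K * measure \<nu> U"
        by (intro tendsto_intros lim \<nu>.finite_measure_axioms sn)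
      show "\<exists>N. \<forall>p\<ge>N. K * measure \<mu> (W p) \<le> M + exp K * measure \<nu> (W p)"
        unfolding W_def by (intro exI allI impI balls[OF K R])
    qed
  qed
  show ?thesis unfolding absolutely_continuous_def
  proof
    fix B assume "B \<in> null_sets \<nu>"
    then have B: "B \<in> sets borel" "emeasure \<nu> B = 0" using sn by (auto simp: null_sets_def)
    \<comment> \<open>For fixed \<open>K\<close> an open superset of tiny \<open>\<nu>\<close>-mass
      absorbs the factor \<open>exp K\<close>, which leaves a bound uniform in
      \<open>K\<close>.\<close>
    have KM: "K * measure \<mu> B \<le> M" if K: "K \<ge> 0" for K
    proof (rule field_le_epsilon)
      fix e :: real assume e: "e > 0"
      have "(INF U\<in>{U. B \<subseteq> U \<and> open U}. emeasure \<nu> U) = 0"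
        using outer_regular[OF sn _ B(1)] B(2) by (simp add: \<nu>.emeasure_eq_measure)
      also have "\<dots> < ennreal (e / exp K)" using e by simp
      finally obtain U where U: "B \<subseteq> U" "open U" "emeasure \<nu> U < ennreal (e / exp K)"
        by (auto simp: INF_less_iff)
      then have "measure \<nu> U < e / exp K" using e by (simp add: \<nu>.emeasure_eq_measure ennreal_less_iff)
      then have 1: "exp K * measure \<nu> U \<le> e" by (simp add: field_simps)
      have "K * measure \<mu> B \<le> K * measure \<mu> U"
        using K U sm by (intro mult_left_mono \<mu>.finite_measure_mono) auto
      also have "\<dots> \<le> M + exp K * measure \<nu> U" by (rule opens[OF K U(2)])
      finally show "K * measure \<mu> B \<le> M + e" using 1 by linarith
    qed
    have "measure \<mu> B = 0"
    proof (rule ccontr)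
      assume "measure \<mu> B \<noteq> 0"
      then have m: "measure \<mu> B > 0" by (simp add: zero_less_measure_iff)
      \<comment> \<open>This value of \<open>K\<close> would give
        \<open>\<bar>M\<bar> + 1 \<le> M\<close>.\<close>
      have "(\<bar>M\<bar> + 1) / measure \<mu> B * measure \<mu> B \<le> M" using m by (intro KM) auto
      then show False using m by simp
    qed
    then show "B \<in> null_sets \<mu>" using B(1) sm by (simp add: null_sets_def \<mu>.emeasure_eq_measure)
  qed
qed

section \<open>Minimising the divergence over mixtures\<close>

lemma finite_common_subseq:
  fixes P :: "'i \<Rightarrow> (nat \<Rightarrow> nat) \<Rightarrow> bool"
  assumes I: "finite I"
    and ex: "\<And>i r. i \<in> I \<Longrightarrow> strict_mono r \<Longrightarrow> \<exists>s :: nat \<Rightarrow> nat. strict_mono s \<and> P i (r \<circ> s)"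
    and stable: "\<And>i r s. P i r \<Longrightarrow> strict_mono s \<Longrightarrow> P i (r \<circ> s)"
  shows "\<exists>r :: nat \<Rightarrow> nat. strict_mono r \<and> (\<forall>i\<in>I. P i r)"
  using I ex
proof (induction I rule: finite_induct)
  case empty
  show ?case by (intro exI[of _ id]) (auto simp: strict_mono_def)
next
  case (insert i I)
  then obtain r where r: "strict_mono r" "\<forall>j\<in>I. P j r" by auto
  have "\<exists>s. strict_mono s \<and> P i (r \<circ> s)" by (rule insert.prems) (use r in auto)
  then obtain s where "strict_mono s \<and> P i (r \<circ> s)" ..
  then have s: "strict_mono s" "P i (r \<circ> s)" by (rule conjunct1, rule conjunct2)
  have "strict_mono (r \<circ> s)" using r(1) s(1) by (rule strict_mono_o)
  moreover have "P j (r \<circ> s)" if "j \<in> insert i I" for j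
    using that r(2) s stable by blast
  ultimately show ?case by blast
qed

lemma KL_nonneg:
  assumes "prob_space \<mu>" "prob_space \<nu>" "sets \<nu> = sets \<mu>"
  shows "0 \<le> KL \<nu> \<mu>"
proof -
  interpret \<mu>: prob_space \<mu> by fact
  have "ereal ((\<integral>x. 0 \<partial>\<nu>) + 1 - (\<integral>x. exp 0 \<partial>\<mu>)) \<le> KL \<nu> \<mu>"
    by (rule KL_ge[OF assms, where h="\<lambda>_. 0" and C=0]) auto
  then show ?thesis by (simp add: \<mu>.prob_space zero_ereal_def)
qed

text \<open>The variational bound at \<open>h = K * indicator B\<close>. After division by
  \<open>K\<close>, the divergence contributes only \<open>c / K\<close>, uniformly over all
  \<open>\<nu>\<close> in a sublevel set.\<close>

lemma KL_measure_bound: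
  assumes \<mu>: "prob_space \<mu>" and \<nu>: "prob_space \<nu>" "sets \<nu> = sets \<mu>"
    and c: "KL \<nu> \<mu> \<le> ereal c" and B: "B \<in> sets \<mu>" and K: "0 \<le> K"
  shows "K * measure \<nu> B \<le> c + exp K * measure \<mu> B"
proof -
  interpret \<mu>: prob_space \<mu> by fact
  interpret \<nu>: prob_space \<nu> by fact
  have i: "integrable W (\<lambda>x. indicator B x :: real)" "(\<integral>x. indicator B x \<partial>W) = measure W B"
    if "prob_space W" "sets W = sets \<mu>" for W
  proof -
    interpret prob_space W by fact
    have "B \<in> sets W" using B that by simp
    then show "integrable W (\<lambda>x. indicator B x :: real)"
      by (intro integrable_real_indicator) (auto simp: emeasure_eq_measure)
    show "(\<integral>x. indicator B x \<partial>W) = measure W B"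
      using sets.sets_into_space[OF \<open>B \<in> sets W\<close>] by (simp add: Int_absorb2)
  qed
  have "ereal ((\<integral>x. K * indicator B x \<partial>\<nu>) + 1 - (\<integral>x. exp (K * indicator B x) \<partial>\<mu>)) \<le> KL \<nu> \<mu>"
    using B K by (intro KL_ge[OF \<mu> \<nu>, where C=K]) (auto simp: indicator_def)
  then have "ereal ((\<integral>x. K * indicator B x \<partial>\<nu>) + 1 - (\<integral>x. exp (K * indicator B x) \<partial>\<mu>)) \<le> ereal c"
    using c by (rule order_trans)
  then have 1: "K * measure \<nu> B + 1 - (\<integral>x. exp (K * indicator B x) \<partial>\<mu>) \<le> c"
    using i[OF \<nu>] by simp
  have "exp (K * indicator B x) = 1 + (exp K - 1) * indicator B x" for x by (auto simp: indicator_def)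
  then have "(\<integral>x. exp (K * indicator B x) \<partial>\<mu>) = 1 + (exp K - 1) * measure \<mu> B"
    using i[OF \<mu> refl] by (simp add: \<mu>.prob_space)
  also have "\<dots> \<le> 1 + exp K * measure \<mu> B" by (simp add: left_diff_distrib)
  finally show ?thesis using 1 by linarith
qed

text \<open>Domination up to the factor \<open>C\<close> lets this serve the mixtures themselves,
  with \<open>C = 1\<close>, and components of non-vanishing weight, with \<open>C\<close> the
  inverse of a lower bound on the weight.\<close>

lemma uniformly_ac_of_KL_bound:
  assumes \<mu>: "prob_space \<mu>" and \<nu>: "\<And>n. prob_space (\<nu> n)" "\<And>n. sets (\<nu> n) = sets \<mu>"
    and c: "\<And>n. KL (\<nu> n) \<mu> \<le> ereal c" and C: "0 < C"
    and V: "\<And>n B. B \<in> sets \<mu> \<Longrightarrow> measure (V n) B \<le> C * measure (\<nu> n) B"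
  shows "uniformly_ac V \<mu>"
  unfolding uniformly_ac_def
proof (intro allI impI)
  interpret \<mu>: prob_space \<mu> by fact
  fix e :: real assume e: "e > 0"
  \<comment> \<open>Chosen so that \<open>C * (\<bar>c\<bar> + 2) / K\<close> equals
    \<open>e\<close>; the threshold \<open>exp (- K)\<close> then keeps the term with
    \<open>exp K\<close> below \<open>1\<close>.\<close>
  define K where "K = C * (\<bar>c\<bar> + 2) / e"
  have K: "K > 0" unfolding K_def using e C by (intro divide_pos_pos mult_pos_pos) auto
  show "\<exists>\<delta>>0. \<forall>n. \<forall>B\<in>sets \<mu>. measure \<mu> B < \<delta> \<longrightarrow> measure (V n) B < e"
  proof (intro exI[of _ "exp (- K)"] conjI allI ballI impI)
    fix n B assume B: "B \<in> sets \<mu>" and s: "measure \<mu> B < exp (- K)"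
    have "K * measure (\<nu> n) B \<le> c + exp K * measure \<mu> B"
      using K by (intro KL_measure_bound[OF \<mu> \<nu> c B]) simp
    also have "exp K * measure \<mu> B < exp K * exp (- K)" using s by (intro mult_strict_left_mono) auto
    also have "exp K * exp (- K) = 1" by (simp add: exp_add[symmetric])
    finally have "K * measure (\<nu> n) B < \<bar>c\<bar> + 2" by linarith
    then have "C * (K * measure (\<nu> n) B) < C * (\<bar>c\<bar> + 2)" using C by (intro mult_strict_left_mono)
    also have "C * (\<bar>c\<bar> + 2) = K * e" unfolding K_def using e by simp
    finally have "K * (C * measure (\<nu> n) B) < K * e" by (simp add: mult_ac)
    then have "C * measure (\<nu> n) B < e" using K by simp
    then show "measure (V n) B < e" using V[OF B, of n] by linarith
  qed simp
qed

lemma KL_setwise_limit_le: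
  assumes \<mu>: "prob_space \<mu>" and \<nu>: "\<And>n. prob_space (\<nu> n)" "\<And>n. sets (\<nu> n) = sets \<mu>"
    and L: "prob_space L" "sets L = sets \<mu>" "absolutely_continuous \<mu> L"
    and lim: "setwise_limit \<nu> L" and c: "\<And>n. KL (\<nu> n) \<mu> \<le> ereal (c n)" "c \<longlonglongrightarrow> c'"
  shows "KL L \<mu> \<le> ereal c'"
proof (rule KL_le[OF \<mu> L])
  fix h :: "'a \<Rightarrow> real" and C assume h: "h \<in> borel_measurable \<mu>" "\<And>x. \<bar>h x\<bar> \<le> C"
  have "(\<lambda>n. \<integral>x. h x \<partial>\<nu> n) \<longlonglongrightarrow> (\<integral>x. h x \<partial>L)"
    using h L \<nu> by (intro setwise_limit_integral[OF _ _ _ lim, where C=C]) (auto cong: measurable_cong_sets)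
  then have "(\<lambda>n. (\<integral>x. h x \<partial>\<nu> n) + 1 - (\<integral>x. exp (h x) \<partial>\<mu>)) \<longlonglongrightarrow> (\<integral>x. h x \<partial>L) + 1 - (\<integral>x. exp (h x) \<partial>\<mu>)"
    by (intro tendsto_intros)
  moreover have "(\<integral>x. h x \<partial>\<nu> n) + 1 - (\<integral>x. exp (h x) \<partial>\<mu>) \<le> c n" for n
    using order_trans[OF KL_ge[OF \<mu> \<nu> h] c(1)] by simp
  ultimately show "(\<integral>x. h x \<partial>L) + 1 - (\<integral>x. exp (h x) \<partial>\<mu>) \<le> c'"
    using c(2) by (intro LIMSEQ_le[of _ _ c]) auto
qed

lemma target_measure_props:
  fixes \<mu>0 :: "'h::topological_space measure"
  assumes "prob_space \<mu>0" "sets \<mu>0 = sets borel" and r: "range \<iota> \<in> sets borel" "emeasure \<mu>0 (range \<iota>) = 1"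
    and i: "set_integrable \<mu>0 (range \<iota>) (\<lambda>x. exp (- \<Phi> (inv \<iota> x)))"
  shows "prob_space (target_measure \<mu>0 \<iota> \<Phi>)" "sets (target_measure \<mu>0 \<iota> \<Phi>) = sets borel"
    "absolutely_continuous \<mu>0 (target_measure \<mu>0 \<iota> \<Phi>)"
proof -
  interpret prob_space \<mu>0 by fact
  define Z where "Z = normalising_constant \<mu>0 \<iota> \<Phi>"
  let ?f = "\<lambda>x. indicator (range \<iota>) x * exp (- \<Phi> (inv \<iota> x))"
  have fi: "integrable \<mu>0 ?f" using i unfolding set_integrable_def by simp
  then have fm [measurable]: "?f \<in> borel_measurable \<mu>0" by (rule borel_measurable_integrable)
  have Zf: "Z = (\<integral>x. ?f x \<partial>\<mu>0)"
    unfolding Z_def normalising_constant_def set_lebesgue_integral_def by simp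
  have Z0: "Z > 0"
  proof -
    have "0 \<le> Z" unfolding Zf by simp
    \<comment> \<open>The exponential is positive, so a zero integral would make the range of
      \<open>\<iota>\<close> null, against its mass \<open>1\<close>.\<close>
    moreover have "Z \<noteq> 0"
    proof
      assume "Z = 0"
      then have "AE x in \<mu>0. ?f x = 0" unfolding Zf using fi by (subst (asm) integral_nonneg_eq_0_iff_AE) auto
      then have "AE x in \<mu>0. x \<notin> range \<iota>" by eventually_elim (auto simp: indicator_def split: if_splits)
      then have "emeasure \<mu>0 (range \<iota>) = 0"
        using r(1) assms(2) AE_iff_measurable[of "range \<iota>" \<mu>0 "\<lambda>x. x \<notin> range \<iota>"]
          sets_eq_imp_space_eq[OF assms(2)] by auto
      then show False using r(2) by simp
    qed
    ultimately show ?thesis by simp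
  qed
  define g where "g x = indicator (range \<iota>) x * (exp (- \<Phi> (inv \<iota> x)) / Z)" for x
  have gf: "g = (\<lambda>x. ?f x / Z)" unfolding g_def by auto
  have gm: "g \<in> borel_measurable \<mu>0" unfolding gf by measurable
  have g0: "0 \<le> g x" for x unfolding g_def using Z0 by simp
  have t: "target_measure \<mu>0 \<iota> \<Phi> = density \<mu>0 (\<lambda>x. ennreal (g x))"
    unfolding target_measure_def g_def Z_def ..
  have gi: "integrable \<mu>0 g" unfolding gf using fi by simp
  have g1: "(\<integral>x. g x \<partial>\<mu>0) = 1" unfolding gf using Zf Z0 by simp
  show "sets (target_measure \<mu>0 \<iota> \<Phi>) = sets borel" unfolding t using assms(2) by simp
  show "absolutely_continuous \<mu>0 (target_measure \<mu>0 \<iota> \<Phi>)"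
    unfolding t using gm by (intro absolutely_continuousI_density) auto
  have "emeasure (density \<mu>0 (\<lambda>x. ennreal (g x))) (space \<mu>0) = (\<integral>\<^sup>+x. ennreal (g x) \<partial>\<mu>0)"
    using gm by (subst emeasure_density) (auto intro!: nn_integral_cong)
  also have "\<dots> = 1" using gi g0 g1 by (simp add: nn_integral_eq_integral)
  finally show "prob_space (target_measure \<mu>0 \<iota> \<Phi>)" unfolding t by (intro prob_spaceI) simp
qed

lemma absolutely_continuous_trans:
  "absolutely_continuous M N \<Longrightarrow> absolutely_continuous N L \<Longrightarrow> absolutely_continuous M L"
  unfolding absolutely_continuous_def by blast

section \<open>Mixtures in terms of real-valued masses\<close>

lemma mixtureE:
  assumes "\<nu> \<in> mixtures N A" and A: "\<forall>\<nu>\<in>A. prob_space \<nu> \<and> sets \<nu> = sets borel"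
  shows "\<exists>p V. (\<forall>i\<in>{1..N}. 0 \<le> p i \<and> p i \<le> 1 \<and> V i \<in> A) \<and> (\<Sum>i=1..N. p i) = (1::real) \<and>
    (\<forall>B\<in>sets borel. measure \<nu> B = (\<Sum>i=1..N. p i * measure (V i) B)) \<and> prob_space \<nu> \<and> sets \<nu> = sets borel"
proof -
  obtain p :: "nat \<Rightarrow> real" and V where sb: "sets \<nu> = sets borel"
    and pV: "\<forall>i\<in>{1..N}. 0 \<le> p i \<and> p i \<le> 1 \<and> V i \<in> A" and sum: "(\<Sum>i=1..N. p i) = 1"
    and em: "\<forall>B\<in>sets borel. emeasure \<nu> B = (\<Sum>i=1..N. ennreal (p i) * emeasure (V i) B)"
    using assms(1) unfolding mixtures_def by blast
  have eq: "emeasure \<nu> B = ennreal (\<Sum>i=1..N. p i * measure (V i) B)" if "B \<in> sets borel" for B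
  proof -
    have "emeasure \<nu> B = (\<Sum>i=1..N. ennreal (p i) * emeasure (V i) B)" using em that by blast
    also have "\<dots> = (\<Sum>i=1..N. ennreal (p i * measure (V i) B))"
    proof (intro sum.cong refl)
      fix i assume i: "i \<in> {1..N}"
      then interpret prob_space "V i" using pV A by blast
      show "ennreal (p i) * emeasure (V i) B = ennreal (p i * measure (V i) B)"
        using pV i by (simp add: emeasure_eq_measure ennreal_mult)
    qed
    also have "\<dots> = ennreal (\<Sum>i=1..N. p i * measure (V i) B)"
      using pV by (intro sum_ennreal) auto
    finally show ?thesis .
  qed
  have m: "measure \<nu> B = (\<Sum>i=1..N. p i * measure (V i) B)" if "B \<in> sets borel" for B
    unfolding measure_def[of \<nu>] eq[OF that]
    by (intro enn2real_ennreal sum_nonneg mult_nonneg_nonneg) (use pV in auto)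
  have "measure (V i) UNIV = 1" if "i \<in> {1..N}" for i
  proof -
    have "V i \<in> A" using pV that by blast
    then show ?thesis using bspec[OF A, of "V i"] prob_space.prob_space[of "V i"] sets_eq_imp_space_eq[of "V i" borel] by simp
  qed
  then have "emeasure \<nu> UNIV = 1" using eq[of UNIV] sum by simp
  then have "prob_space \<nu>" using sets_eq_imp_space_eq[OF sb] by (intro prob_spaceI) simp
  then show ?thesis using pV sum m sb by blast
qed

lemma mixtureI:
  assumes "\<And>i. i \<in> {1..N} \<Longrightarrow> 0 \<le> p i \<and> p i \<le> 1 \<and> V i \<in> A" "(\<Sum>i=1..N. p i) = (1::real)"
    and A: "\<And>\<nu>. \<nu> \<in> A \<Longrightarrow> prob_space \<nu>"
    and m: "\<And>B. B \<in> sets borel \<Longrightarrow> measure \<nu> B = (\<Sum>i=1..N. p i * measure (V i) B)"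
    and \<nu>: "prob_space \<nu>" "sets \<nu> = sets borel"
  shows "\<nu> \<in> mixtures N A"
proof -
  interpret \<nu>: prob_space \<nu> by fact
  have "emeasure \<nu> B = (\<Sum>i=1..N. ennreal (p i) * emeasure (V i) B)" if B: "B \<in> sets borel" for B
  proof -
    have "emeasure \<nu> B = ennreal (\<Sum>i=1..N. p i * measure (V i) B)"
      by (simp add: \<nu>.emeasure_eq_measure m[OF B])
    also have "\<dots> = (\<Sum>i=1..N. ennreal (p i * measure (V i) B))"
      using assms(1) by (intro sum_ennreal[symmetric]) auto
    also have "\<dots> = (\<Sum>i=1..N. ennreal (p i) * emeasure (V i) B)"
    proof (intro sum.cong refl)
      fix i assume i: "i \<in> {1..N}"
      then interpret prob_space "V i" using assms(1) A by blast
      show "ennreal (p i * measure (V i) B) = ennreal (p i) * emeasure (V i) B"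
        using assms(1)[OF i] by (simp add: emeasure_eq_measure ennreal_mult)
    qed
    finally show ?thesis .
  qed
  then show ?thesis unfolding mixtures_def using assms(1,2) \<nu>(2) by blast
qed

lemma mixtureI_single:
  assumes "w \<in> A" "1 \<le> N" and A: "\<And>\<nu>. \<nu> \<in> A \<Longrightarrow> prob_space \<nu> \<and> sets \<nu> = sets borel"
  shows "w \<in> mixtures N A"
  using assms
  by (intro mixtureI[where p="\<lambda>i. if i = 1 then 1 else 0" and V="\<lambda>_. w"])
    (auto simp: if_distrib[where f="\<lambda>x. x * _"] cong: if_cong)

lemma mixture_minimiser_exists:
  fixes \<mu> :: "'h::{second_countable_topology, complete_space} measure"
  assumes \<mu>: "prob_space \<mu>" "sets \<mu> = sets borel" and N: "1 \<le> N"
    and A: "\<And>\<nu>. \<nu> \<in> A \<Longrightarrow> prob_space \<nu> \<and> sets \<nu> = sets borel"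
    and closed: "\<And>V L. (\<And>n. V n \<in> A) \<Longrightarrow> prob_space L \<Longrightarrow> sets L = sets borel \<Longrightarrow>
      setwise_limit V L \<Longrightarrow> absolutely_continuous \<mu> L \<Longrightarrow> L \<in> A"
    and w: "w \<in> A" "KL w \<mu> < \<infinity>"
  shows "\<exists>\<nu>. is_arg_min (\<lambda>\<nu>. KL \<nu> \<mu>) (\<lambda>\<nu>. \<nu> \<in> mixtures N A) \<nu>"
proof -
  interpret \<mu>: prob_space \<mu> by fact
  have wm: "w \<in> mixtures N A" by (rule mixtureI_single[OF w(1) N A])
  have mp: "prob_space \<nu>" "sets \<nu> = sets borel" if "\<nu> \<in> mixtures N A" for \<nu>
    using mixtureE[OF that] A by blast+
  define I where "I = (INF \<nu>\<in>mixtures N A. KL \<nu> \<mu>)"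
  have IK: "I \<le> KL \<nu> \<mu>" if "\<nu> \<in> mixtures N A" for \<nu> unfolding I_def using that by (rule INF_lower)
  have "0 \<le> I" unfolding I_def using KL_nonneg[OF \<mu>(1)] mp \<mu>(2) by (intro INF_greatest) auto
  moreover have "I < \<infinity>" using IK[OF wm] w(2) by (rule le_less_trans)
  ultimately obtain c where c: "I = ereal c" by (cases I) auto
  have "\<exists>\<nu>. \<nu> \<in> mixtures N A \<and> KL \<nu> \<mu> \<le> ereal (c + 1 / real (Suc n))" for n
  proof -
    have "I < ereal (c + 1 / real (Suc n))" unfolding c by simp
    then show ?thesis unfolding I_def by (auto simp: INF_less_iff intro: less_imp_le)
  qed
  then obtain \<nu> where \<nu>: "\<And>n. \<nu> n \<in> mixtures N A" and \<nu>c: "\<And>n. KL (\<nu> n) \<mu> \<le> ereal (c + 1 / real (Suc n))"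
    by metis
  note \<nu>p = mp[OF \<nu>]
  have \<nu>s: "sets (\<nu> n) = sets \<mu>" for n using \<nu>p \<mu>(2) by simp
  have \<nu>c1: "KL (\<nu> n) \<mu> \<le> ereal (c + 1)" for n
  proof -
    have "ereal (c + 1 / real (Suc n)) \<le> ereal (c + 1)" by simp
    then show ?thesis using \<nu>c[of n] by (rule order_trans[rotated])
  qed
  have "\<forall>n. \<exists>p V. (\<forall>i\<in>{1..N}. 0 \<le> p i \<and> p i \<le> 1 \<and> V i \<in> A) \<and> (\<Sum>i=1..N. p i) = (1::real) \<and>
    (\<forall>B\<in>sets borel. measure (\<nu> n) B = (\<Sum>i=1..N. p i * measure (V i) B))"
    using mixtureE[OF \<nu>] A by blast
  from choice[OF this] obtain p where "\<forall>n. \<exists>V. (\<forall>i\<in>{1..N}. 0 \<le> p n i \<and> p n i \<le> 1 \<and> V i \<in> A) \<and> (\<Sum>i=1..N. p n i) = (1::real) \<and>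
    (\<forall>B\<in>sets borel. measure (\<nu> n) B = (\<Sum>i=1..N. p n i * measure (V i) B))" ..
  from choice[OF this] obtain V where pV: "\<forall>n. (\<forall>i\<in>{1..N}. 0 \<le> p n i \<and> p n i \<le> 1 \<and> V n i \<in> A) \<and> (\<Sum>i=1..N. p n i) = (1::real) \<and>
    (\<forall>B\<in>sets borel. measure (\<nu> n) B = (\<Sum>i=1..N. p n i * measure (V n i) B))" ..
  have p01: "0 \<le> p n i" "p n i \<le> 1" and VA: "V n i \<in> A" if "i \<in> {1..N}" for n i
    using pV that by blast+
  have psum: "(\<Sum>i=1..N. p n i) = 1" for n using pV by blast
  have \<nu>m: "measure (\<nu> n) B = (\<Sum>i=1..N. p n i * measure (V n i) B)" if "B \<in> sets borel" for n B
    using pV that by blast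
  have Vp: "prob_space (V n i)" "sets (V n i) = sets borel" if "i \<in> {1..N}" for n i
    using A[OF VA[OF that]] by auto
  text \<open>Components of vanishing weight need not converge; only their contribution does.\<close>
  define lim where "lim i r P L \<longleftrightarrow> (\<lambda>n. p (r n) i) \<longlonglongrightarrow> P \<and>
    (P = 0 \<or> prob_space L \<and> sets L = sets borel \<and> setwise_limit (\<lambda>n. V (r n) i) L \<and> absolutely_continuous \<mu> L)"
    for i r P L
  have "\<exists>r. strict_mono r \<and> (\<forall>i\<in>{1..N}. \<exists>P L. lim i r P L)"
  proof (rule finite_common_subseq)
    fix i and r s :: "nat \<Rightarrow> nat"
    assume "\<exists>P L. lim i r P L" and s: "strict_mono s"
    then obtain P L where PL: "lim i r P L" by blast
    have "lim i (r \<circ> s) P L"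
      using PL LIMSEQ_subseq_LIMSEQ[OF _ s, of "\<lambda>n. p (r n) i" P]
        setwise_limit_subseq[OF _ s, of "\<lambda>n. V (r n) i" L]
      unfolding lim_def by (auto simp: comp_def)
    then show "\<exists>P L. lim i (r \<circ> s) P L" by blast
  next
    fix i and r :: "nat \<Rightarrow> nat" assume i: "i \<in> {1..N}" and r: "strict_mono r"
    have "bounded (range (\<lambda>n. p (r n) i))"
      using p01[OF i] by (intro boundedI[of _ 1]) auto
    then obtain P s where s: "strict_mono s" and P: "((\<lambda>n. p (r n) i) \<circ> s) \<longlonglongrightarrow> P"
      using bounded_imp_convergent_subsequence by blast
    have P0: "0 \<le> P" by (rule LIMSEQ_le_const[OF P]) (use p01[OF i] in auto)
    show "\<exists>s. strict_mono s \<and> (\<exists>P L. lim i (r \<circ> s) P L)"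
    proof (cases "P = 0")
      case True
      \<comment> \<open>The measure \<open>\<mu>\<close> is a mere placeholder, since
        \<open>lim\<close> demands nothing of the component when the limit weight is
        \<open>0\<close>.\<close>
      then have "lim i (r \<circ> s) P \<mu>" unfolding lim_def using P by (auto simp: comp_def)
      then show ?thesis using s by blast
    next
      case False
      then have Pp: "P > 0" using P0 by simp
      \<comment> \<open>From some index on the weight exceeds \<open>P / 2\<close>, so the component
        is dominated by \<open>2 / P\<close> times the mixture and inherits its uniform absolute
        continuity.\<close>
      have "eventually (\<lambda>n. ((\<lambda>n. p (r n) i) \<circ> s) n > P / 2) sequentially"
        using Pp by (intro order_tendstoD(1)[OF P]) simp
      then obtain n0 where n0: "\<And>n. n \<ge> n0 \<Longrightarrow> p (r (s n)) i > P / 2"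
        by (auto simp: eventually_sequentially)
      define q where "q n = r (s (n + n0))" for n
      have "uniformly_ac (\<lambda>n. V (q n) i) \<mu>"
      proof (rule uniformly_ac_of_KL_bound[OF \<mu>(1), where \<nu>="\<lambda>n. \<nu> (q n)" and c="c + 1" and C="2 / P"])
        fix n B assume "B \<in> sets \<mu>"
        then have B: "B \<in> sets borel" using \<mu>(2) by simp
        have "P / 2 * measure (V (q n) i) B \<le> p (q n) i * measure (V (q n) i) B"
          using n0[of "n + n0"] by (intro mult_right_mono) (auto simp: q_def)
        also have "\<dots> \<le> measure (\<nu> (q n)) B"
          unfolding \<nu>m[OF B] using p01 i by (intro member_le_sum) auto
        finally show "measure (V (q n) i) B \<le> 2 / P * measure (\<nu> (q n)) B"
          using Pp by (simp add: field_simps)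
      qed (use \<nu>p \<nu>s \<nu>c1 Pp in auto)
      from setwise_compactness[OF \<mu>.finite_measure_axioms \<mu>(2) Vp[OF i] this]
      obtain r' L where r': "strict_mono (r' :: nat \<Rightarrow> nat)" and L: "prob_space L" "sets L = sets borel"
        "setwise_limit ((\<lambda>n. V (q n) i) \<circ> r') L" "absolutely_continuous \<mu> L"
        by metis
      define s' where "s' n = s (r' n + n0)" for n
      have s': "strict_mono s'" using s r' unfolding s'_def strict_mono_def by simp
      have "strict_mono (\<lambda>n. r' n + n0)" using r' unfolding strict_mono_def by simp
      from LIMSEQ_subseq_LIMSEQ[OF P this] have "(\<lambda>n. p ((r \<circ> s') n) i) \<longlonglongrightarrow> P"
        by (simp add: comp_def s'_def)
      moreover have "setwise_limit (\<lambda>n. V ((r \<circ> s') n) i) L"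
        using L(3) by (simp add: comp_def s'_def q_def)
      ultimately have "lim i (r \<circ> s') P L" unfolding lim_def using L by blast
      then show ?thesis using s' by blast
    qed
  qed simp
  then obtain r where r: "strict_mono r" and rl: "\<forall>i\<in>{1..N}. \<exists>P L. lim i r P L" by blast
  \<comment> \<open>Some components may fail to converge, so a limit of the whole mixture is taken
    separately, along a further subsequence; it is identified afterwards with the mixture of the
    component limits.\<close>
  have "uniformly_ac (\<lambda>n. \<nu> (r n)) \<mu>"
    by (rule uniformly_ac_of_KL_bound[OF \<mu>(1), where \<nu>="\<lambda>n. \<nu> (r n)" and c="c + 1" and C=1])
      (use \<nu>p \<nu>s \<nu>c1 in auto)
  from setwise_compactness[OF \<mu>.finite_measure_axioms \<mu>(2) \<nu>p this]
  obtain s M where s: "strict_mono (s :: nat \<Rightarrow> nat)" and M: "prob_space M" "sets M = sets borel"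
    "setwise_limit ((\<lambda>n. \<nu> (r n)) \<circ> s) M" "absolutely_continuous \<mu> M"
    by metis
  define q where "q = r \<circ> s"
  have q: "strict_mono q" unfolding q_def using r s by (rule strict_mono_o)
  have M3: "setwise_limit (\<lambda>n. \<nu> (q n)) M" using M(3) by (simp add: q_def comp_def)
  have "\<forall>i. \<exists>PL. i \<in> {1..N} \<longrightarrow> lim i r (fst PL) (snd PL)" using rl by (metis fst_conv snd_conv)
  from choice[OF this] obtain PL where PL: "\<forall>i. i \<in> {1..N} \<longrightarrow> lim i r (fst (PL i)) (snd (PL i))" ..
  define P where "P i = fst (PL i)" for i
  \<comment> \<open>At zero limit weight any member of \<open>A\<close> will do, and
    \<open>w\<close> is the one at hand.\<close>
  define L where "L i = (if P i = 0 then w else snd (PL i))" for i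
  have Pl: "(\<lambda>n. p (q n) i) \<longlonglongrightarrow> P i" if "i \<in> {1..N}" for i
    using LIMSEQ_subseq_LIMSEQ[OF _ s, of "\<lambda>n. p (r n) i" "P i"] PL that
    unfolding lim_def P_def q_def by (auto simp: comp_def)
  have P01: "0 \<le> P i" "P i \<le> 1" if "i \<in> {1..N}" for i
    by (rule LIMSEQ_le_const[OF Pl[OF that]], use p01[OF that] in blast)
      (rule LIMSEQ_le_const2[OF Pl[OF that]], use p01[OF that] in blast)
  have Ll: "L i \<in> A" and Ls: "P i \<noteq> 0 \<Longrightarrow> setwise_limit (\<lambda>n. V (q n) i) (L i)" if i: "i \<in> {1..N}" for i
  proof -
    have *: "prob_space (L i) \<and> sets (L i) = sets borel \<and> setwise_limit (\<lambda>n. V (r n) i) (L i) \<and> absolutely_continuous \<mu> (L i)"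
      if "P i \<noteq> 0"
      using PL i that unfolding lim_def P_def L_def by auto
    show "L i \<in> A"
    proof (cases "P i = 0")
      case True then show ?thesis using w(1) by (simp add: L_def)
    next
      case False
      then show ?thesis using *[OF False] closed[of "\<lambda>n. V (r n) i" "L i"] VA[OF i] by blast
    qed
    show "setwise_limit (\<lambda>n. V (q n) i) (L i)" if "P i \<noteq> 0"
      using setwise_limit_subseq[OF _ s, of "\<lambda>n. V (r n) i" "L i"] *[OF that] by (simp add: comp_def q_def)
  qed
  have "M \<in> mixtures N A"
  proof (rule mixtureI[where p=P and V=L])
    show "0 \<le> P i \<and> P i \<le> 1 \<and> L i \<in> A" if "i \<in> {1..N}" for i using P01[OF that] Ll[OF that] by blast
    have "(\<lambda>n. \<Sum>i=1..N. p (q n) i) \<longlonglongrightarrow> (\<Sum>i=1..N. P i)" by (intro tendsto_sum Pl)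
    then show "(\<Sum>i=1..N. P i) = 1" unfolding psum by (simp add: LIMSEQ_const_iff)
    show "measure M B = (\<Sum>i=1..N. P i * measure (L i) B)" if B: "B \<in> sets borel" for B
    proof (rule LIMSEQ_unique)
      show "(\<lambda>n. measure (\<nu> (q n)) B) \<longlonglongrightarrow> measure M B"
        using M3 B M(2) unfolding setwise_limit_def by simp
      have "(\<lambda>n. p (q n) i * measure (V (q n) i) B) \<longlonglongrightarrow> P i * measure (L i) B" if i: "i \<in> {1..N}" for i
      proof (cases "P i = 0")
        case True
        \<comment> \<open>The masses are at most \<open>1\<close>, so a vanishing weight removes the
          term whether or not the component converges.\<close>
        have "(\<lambda>n. p (q n) i * measure (V (q n) i) B) \<longlonglongrightarrow> 0"
        proof (rule tendsto_sandwich[of "\<lambda>_. 0"])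
          show "eventually (\<lambda>n. p (q n) i * measure (V (q n) i) B \<le> p (q n) i) sequentially"
            using p01[OF i] prob_space.prob_le_1[OF Vp(1)[OF i]]
            by (intro always_eventually allI mult_left_le) auto
          show "(\<lambda>n. p (q n) i) \<longlonglongrightarrow> 0" using Pl[OF i] True by simp
        qed (use p01[OF i] in auto)
        then show ?thesis using True by simp
      next
        case False
        have "sets (L i) = sets borel" using A[OF Ll[OF i]] by blast
        then have "(\<lambda>n. measure (V (q n) i) B) \<longlonglongrightarrow> measure (L i) B"
          using Ls[OF i False] B unfolding setwise_limit_def by simp
        then show ?thesis using Pl[OF i] by (intro tendsto_mult)
      qed
      then show "(\<lambda>n. measure (\<nu> (q n)) B) \<longlonglongrightarrow> (\<Sum>i=1..N. P i * measure (L i) B)"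
        unfolding \<nu>m[OF B] by (rule tendsto_sum)
    qed
  qed (use A M in auto)
  moreover have "KL M \<mu> \<le> ereal c"
  proof (rule KL_setwise_limit_le[OF \<mu>(1) _ _ _ _ M(4) M3])
    show "KL (\<nu> (q n)) \<mu> \<le> ereal (c + 1 / real (Suc (q n)))" for n by (rule \<nu>c)
    have "(\<lambda>n. c + 1 / real (Suc (q n))) \<longlonglongrightarrow> c + 0"
      by (intro tendsto_intros LIMSEQ_subseq_LIMSEQ[OF LIMSEQ_Suc[OF lim_1_over_n] q, unfolded comp_def])
    then show "(\<lambda>n. c + 1 / real (Suc (q n))) \<longlonglongrightarrow> c" by simp
  qed (use \<nu>p \<nu>s M \<mu> in auto)
  ultimately have "is_arg_min (\<lambda>\<nu>. KL \<nu> \<mu>) (\<lambda>\<nu>. \<nu> \<in> mixtures N A) M"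
    unfolding is_arg_min_def using IK unfolding c by (meson leD order_trans)
  then show ?thesis by blast
qed

theorem theorem3p20:
  fixes \<mu>0 :: "'h::{banach, real_inner, second_countable_topology} measure"
    and m0 :: 'h and C0 :: "'h \<Rightarrow>\<^sub>L 'h"
    and \<iota> :: "'x::{banach, second_countable_topology} \<Rightarrow> 'h"
    and \<Phi> :: "'x \<Rightarrow> real"
    and A :: "'h measure set" and N :: nat
  assumes "covariance_operator C0" and "strictly_positive C0"
    and "gaussian_measure \<mu>0" and "has_mean \<mu>0 m0" and "has_covariance \<mu>0 C0"
    and "bounded_linear \<iota>" and "inj \<iota>"
    and "range \<iota> \<in> sets borel" and "emeasure \<mu>0 (range \<iota>) = 1"
    and "continuous_on UNIV \<Phi>"
    and "set_integrable \<mu>0 (range \<iota>) (\<lambda>x. exp (- \<Phi> (inv \<iota> x)))"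
    and "A = {\<nu>. gaussian_measure \<nu>} \<or>
         A = {\<nu>. gaussian_measure \<nu> \<and> equivalent_measures \<nu> \<mu>0} \<or>
         (\<exists>C. covariance_operator C \<and> A = {\<nu>. gaussian_measure \<nu> \<and> has_covariance \<nu> C}) \<or>
         (\<exists>m. A = {\<nu>. gaussian_measure \<nu> \<and> has_mean \<nu> m})"
    and "N \<ge> 1"
    and "\<exists>\<nu>\<in>A. KL \<nu> (target_measure \<mu>0 \<iota> \<Phi>) < \<infinity>"
  shows "(\<exists>\<nu>. is_arg_min (\<lambda>\<nu>. KL \<nu> (target_measure \<mu>0 \<iota> \<Phi>)) (\<lambda>\<nu>. \<nu> \<in> mixtures N A) \<nu>) \<and>
         (\<forall>\<nu>. is_arg_min (\<lambda>\<nu>. KL \<nu> (target_measure \<mu>0 \<iota> \<Phi>)) (\<lambda>\<nu>. \<nu> \<in> mixtures N A) \<nu> \<longrightarrow>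
              equivalent_measures \<nu> \<mu>0)"
proof -
  let ?\<mu> = "target_measure \<mu>0 \<iota> \<Phi>"
  have G0: "gaussian_measure \<mu>0" by fact
  note p0 = gaussian_prob_space[OF G0] and s0 = gaussian_sets[OF G0]
  note \<mu> = target_measure_props[OF p0 s0 \<open>range \<iota> \<in> sets borel\<close> \<open>emeasure \<mu>0 (range \<iota>) = 1\<close>
    \<open>set_integrable \<mu>0 (range \<iota>) (\<lambda>x. exp (- \<Phi> (inv \<iota> x)))\<close>]
  \<comment> \<open>In this form strict positivity of \<open>C0\<close> enters the dichotomy: no
    non-trivial marginal of \<open>\<mu>0\<close> is degenerate.\<close>
  have pos: "0 < gcov \<mu>0 h h" if "h \<noteq> 0" for h
    using \<open>strictly_positive C0\<close> that has_covariance_gcov[OF G0 \<open>has_covariance \<mu>0 C0\<close>, of h h]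
    unfolding strictly_positive_def by simp
  have equiv: "equivalent_measures \<nu> \<mu>0" if "gaussian_measure \<nu>" "absolutely_continuous \<mu>0 \<nu>" for \<nu>
    using gaussian_ac_imp_ac[OF G0 that pos] that(2) unfolding equivalent_measures_def by blast
  have AG: "gaussian_measure \<nu>" if "\<nu> \<in> A" for \<nu>
    using assms(12) that by blast
  then have A: "prob_space \<nu> \<and> sets \<nu> = sets borel" if "\<nu> \<in> A" for \<nu>
    using gaussian_prob_space gaussian_sets that by blast
  have closed: "L \<in> A"
    if V: "\<And>n. V n \<in> A" and L: "prob_space L" "sets L = sets borel" and lim: "setwise_limit V L"
      and ac: "absolutely_continuous ?\<mu> L" for V :: "nat \<Rightarrow> 'h measure" and L
  proof -
    note VG = AG[OF V]
    have G: "gaussian_measure L" by (rule gaussian_setwise_limit[OF VG L lim])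
    \<comment> \<open>Domination of \<open>L\<close> by \<open>\<mu>0\<close> comes with the limit;
      the converse direction, which the second class demands, is the dichotomy for the Gaussian
      limit.\<close>
    have "equivalent_measures L \<mu>0"
      by (rule equiv[OF G absolutely_continuous_trans[OF \<mu>(3) ac]])
    moreover have "has_covariance L C" if "\<And>n. has_covariance (V n) C" for C
      by (rule has_covariance_setwise_limit[OF VG L lim that])
    moreover have "has_mean L m" if "\<And>n. has_mean (V n) m" for m
      by (rule has_mean_setwise_limit[OF VG L lim that])
    ultimately show ?thesis
      using assms(12) G V by (elim disjE exE conjE) auto
  qed
  obtain w where w: "w \<in> A" "KL w ?\<mu> < \<infinity>" using assms(14) by blast
  have "equivalent_measures \<nu> \<mu>0"
    if min: "is_arg_min (\<lambda>\<nu>. KL \<nu> ?\<mu>) (\<lambda>\<nu>. \<nu> \<in> mixtures N A) \<nu>" for \<nu>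
  proof -
    have \<nu>: "\<nu> \<in> mixtures N A" using min by (simp add: is_arg_min_def)
    \<comment> \<open>Comparison with \<open>w\<close> makes the minimal value finite, and a finite
      divergence entails absolute continuity.\<close>
    have "KL \<nu> ?\<mu> \<le> KL w ?\<mu>"
      using min mixtureI_single[OF w(1) \<open>N \<ge> 1\<close> A] unfolding is_arg_min_def by (meson not_le)
    then have "KL \<nu> ?\<mu> < \<infinity>" using w(2) by (rule le_less_trans)
    then have "absolutely_continuous ?\<mu> \<nu>" unfolding KL_def by (auto split: if_splits)
    then have ac: "absolutely_continuous \<mu>0 \<nu>" by (rule absolutely_continuous_trans[OF \<mu>(3)])
    have "\<forall>\<nu>\<in>A. prob_space \<nu> \<and> sets \<nu> = sets borel" using A by blast
    from mixtureE[OF \<nu> this] obtain p V where pV: "\<forall>i\<in>{1..N}. 0 \<le> p i \<and> p i \<le> 1 \<and> V i \<in> A"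
      and psum: "(\<Sum>i=1..N. p i) = (1::real)"
      and m: "\<forall>B\<in>sets borel. measure \<nu> B = (\<Sum>i=1..N. p i * measure (V i) B)"
      and \<nu>p: "prob_space \<nu>" "sets \<nu> = sets borel"
      by (elim exE conjE) blast
    \<comment> \<open>A mixture is not Gaussian, so the dichotomy is applied to one component of
      positive weight: it is dominated by the mixture and, being equivalent to
      \<open>\<mu>0\<close>, passes the domination on to \<open>\<mu>0\<close>.\<close>
    have "\<exists>i\<in>{1..N}. p i \<noteq> 0" using psum sum.neutral[of "{1..N}" p] by fastforce
    then obtain i where i: "i \<in> {1..N}" "p i \<noteq> 0" ..
    then have pi: "p i > 0" using pV by force
    have Vi: "V i \<in> A" using pV i(1) by blast
    interpret \<nu>: prob_space \<nu> by fact
    interpret V: prob_space "V i" using A[OF Vi] by blast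
    have "absolutely_continuous \<nu> (V i)"
      unfolding absolutely_continuous_def
    proof
      fix B assume "B \<in> null_sets \<nu>"
      then have B: "B \<in> sets borel" "measure \<nu> B = 0" using \<nu>p(2) by (auto simp: null_sets_def measure_def)
      have "p i * measure (V i) B \<le> (\<Sum>i=1..N. p i * measure (V i) B)"
        using pV i(1) by (intro member_le_sum) auto
      also have "\<dots> = 0" using m B by simp
      finally have "p i * measure (V i) B \<le> 0" .
      then have "measure (V i) B = 0" using pi by (simp add: mult_le_0_iff measure_le_0_iff)
      then show "B \<in> null_sets (V i)" using B(1) A[OF Vi] by (simp add: null_sets_def V.emeasure_eq_measure)
    qed
    moreover from this have "equivalent_measures (V i) \<mu>0"
      by (intro equiv[OF AG[OF Vi]] absolutely_continuous_trans[OF ac])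
    ultimately have "absolutely_continuous \<nu> \<mu>0"
      unfolding equivalent_measures_def using absolutely_continuous_trans by blast
    then show ?thesis using ac by (simp add: equivalent_measures_def)
  qed
  moreover have "\<exists>\<nu>. is_arg_min (\<lambda>\<nu>. KL \<nu> ?\<mu>) (\<lambda>\<nu>. \<nu> \<in> mixtures N A) \<nu>"
    using mixture_minimiser_exists[OF \<mu>(1,2) \<open>N \<ge> 1\<close> A closed w] .
  ultimately show ?thesis by blast
qed

end
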